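(* Let $M$ be a 3-manifold with an enriched path structure $(T^1,T^2,L)$, let $Y_2\to M$ be its coframe bundle, and let $Y\to E\to M$ be the coframe bundle of the underlying path structure $(T^1,T^2)$. There exists a unique embedding $\iota_2:Y_2\to Y$ satisfying $\iota_2^*(\omega)=\omega$, $\iota_2^*(\omega^1)=\omega^1$, $\iota_2^*(\omega^2)=\omega^2$ and $\iota_2^*(\phi)=\phi$. (By abuse of language the forms of $Y_2$ and $Y$ are written with the same letters: inside $\iota_2^*(\cdot)$ they are the forms of $Y$, and on the right-hand sides they are the forms of $Y_2$.)
   Context: A path structure on a 3-manifold $M$ is a pair of line subbundles $T^1,T^2\subset TM$ with $T^1\cap T^2=\{0\}$ and $D=T^1\oplus T^2$ a contact distribution. An enriched path structure is a path structure together with a line field $L$ such that $TM=T^1\oplus T^2\oplus L$. Bundle $Y_2$: let $(\theta^1,\theta^2,\theta)$ be the coframe dual to a frame $X_1\in T^1$, $X_2\in T^2$, $X\in L$. One considers the coframes $\omega=\lambda\theta$, $\omega^1=a^1\theta^1$, $\omega^2=a^2\theta^2$ with $a^1,a^2,\lambda>0$ (positivity being supposed for simplicity) which satisfy $d\omega|_D=(\omega^1\wedge\omega^2)|_D$ (for an extension of $\omega$ with kernel $D$). $Y_2$ is the bundle of these coframes $(\omega,\omega^1,\omega^2)$, called an $(\mathbb R^* )^2$-coframe bundle; the structure group acts by $(\omega,\omega^1,\omega^2)\mapsto(\lambda\omega,a^1\omega^1,a^2\omega^2)$ with $\lambda,a^1,a^2\in\mathbb R_+^*$ and $a^1a^2=\lambda$.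 The tautological 1-forms on $Y_2$ are denoted by the same letters, and $\phi,w$ are the unique 1-forms on $Y_2$ with $$d\omega=2\phi\wedge\omega+\omega^1\wedge\omega^2,\quad d\omega^1=\phi\wedge\omega^1+3w\wedge\omega^1+\tau^1_2\,\omega\wedge\omega^2,\quad d\omega^2=\phi\wedge\omega^2-3w\wedge\omega^2-\tau^2_1\,\omega\wedge\omega^1$$ for some functions $\tau^1_2,\tau^2_1$ on $Y_2$. Bundle $Y$: let $E\to M$ be the $\mathbb R^*$-bundle of all forms $\theta$ with $\ker\theta=D$, with its tautological 1-form $\omega$. The fibre of $Y$ over $\varepsilon\in E$ (lying over $x\in M$) is the set of coframes $(\omega,\omega^1,\omega^2,\phi)$ of $T^*_\varepsilon E$ where $\omega$ is the tautological form at $\varepsilon$, $\omega^1,\omega^2$ are pull-backs of covectors $\theta^1,\theta^2\in T_x^*M$ with $\theta^1|_{T^2}=0$, $\theta^1|_{T^1}\neq0$, $\theta^2|_{T^1}=0$, $\theta^2|_{T^2}\neq0$, and $d\omega=2\phi\wedge\omega+\omega^1\wedge\omega^2$ at $\varepsilon$. Two such coframes over the same point are related by $\omega'=\omega$, $\omega'^1=a^1\omega^1+v^1\omega$, $\omega'^2=a^2\omega^2+v^2\omega$, $\phi'=\phi-\frac12a^1v^2\omega^1+\frac12a^2v^1\omega^2+s\omega$, with $s,v^1,v^2\in\mathbb R$, $a^1,a^2\in\mathbb R^*$, $a^1a^2=1$. The corresponding tautological 1-forms on $Y$ are denoted $\omega,\omega^1,\omega^2,\phi$.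
   Formalization: The embedding is required to cover the identity of M, and uniqueness is among such embeddings; without this it fails, e.g. on the Heisenberg group, where lifts of left translations to Y_2 preserve all four forms and compose with ι_2 to give other embeddings. *)

theory Defs
  imports "HOL-Analysis.Analysis"
begin

section \<open>Smooth manifolds given by atlases\<close>

primrec Ck_on :: "nat \<Rightarrow> 'a::euclidean_space set \<Rightarrow> ('a \<Rightarrow> 'b::euclidean_space) \<Rightarrow> bool" where
  "Ck_on 0 S f = continuous_on S f"
| "Ck_on (Suc k) S f =
     (\<exists>f'. (\<forall>x\<in>S. (f has_derivative f' x) (at x)) \<and> (\<forall>v. Ck_on k S (\<lambda>x. f' x v)))"

text \<open>Only used for open \<^term>\<open>S\<close>.\<close>

definition smooth_on :: "'a::euclidean_space set \<Rightarrow> ('a \<Rightarrow> 'b::euclidean_space) \<Rightarrow> bool" where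
  "smooth_on S f \<longleftrightarrow> (\<forall>k. Ck_on k S f)"

type_synonym ('p, 'e) chart = "'p set \<times> ('p \<Rightarrow> 'e)"
type_synonym ('p, 'e) atlas = "('p, 'e) chart set"

abbreviation cinv :: "('p, 'e) chart \<Rightarrow> 'e \<Rightarrow> 'p" where
  "cinv c \<equiv> the_inv_into (fst c) (snd c)"

definition points :: "('p, 'e) atlas \<Rightarrow> 'p set" where
  "points A = \<Union> (fst ` A)"

definition mtop :: "('p, 'e::euclidean_space) atlas \<Rightarrow> 'p topology" where
  "mtop A = topology_generated_by {{p \<in> fst c. snd c p \<in> Q} | c Q. c \<in> A \<and> open Q}"

definition smooth_manifold :: "('p, 'e::euclidean_space) atlas \<Rightarrow> bool" where
  "smooth_manifold A \<longleftrightarrow>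
     (\<forall>c\<in>A. inj_on (snd c) (fst c) \<and> open (snd c ` fst c)) \<and>
     (\<forall>c\<in>A. \<forall>d\<in>A. open (snd c ` (fst c \<inter> fst d)) \<and>
        smooth_on (snd c ` (fst c \<inter> fst d)) (snd d \<circ> cinv c)) \<and>
     Hausdorff_space (mtop A) \<and> second_countable (mtop A)"

text \<open>
  The tangent space at \<open>p\<close> is the model space \<open>'e\<close>, identified with it through the
  preferred chart \<open>chart_at A p\<close>. In particular covectors at \<open>p\<close> are linear maps
  \<open>'e \<Rightarrow> real\<close>. \<open>tcoord\<close> gives the components of a tangent vector at \<open>p\<close> in another chart,
  \<open>tvec\<close> is the tangent vector at \<open>p\<close> with given components in another chart.
\<close>

definition chart_at :: "('p, 'e) atlas \<Rightarrow> 'p \<Rightarrow> ('p, 'e) chart" where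
  "chart_at A p = (SOME c. c \<in> A \<and> p \<in> fst c)"

definition tcoord :: "('p, 'e::euclidean_space) atlas \<Rightarrow> ('p, 'e) chart \<Rightarrow> 'p \<Rightarrow> 'e \<Rightarrow> 'e" where
  "tcoord A c p v =
     frechet_derivative (snd c \<circ> cinv (chart_at A p)) (at (snd (chart_at A p) p)) v"

definition tvec :: "('p, 'e::euclidean_space) atlas \<Rightarrow> ('p, 'e) chart \<Rightarrow> 'p \<Rightarrow> 'e \<Rightarrow> 'e" where
  "tvec A c p h = frechet_derivative (snd (chart_at A p) \<circ> cinv c) (at (snd c p)) h"

definition tangent_map ::
  "('p, 'e::euclidean_space) atlas \<Rightarrow> ('q, 'f::euclidean_space) atlas \<Rightarrow> ('p \<Rightarrow> 'q) \<Rightarrow> 'p \<Rightarrow> 'e \<Rightarrow> 'f" where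
  "tangent_map A B F p v =
     frechet_derivative (snd (chart_at B (F p)) \<circ> F \<circ> cinv (chart_at A p))
       (at (snd (chart_at A p) p)) v"

definition smooth_map ::
  "'p set \<Rightarrow> ('p, 'e::euclidean_space) atlas \<Rightarrow> ('q, 'f::euclidean_space) atlas \<Rightarrow> ('p \<Rightarrow> 'q) \<Rightarrow> bool" where
  "smooth_map P A B F \<longleftrightarrow>
     (\<forall>p\<in>P. \<exists>c\<in>A. \<exists>d\<in>B. \<exists>W. p \<in> fst c \<and> F p \<in> fst d \<and>
        open W \<and> snd c p \<in> W \<and> W \<subseteq> snd c ` fst c \<and> F ` cinv c ` W \<subseteq> fst d \<and>
        smooth_on W (snd d \<circ> F \<circ> cinv c))"

definition smooth_embedding ::
  "'p set \<Rightarrow> ('p, 'e::euclidean_space) atlas \<Rightarrow> 'q set \<Rightarrow> ('q, 'f::euclidean_space) atlas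
    \<Rightarrow> ('p \<Rightarrow> 'q) \<Rightarrow> bool" where
  "smooth_embedding P A Q B F \<longleftrightarrow>
     F ` P \<subseteq> Q \<and> smooth_map P A B F \<and>
     (\<forall>p\<in>P. inj (tangent_map A B F p)) \<and>
     embedding_map (mtop A) (mtop B) F"

section \<open>Vector fields and differential forms\<close>

definition vector_field_on ::
  "('p, 'e::euclidean_space) atlas \<Rightarrow> 'p set \<Rightarrow> ('p \<Rightarrow> 'e) \<Rightarrow> bool" where
  "vector_field_on A U X \<longleftrightarrow>
     (\<forall>c\<in>A. smooth_on (snd c ` (fst c \<inter> U)) (\<lambda>u. tcoord A c (cinv c u) (X (cinv c u))))"

definition form_on ::
  "('p, 'e::euclidean_space) atlas \<Rightarrow> 'p set \<Rightarrow> ('p \<Rightarrow> 'e \<Rightarrow> real) \<Rightarrow> bool" where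
  "form_on A U \<alpha> \<longleftrightarrow>
     (\<forall>p\<in>U. linear (\<alpha> p)) \<and>
     (\<forall>c\<in>A. \<forall>h. smooth_on (snd c ` (fst c \<inter> U)) (\<lambda>u. \<alpha> (cinv c u) (tvec A c (cinv c u) h)))"

text \<open>
  The exterior derivative of a 1-form, computed in the preferred chart (by naturality any
  chart gives the same result), with the conventions
  \<open>d\<alpha>(X,Y) = X \<alpha>(Y) - Y \<alpha>(X) - \<alpha>([X,Y])\<close> and
  \<open>(\<alpha> \<and> \<beta>)(v,w) = \<alpha>(v) \<beta>(w) - \<alpha>(w) \<beta>(v)\<close>.
\<close>

definition ext_deriv ::
  "('p, 'e::euclidean_space) atlas \<Rightarrow> ('p \<Rightarrow> 'e \<Rightarrow> real) \<Rightarrow> 'p \<Rightarrow> 'e \<Rightarrow> 'e \<Rightarrow> real" where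
  "ext_deriv A \<alpha> p v w =
     (let c = chart_at A p; \<alpha>c = (\<lambda>h u. \<alpha> (cinv c u) (tvec A c (cinv c u) h))
      in frechet_derivative (\<alpha>c w) (at (snd c p)) v - frechet_derivative (\<alpha>c v) (at (snd c p)) w)"

definition wedge :: "('e \<Rightarrow> real) \<Rightarrow> ('e \<Rightarrow> real) \<Rightarrow> 'e \<Rightarrow> 'e \<Rightarrow> real" where
  "wedge \<alpha> \<beta> v w = \<alpha> v * \<beta> w - \<alpha> w * \<beta> v"

definition wedge12 :: "('e \<Rightarrow> real) \<Rightarrow> ('e \<Rightarrow> 'e \<Rightarrow> real) \<Rightarrow> 'e \<Rightarrow> 'e \<Rightarrow> 'e \<Rightarrow> real" where
  "wedge12 \<alpha> \<beta> u v w = \<alpha> u * \<beta> v w + \<alpha> v * \<beta> w u + \<alpha> w * \<beta> u v"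

definition line_subbundle ::
  "('p, 'e::euclidean_space) atlas \<Rightarrow> ('p \<Rightarrow> 'e set) \<Rightarrow> bool" where
  "line_subbundle A T \<longleftrightarrow>
     (\<forall>p\<in>points A. \<exists>U X. openin (mtop A) U \<and> p \<in> U \<and> vector_field_on A U X \<and>
        (\<forall>q\<in>U. X q \<noteq> 0 \<and> T q = span {X q}))"

definition kernel_on :: "'p set \<Rightarrow> ('p \<Rightarrow> 'e set) \<Rightarrow> ('p \<Rightarrow> 'e \<Rightarrow> real) \<Rightarrow> bool" where
  "kernel_on U D \<theta> \<longleftrightarrow> (\<forall>p\<in>U. {v. \<theta> p v = 0} = D p)"

definition contact_distribution ::
  "('p, 'e::euclidean_space) atlas \<Rightarrow> ('p \<Rightarrow> 'e set) \<Rightarrow> bool" where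
  "contact_distribution A D \<longleftrightarrow>
     (\<forall>p\<in>points A. \<exists>U \<theta>. openin (mtop A) U \<and> p \<in> U \<and> form_on A U \<theta> \<and> kernel_on U D \<theta> \<and>
        (\<forall>q\<in>U. \<exists>u v w. wedge12 (\<theta> q) (ext_deriv A \<theta> q) u v w \<noteq> 0))"

section \<open>Path structures\<close>

type_synonym 'm mfd3 = "('m, real^3) atlas"
type_synonym 'm dist3 = "'m \<Rightarrow> (real^3) set"
type_synonym covector = "real^3 \<Rightarrow> real"

definition dsum :: "'m dist3 \<Rightarrow> 'm dist3 \<Rightarrow> 'm dist3" where
  "dsum T1 T2 p = {u + v | u v. u \<in> T1 p \<and> v \<in> T2 p}"

definition path_structure :: "'m mfd3 \<Rightarrow> 'm dist3 \<Rightarrow> 'm dist3 \<Rightarrow> bool" where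
  "path_structure M T1 T2 \<longleftrightarrow>
     line_subbundle M T1 \<and> line_subbundle M T2 \<and>
     (\<forall>p\<in>points M. T1 p \<inter> T2 p = {0}) \<and>
     contact_distribution M (dsum T1 T2)"

definition enriched_path_structure ::
  "'m mfd3 \<Rightarrow> 'm dist3 \<Rightarrow> 'm dist3 \<Rightarrow> 'm dist3 \<Rightarrow> bool" where
  "enriched_path_structure M T1 T2 L \<longleftrightarrow>
     path_structure M T1 T2 \<and> line_subbundle M L \<and>
     (\<forall>p\<in>points M. \<forall>v. \<exists>!(v1, v2, l).
        v1 \<in> T1 p \<and> v2 \<in> T2 p \<and> l \<in> L p \<and> v = v1 + v2 + l)"

section \<open>The bundle $E$\<close>

type_synonym 'm contact_covector = "'m \<times> covector"
type_synonym E_model = "(real^3) \<times> real"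

definition E_set :: "'m mfd3 \<Rightarrow> 'm dist3 \<Rightarrow> 'm dist3 \<Rightarrow> 'm contact_covector set" where
  "E_set M T1 T2 = {(x, t). x \<in> points M \<and> linear t \<and> {v. t v = 0} = dsum T1 T2 x}"

text \<open>
  The charts of \<open>E\<close> are the local trivialisations by smooth local sections \<open>\<theta>\<close>, combined
  with charts of \<open>M\<close>: they map \<open>r \<theta>\<^sub>x\<close> to \<open>(x, r)\<close>. The bundles below are treated
  in the same way.
\<close>

definition E_atlas ::
  "'m mfd3 \<Rightarrow> 'm dist3 \<Rightarrow> 'm dist3 \<Rightarrow> ('m contact_covector, E_model) atlas" where
  "E_atlas M T1 T2 =
     {({e \<in> E_set M T1 T2. fst e \<in> W},
       \<lambda>e. (snd c (fst e), THE r. snd e = (\<lambda>v. r * \<theta> (fst e) v))) | c W \<theta>.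
      c \<in> M \<and> openin (mtop M) W \<and> W \<subseteq> fst c \<and> form_on M W \<theta> \<and> kernel_on W (dsum T1 T2) \<theta>}"

definition E_proj ::
  "'m mfd3 \<Rightarrow> 'm dist3 \<Rightarrow> 'm dist3 \<Rightarrow> 'm contact_covector \<Rightarrow> E_model \<Rightarrow> real^3" where
  "E_proj M T1 T2 = tangent_map (E_atlas M T1 T2) M fst"

definition E_taut ::
  "'m mfd3 \<Rightarrow> 'm dist3 \<Rightarrow> 'm dist3 \<Rightarrow> 'm contact_covector \<Rightarrow> E_model \<Rightarrow> real" where
  "E_taut M T1 T2 e = snd e \<circ> E_proj M T1 T2 e"

section \<open>The bundle $Y$\<close>

type_synonym E_covector = "E_model \<Rightarrow> real"
type_synonym E_coframe = "E_covector \<times> E_covector \<times> E_covector \<times> E_covector"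
type_synonym 'm Y_point = "'m contact_covector \<times> E_coframe"
type_synonym Y_model = "E_model \<times> real \<times> real \<times> real \<times> real"

definition Y_fibre ::
  "'m mfd3 \<Rightarrow> 'm dist3 \<Rightarrow> 'm dist3 \<Rightarrow> 'm contact_covector \<Rightarrow> E_coframe set" where
  "Y_fibre M T1 T2 e = {(w, w1, w2, f).
     linear w \<and> linear w1 \<and> linear w2 \<and> linear f \<and> bij (\<lambda>v. (w v, w1 v, w2 v, f v)) \<and>
     w = E_taut M T1 T2 e \<and>
     (\<exists>t1. linear t1 \<and> (\<forall>v\<in>T2 (fst e). t1 v = 0) \<and> (\<exists>v\<in>T1 (fst e). t1 v \<noteq> 0) \<and>
        w1 = t1 \<circ> E_proj M T1 T2 e) \<and>
     (\<exists>t2. linear t2 \<and> (\<forall>v\<in>T1 (fst e). t2 v = 0) \<and> (\<exists>v\<in>T2 (fst e). t2 v \<noteq> 0) \<and>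
        w2 = t2 \<circ> E_proj M T1 T2 e) \<and>
     (\<forall>u v. ext_deriv (E_atlas M T1 T2) (E_taut M T1 T2) e u v = 2 * wedge f w u v + wedge w1 w2 u v)}"

definition Y_set :: "'m mfd3 \<Rightarrow> 'm dist3 \<Rightarrow> 'm dist3 \<Rightarrow> 'm Y_point set" where
  "Y_set M T1 T2 = {(e, q). e \<in> E_set M T1 T2 \<and> q \<in> Y_fibre M T1 T2 e}"

text \<open>The action of the structure group, with \<open>a1 = a\<close> and \<open>a2 = 1 / a\<close>.\<close>

fun Y_act :: "real \<times> real \<times> real \<times> real \<Rightarrow> E_coframe \<Rightarrow> E_coframe" where
  "Y_act (a, v1, v2, s) (w, w1, w2, f) =
     (w,
      \<lambda>h. a * w1 h + v1 * w h,
      \<lambda>h. (1 / a) * w2 h + v2 * w h,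
      \<lambda>h. f h - 1/2 * a * v2 * w1 h + 1/2 * (1 / a) * v1 * w2 h + s * w h)"

definition Y_atlas :: "'m mfd3 \<Rightarrow> 'm dist3 \<Rightarrow> 'm dist3 \<Rightarrow> ('m Y_point, Y_model) atlas" where
  "Y_atlas M T1 T2 =
     {({y \<in> Y_set M T1 T2. fst y \<in> V},
       \<lambda>y. (snd c (fst y),
            THE g. fst g \<noteq> 0 \<and> snd y = Y_act g (E_taut M T1 T2 (fst y), \<eta>1 (fst y), \<eta>2 (fst y), \<psi> (fst y))))
      | c V \<eta>1 \<eta>2 \<psi>.
      c \<in> E_atlas M T1 T2 \<and> openin (mtop (E_atlas M T1 T2)) V \<and> V \<subseteq> fst c \<and>
      form_on (E_atlas M T1 T2) V \<eta>1 \<and> form_on (E_atlas M T1 T2) V \<eta>2 \<and>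
      form_on (E_atlas M T1 T2) V \<psi> \<and>
      (\<forall>e\<in>V. (E_taut M T1 T2 e, \<eta>1 e, \<eta>2 e, \<psi> e) \<in> Y_fibre M T1 T2 e)}"

definition Y_proj :: "'m mfd3 \<Rightarrow> 'm dist3 \<Rightarrow> 'm dist3 \<Rightarrow> 'm Y_point \<Rightarrow> Y_model \<Rightarrow> E_model" where
  "Y_proj M T1 T2 = tangent_map (Y_atlas M T1 T2) (E_atlas M T1 T2) fst"

definition Y_omega :: "'m mfd3 \<Rightarrow> 'm dist3 \<Rightarrow> 'm dist3 \<Rightarrow> 'm Y_point \<Rightarrow> Y_model \<Rightarrow> real" where
  "Y_omega M T1 T2 y = (case snd y of (w, w1, w2, f) \<Rightarrow> w \<circ> Y_proj M T1 T2 y)"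

definition Y_omega1 :: "'m mfd3 \<Rightarrow> 'm dist3 \<Rightarrow> 'm dist3 \<Rightarrow> 'm Y_point \<Rightarrow> Y_model \<Rightarrow> real" where
  "Y_omega1 M T1 T2 y = (case snd y of (w, w1, w2, f) \<Rightarrow> w1 \<circ> Y_proj M T1 T2 y)"

definition Y_omega2 :: "'m mfd3 \<Rightarrow> 'm dist3 \<Rightarrow> 'm dist3 \<Rightarrow> 'm Y_point \<Rightarrow> Y_model \<Rightarrow> real" where
  "Y_omega2 M T1 T2 y = (case snd y of (w, w1, w2, f) \<Rightarrow> w2 \<circ> Y_proj M T1 T2 y)"

definition Y_phi :: "'m mfd3 \<Rightarrow> 'm dist3 \<Rightarrow> 'm dist3 \<Rightarrow> 'm Y_point \<Rightarrow> Y_model \<Rightarrow> real" where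
  "Y_phi M T1 T2 y = (case snd y of (w, w1, w2, f) \<Rightarrow> f \<circ> Y_proj M T1 T2 y)"

section \<open>The bundle $Y_2$ of an enriched path structure\<close>

type_synonym 'm Y2_point = "'m \<times> covector \<times> covector \<times> covector"
type_synonym Y2_model = "(real^3) \<times> real \<times> real"

definition adapted_frame ::
  "'m mfd3 \<Rightarrow> 'm dist3 \<Rightarrow> 'm dist3 \<Rightarrow> 'm dist3 \<Rightarrow> 'm set
    \<Rightarrow> ('m \<Rightarrow> real^3) \<Rightarrow> ('m \<Rightarrow> real^3) \<Rightarrow> ('m \<Rightarrow> real^3) \<Rightarrow> bool" where
  "adapted_frame M T1 T2 L W X1 X2 X \<longleftrightarrow>
     vector_field_on M W X1 \<and> vector_field_on M W X2 \<and> vector_field_on M W X \<and>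
     (\<forall>x\<in>W. X1 x \<in> T1 x \<and> X2 x \<in> T2 x \<and> X x \<in> L x \<and> X1 x \<noteq> 0 \<and> X2 x \<noteq> 0 \<and> X x \<noteq> 0)"

definition dual_coframe ::
  "real^3 \<Rightarrow> real^3 \<Rightarrow> real^3 \<Rightarrow> covector \<Rightarrow> covector \<Rightarrow> covector \<Rightarrow> bool" where
  "dual_coframe X1 X2 X t1 t2 t \<longleftrightarrow>
     linear t1 \<and> linear t2 \<and> linear t \<and>
     t1 X1 = 1 \<and> t1 X2 = 0 \<and> t1 X = 0 \<and>
     t2 X1 = 0 \<and> t2 X2 = 1 \<and> t2 X = 0 \<and>
     t X1 = 0 \<and> t X2 = 0 \<and> t X = 1"

text \<open>
  The coframes \<open>(\<lambda> \<theta>, a1 \<theta>\<^sup>1, a2 \<theta>\<^sup>2)\<close> at \<open>x\<close> with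
  \<open>d\<omega> = \<omega>\<^sup>1 \<and> \<omega>\<^sup>2\<close> on \<open>D\<close>; \<open>\<Omega>\<close> is an extension of \<open>\<omega>\<close> to a local form with kernel \<open>D\<close>.
\<close>

definition Y2_fibre ::
  "'m mfd3 \<Rightarrow> 'm dist3 \<Rightarrow> 'm dist3 \<Rightarrow> real^3 \<Rightarrow> real^3 \<Rightarrow> real^3 \<Rightarrow> 'm
    \<Rightarrow> (covector \<times> covector \<times> covector) set" where
  "Y2_fibre M T1 T2 X1 X2 X x = {(w, w1, w2).
     (\<exists>t1 t2 t a1 a2 l. dual_coframe X1 X2 X t1 t2 t \<and> a1 > 0 \<and> a2 > 0 \<and> l > 0 \<and>
        w = (\<lambda>v. l * t v) \<and> w1 = (\<lambda>v. a1 * t1 v) \<and> w2 = (\<lambda>v. a2 * t2 v)) \<and>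
     (\<exists>U \<Omega>. openin (mtop M) U \<and> x \<in> U \<and> form_on M U \<Omega> \<and> kernel_on U (dsum T1 T2) \<Omega> \<and> \<Omega> x = w \<and>
        (\<forall>u\<in>dsum T1 T2 x. \<forall>v\<in>dsum T1 T2 x. ext_deriv M \<Omega> x u v = wedge w1 w2 u v))}"

definition Y2_trivialising ::
  "'m mfd3 \<Rightarrow> 'm dist3 \<Rightarrow> 'm dist3 \<Rightarrow> 'm dist3 \<Rightarrow> 'm Y2_point set \<Rightarrow> 'm set
    \<Rightarrow> ('m \<Rightarrow> real^3) \<Rightarrow> ('m \<Rightarrow> real^3) \<Rightarrow> ('m \<Rightarrow> real^3) \<Rightarrow> bool" where
  "Y2_trivialising M T1 T2 L Y2 W X1 X2 X \<longleftrightarrow>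
     openin (mtop M) W \<and> adapted_frame M T1 T2 L W X1 X2 X \<and>
     (\<forall>x\<in>W. {q. (x, q) \<in> Y2} = Y2_fibre M T1 T2 (X1 x) (X2 x) (X x) x)"

text \<open>
  Positivity of \<open>a1, a2, \<lambda>\<close> refers to a frame, so \<open>Y\<^sub>2\<close> depends on the orientations of
  \<open>T\<^sup>1, T\<^sup>2, L\<close> which the frame defines. A global frame is not required: \<open>Y\<^sub>2\<close> is described
  over each member of an open cover by a local frame. Nonempty fibres mean that
  the orientations satisfy \<open>d\<theta>(X\<^sub>1, X\<^sub>2) > 0\<close>, which is necessary for the normalisation
  \<open>\<lambda> d\<theta>(X\<^sub>1, X\<^sub>2) = a1 a2\<close> to have positive solutions.
\<close>

definition Y2_bundle ::
  "'m mfd3 \<Rightarrow> 'm dist3 \<Rightarrow> 'm dist3 \<Rightarrow> 'm dist3 \<Rightarrow> 'm Y2_point set \<Rightarrow> bool" where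
  "Y2_bundle M T1 T2 L Y2 \<longleftrightarrow>
     fst ` Y2 = points M \<and>
     (\<forall>x\<in>points M. \<exists>W X1 X2 X. x \<in> W \<and> Y2_trivialising M T1 T2 L Y2 W X1 X2 X)"

definition Y2_atlas ::
  "'m mfd3 \<Rightarrow> 'm dist3 \<Rightarrow> 'm dist3 \<Rightarrow> 'm dist3 \<Rightarrow> 'm Y2_point set \<Rightarrow> ('m Y2_point, Y2_model) atlas" where
  "Y2_atlas M T1 T2 L Y2 =
     {({y \<in> Y2. fst y \<in> W}, \<lambda>(x, w, w1, w2). (snd c x, w1 (X1 x), w2 (X2 x))) | c W X1 X2 X.
      c \<in> M \<and> W \<subseteq> fst c \<and> Y2_trivialising M T1 T2 L Y2 W X1 X2 X}"

definition Y2_proj ::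
  "'m mfd3 \<Rightarrow> 'm dist3 \<Rightarrow> 'm dist3 \<Rightarrow> 'm dist3 \<Rightarrow> 'm Y2_point set \<Rightarrow> 'm Y2_point \<Rightarrow> Y2_model \<Rightarrow> real^3" where
  "Y2_proj M T1 T2 L Y2 = tangent_map (Y2_atlas M T1 T2 L Y2) M fst"

definition Y2_omega ::
  "'m mfd3 \<Rightarrow> 'm dist3 \<Rightarrow> 'm dist3 \<Rightarrow> 'm dist3 \<Rightarrow> 'm Y2_point set \<Rightarrow> 'm Y2_point \<Rightarrow> Y2_model \<Rightarrow> real" where
  "Y2_omega M T1 T2 L Y2 y = (case snd y of (w, w1, w2) \<Rightarrow> w \<circ> Y2_proj M T1 T2 L Y2 y)"

definition Y2_omega1 ::
  "'m mfd3 \<Rightarrow> 'm dist3 \<Rightarrow> 'm dist3 \<Rightarrow> 'm dist3 \<Rightarrow> 'm Y2_point set \<Rightarrow> 'm Y2_point \<Rightarrow> Y2_model \<Rightarrow> real" where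
  "Y2_omega1 M T1 T2 L Y2 y = (case snd y of (w, w1, w2) \<Rightarrow> w1 \<circ> Y2_proj M T1 T2 L Y2 y)"

definition Y2_omega2 ::
  "'m mfd3 \<Rightarrow> 'm dist3 \<Rightarrow> 'm dist3 \<Rightarrow> 'm dist3 \<Rightarrow> 'm Y2_point set \<Rightarrow> 'm Y2_point \<Rightarrow> Y2_model \<Rightarrow> real" where
  "Y2_omega2 M T1 T2 L Y2 y = (case snd y of (w, w1, w2) \<Rightarrow> w2 \<circ> Y2_proj M T1 T2 L Y2 y)"

definition Y2_structure_equations ::
  "'m mfd3 \<Rightarrow> 'm dist3 \<Rightarrow> 'm dist3 \<Rightarrow> 'm dist3 \<Rightarrow> 'm Y2_point set
    \<Rightarrow> ('m Y2_point \<Rightarrow> Y2_model \<Rightarrow> real) \<Rightarrow> ('m Y2_point \<Rightarrow> Y2_model \<Rightarrow> real)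
    \<Rightarrow> ('m Y2_point \<Rightarrow> real) \<Rightarrow> ('m Y2_point \<Rightarrow> real) \<Rightarrow> bool" where
  "Y2_structure_equations M T1 T2 L Y2 \<phi> w \<tau>12 \<tau>21 \<longleftrightarrow>
     (let A = Y2_atlas M T1 T2 L Y2; \<omega> = Y2_omega M T1 T2 L Y2;
          \<omega>1 = Y2_omega1 M T1 T2 L Y2; \<omega>2 = Y2_omega2 M T1 T2 L Y2
      in \<forall>y\<in>Y2. \<forall>u v.
        ext_deriv A \<omega> y u v = 2 * wedge (\<phi> y) (\<omega> y) u v + wedge (\<omega>1 y) (\<omega>2 y) u v \<and>
        ext_deriv A \<omega>1 y u v =
          wedge (\<phi> y) (\<omega>1 y) u v + 3 * wedge (w y) (\<omega>1 y) u v + \<tau>12 y * wedge (\<omega> y) (\<omega>2 y) u v \<and>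
        ext_deriv A \<omega>2 y u v =
          wedge (\<phi> y) (\<omega>2 y) u v - 3 * wedge (w y) (\<omega>2 y) u v - \<tau>21 y * wedge (\<omega> y) (\<omega>1 y) u v)"

definition pulls_back ::
  "'p set \<Rightarrow> ('p, 'e::euclidean_space) atlas \<Rightarrow> ('q, 'f::euclidean_space) atlas \<Rightarrow> ('p \<Rightarrow> 'q)
    \<Rightarrow> ('q \<Rightarrow> 'f \<Rightarrow> real) \<Rightarrow> ('p \<Rightarrow> 'e \<Rightarrow> real) \<Rightarrow> bool" where
  "pulls_back P A B F \<beta> \<alpha> \<longleftrightarrow> (\<forall>p\<in>P. \<forall>v. \<beta> (F p) (tangent_map A B F p v) = \<alpha> p v)"

end

theory Submission
  imports Defs
begin

text \<open>
  Let \<open>p : Y\<^sub>2 \<rightarrow> E\<close> forget \<open>\<omega>\<^sup>1\<close> and \<open>\<omega>\<^sup>2\<close>; it is a submersion with one-dimensional fibres, and the form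
  \<open>\<omega>\<close> of \<open>Y\<^sub>2\<close> is the pull-back of the tautological form of \<open>E\<close>. The forms \<open>\<omega>\<^sup>1, \<omega>\<^sup>2\<close> are horizontal
  over \<open>M\<close>, and \<open>\<phi>\<close> vanishes on \<open>ker dp\<close>: insert a vertical vector into
  \<open>d\<omega> = 2 \<phi> \<and> \<omega> + \<omega>\<^sup>1 \<and> \<omega>\<^sup>2\<close>, whose left-hand side is pulled back from \<open>E\<close>. So there is exactly one
  coframe \<open>q\<close> at \<open>p(y)\<close> with \<open>q \<circ> dp = (\<omega>, \<omega>\<^sup>1, \<omega>\<^sup>2, \<phi>)\<close>; it lies in \<open>Y\<close> because \<open>dp\<close> is onto, and
  \<open>\<iota>\<^sub>2(y) = (p(y), q)\<close>.

  Conversely, let \<open>\<iota>\<close> cover the identity of \<open>M\<close> and pull the forms back correctly. Comparing the two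
  forms \<open>\<omega>\<close> shows that \<open>\<iota>\<close> lies over \<open>p\<close>, and the remaining forms then determine the coframe.

  Composing \<open>\<iota>\<^sub>2\<close> with local sections of \<open>p\<close> gives local sections of \<open>Y \<rightarrow> E\<close>. In the resulting charts
  \<open>\<iota>\<^sub>2\<close> has a smooth left inverse, hence is an embedding.
\<close>

text \<open>The four pull-back conditions alone do not single out a map: a symmetry of the enriched
  structure that preserves \<open>Y2\<close> lifts to a diffeomorphism of \<open>Y2\<close>
  preserving all these forms, and can be composed with any solution. Covering the identity of M
  excludes this.

  The obstacle is smoothness. Fibre coordinates of E and Y are given by \<open>THE\<close>, and
  tangent vectors are written in a preferred chart that may jump from point to point, so nothing is
  smooth by construction. Unknown coefficients in linear relations between smooth covector fields
  are therefore recovered by inner products, and vectors are always converted by \<open>tvec\<close>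
  and \<open>tcoord\<close>.

  Computing the exterior derivative of \<open>\<omega>\<close> on E requires naturality of d, hence
  the symmetry of second derivatives.

  With a local contact form \<open>\<Theta>\<close>, a frame and
  \<open>\<kappa> = d\<Theta>(X1, X2)\<close>, the projection from \<open>Y2\<close> to E reads
  \<open>(x, a, b) \<mapsto> (x, a b / \<kappa>)\<close>, where a and b are the values
  \<open>\<omega>1(X1)\<close> and \<open>\<omega>2(X2)\<close>. This shows that it is a submersion
  and yields its sections \<open>a = r \<kappa> / b\<close>.\<close>

abbreviation FD :: "('a::euclidean_space \<Rightarrow> 'b::euclidean_space) \<Rightarrow> 'a \<Rightarrow> 'a \<Rightarrow> 'b" where
  "FD f x \<equiv> frechet_derivative f (at x)"

section \<open>Calculus of smooth functions\<close>

lemma FD_eqI: "(f has_derivative f') (at x) \<Longrightarrow> FD f x = f'"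
  by (metis frechet_derivative_at)

lemma has_derivative_transform_open:
  assumes "(f has_derivative f') (at x)" "open S" "x \<in> S" "\<And>y. y \<in> S \<Longrightarrow> f y = g y"
  shows "(g has_derivative f') (at x)"
  using has_derivative_transform_within_open[OF assms(1,2,3)] assms(4) by blast

text \<open>No differentiability is required: both sides are the same choice, because the two
  functions have the same derivatives at \<open>x\<close>.\<close>

lemma FD_cong_open:
  assumes "open S" "x \<in> S" "\<And>y. y \<in> S \<Longrightarrow> f y = g y"
  shows "FD f x = FD g x"
proof -
  have "(f has_derivative D) (at x) \<longleftrightarrow> (g has_derivative D) (at x)" for D
    using has_derivative_transform_open[of f D x S g] has_derivative_transform_open[of g D x S f] assms
    by auto
  then show ?thesis by (simp add: frechet_derivative_def)
qed

section \<open>Closure properties of the classes C^k\<close>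

lemma Ck_on_subset: "Ck_on k S f \<Longrightarrow> T \<subseteq> S \<Longrightarrow> Ck_on k T f"
proof (induction k arbitrary: f)
  case 0 then show ?case by (auto intro: continuous_on_subset)
next
  case (Suc k)
  then obtain f' where "\<forall>x\<in>S. (f has_derivative f' x) (at x)" "\<forall>v. Ck_on k S (\<lambda>x. f' x v)" by auto
  with Suc show ?case by (auto intro!: exI[of _ f'])
qed

lemma Ck_on_cong:
  assumes "Ck_on k S f" "open S" "\<And>x. x \<in> S \<Longrightarrow> f x = g x"
  shows "Ck_on k S g"
proof (cases k)
  case 0 then show ?thesis using assms continuous_on_cong[of S S f g] by auto
next
  case (Suc j)
  then obtain f' where f': "\<forall>x\<in>S. (f has_derivative f' x) (at x)" "\<forall>v. Ck_on j S (\<lambda>x. f' x v)"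
    using assms by auto
  then have "\<forall>x\<in>S. (g has_derivative f' x) (at x)"
    using has_derivative_transform_open assms by blast
  with f' Suc show ?thesis by (auto intro!: exI[of _ f'])
qed

text \<open>Derivatives at a point are unique, so the existential witness in \<open>Ck_on\<close>
  can be replaced by the canonical \<open>FD f\<close>.\<close>

lemma Ck_on_Suc_FD:
  assumes "open S"
  shows "Ck_on (Suc k) S f \<longleftrightarrow>
    (\<forall>x\<in>S. (f has_derivative FD f x) (at x)) \<and> (\<forall>v. Ck_on k S (\<lambda>x. FD f x v))"
proof
  assume "Ck_on (Suc k) S f"
  then obtain f' where f': "\<forall>x\<in>S. (f has_derivative f' x) (at x)" "\<forall>v. Ck_on k S (\<lambda>x. f' x v)"
    by auto
  have eq: "FD f x = f' x" if "x \<in> S" for x using f' that FD_eqI by blast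
  show "(\<forall>x\<in>S. (f has_derivative FD f x) (at x)) \<and> (\<forall>v. Ck_on k S (\<lambda>x. FD f x v))"
    using f' eq Ck_on_cong[OF _ assms, of k "\<lambda>x. f' x _" "\<lambda>x. FD f x _"] by auto
qed auto

lemma Ck_on_continuous: "Ck_on k S f \<Longrightarrow> continuous_on S f"
  by (cases k)
    (auto intro!: continuous_at_imp_continuous_on simp: has_derivative_continuous)

lemma Ck_on_SucD: "Ck_on (Suc k) S f \<Longrightarrow> open S \<Longrightarrow> Ck_on k S f"
proof (induction k arbitrary: f)
  case 0 then show ?case using Ck_on_continuous[of "Suc 0" S f] by simp
next
  case (Suc k)
  then obtain f' where "\<forall>x\<in>S. (f has_derivative f' x) (at x)" "\<forall>v. Ck_on (Suc k) S (\<lambda>x. f' x v)"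
    by (auto simp del: Ck_on.simps simp: Ck_on.simps(2)[of "Suc k"])
  then have "\<forall>x\<in>S. (f has_derivative f' x) (at x)" "\<forall>v. Ck_on k S (\<lambda>x. f' x v)"
    using Suc.IH Suc.prems(2) by blast+
  then show ?case unfolding Ck_on.simps by blast
qed

text \<open>With \<open>FD f\<close> as the witness on every member, the derivatives on different
  members agree and there is nothing to glue.\<close>

lemma Ck_on_Union:
  assumes "\<And>N. N \<in> \<N> \<Longrightarrow> open N \<and> Ck_on k N f"
  shows "Ck_on k (\<Union>\<N>) f"
  using assms
proof (induction k arbitrary: f)
  case 0
  then show ?case by (auto intro!: continuous_on_open_Union)
next
  case (Suc k)
  have "Ck_on k (\<Union>\<N>) (\<lambda>x. FD f x v)" for v
    by (intro Suc.IH) (use Suc.prems Ck_on_Suc_FD in blast)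
  moreover have "(f has_derivative FD f x) (at x)" if "x \<in> \<Union>\<N>" for x
    using Suc.prems that Ck_on_Suc_FD by blast
  ultimately show ?case unfolding Ck_on.simps by (intro exI[of _ "\<lambda>x. FD f x"] conjI ballI allI)
qed

lemma Ck_on_local:
  assumes "\<And>x. x \<in> S \<Longrightarrow> \<exists>N. open N \<and> x \<in> N \<and> Ck_on k N f"
  shows "Ck_on k S f"
  by (rule Ck_on_subset[OF Ck_on_Union[of "{N. open N \<and> Ck_on k N f}"]]) (use assms in auto)

lemma Ck_on_const: "Ck_on k S (\<lambda>x. c)"
proof (induction k arbitrary: c)
  case (Suc k)
  show ?case using Suc[of 0] by (auto intro!: exI[of _ "\<lambda>x v. 0"])
qed simp

lemma Ck_on_linear:
  assumes "bounded_linear L" "Ck_on k S f"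
  shows "Ck_on k S (\<lambda>x. L (f x))"
  using assms(2)
proof (induction k arbitrary: f)
  case 0
  then show ?case using assms(1) by (auto intro: linear_continuous_on_compose bounded_linear.continuous_on)
next
  case (Suc k)
  then obtain f' where "\<forall>x\<in>S. (f has_derivative f' x) (at x)" "\<forall>v. Ck_on k S (\<lambda>x. f' x v)" by auto
  then show ?case
    using Suc.IH by (auto intro!: exI[of _ "\<lambda>x v. L (f' x v)"] bounded_linear.has_derivative[OF assms(1)])
qed

lemma Ck_on_add:
  assumes "Ck_on k S f" "Ck_on k S g"
  shows "Ck_on k S (\<lambda>x. f x + g x)"
  using assms
proof (induction k arbitrary: f g)
  case 0
  then show ?case by (auto intro: continuous_on_add)
next
  case (Suc k)
  then obtain f' where "\<forall>x\<in>S. (f has_derivative f' x) (at x)" "\<forall>v. Ck_on k S (\<lambda>x. f' x v)" by auto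
  moreover obtain g' where "\<forall>x\<in>S. (g has_derivative g' x) (at x)" "\<forall>v. Ck_on k S (\<lambda>x. g' x v)"
    using Suc by auto
  ultimately show ?case
    using Suc.IH by (auto intro!: exI[of _ "\<lambda>x v. f' x v + g' x v"] has_derivative_add)
qed

lemma Ck_on_sum:
  assumes "finite I" "\<And>i. i \<in> I \<Longrightarrow> Ck_on k S (f i)"
  shows "Ck_on k S (\<lambda>x. \<Sum>i\<in>I. f i x)"
  using assms by (induction I rule: finite_induct) (auto intro: Ck_on_const Ck_on_add)

lemma Ck_on_bilinear:
  assumes "bounded_bilinear bop" "open S" "Ck_on k S f" "Ck_on k S g"
  shows "Ck_on k S (\<lambda>x. bop (f x) (g x))"
  using assms(3,4)
proof (induction k arbitrary: f g)
  case 0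
  then show ?case using bounded_bilinear.continuous_on[OF assms(1)] by auto
next
  case (Suc k)
  then obtain f' where f': "\<forall>x\<in>S. (f has_derivative f' x) (at x)" "\<forall>v. Ck_on k S (\<lambda>x. f' x v)" by auto
  obtain g' where g': "\<forall>x\<in>S. (g has_derivative g' x) (at x)" "\<forall>v. Ck_on k S (\<lambda>x. g' x v)"
    using Suc by auto
  have fg: "Ck_on k S f" "Ck_on k S g" using Suc.prems Ck_on_SucD assms(2) by blast+
  show ?case
    unfolding Ck_on.simps
  proof (intro exI[of _ "\<lambda>x v. bop (f x) (g' x v) + bop (f' x v) (g x)"] conjI ballI allI)
    fix x assume "x \<in> S"
    then show "((\<lambda>x. bop (f x) (g x)) has_derivative (\<lambda>v. bop (f x) (g' x v) + bop (f' x v) (g x))) (at x)"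
      using f' g' bounded_bilinear.FDERIV[OF assms(1)] by blast
  next
    fix v show "Ck_on k S (\<lambda>x. bop (f x) (g' x v) + bop (f' x v) (g x))"
      using Suc.IH f' g' fg by (auto intro!: Ck_on_add)
  qed
qed

lemma Ck_on_id: "Ck_on k (S :: 'a::euclidean_space set) (\<lambda>x. x)"
  by (cases k) (auto intro!: exI[of _ "\<lambda>x v. v"] Ck_on_const)

lemma Ck_on_compose:
  fixes f :: "'a::euclidean_space \<Rightarrow> 'b::euclidean_space" and g :: "'b \<Rightarrow> 'c::euclidean_space"
  assumes "open S" "open T" "Ck_on k S f" "Ck_on k T g" "f ` S \<subseteq> T"
  shows "Ck_on k S (\<lambda>x. g (f x))"
  using assms(3,4)
proof (induction k arbitrary: g)
  case 0
  then show ?case using assms(5) continuous_on_compose2 by auto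
next
  case (Suc k)
  obtain f' where f': "\<forall>x\<in>S. (f has_derivative f' x) (at x)" "\<forall>v. Ck_on k S (\<lambda>x. f' x v)"
    using Suc by auto
  obtain g' where g': "\<forall>x\<in>T. (g has_derivative g' x) (at x)" "\<forall>v. Ck_on k T (\<lambda>x. g' x v)"
    using Suc by auto
  have fk: "Ck_on k S f" using Suc.prems Ck_on_SucD assms(1) by blast
  \<comment> \<open>The definition of \<open>Ck_on\<close> controls \<open>g' y b\<close> only for a
    fixed direction \<open>b\<close>, while the chain rule produces the moving direction
    \<open>f' x v\<close>. Expanding in the basis reduces to fixed directions.\<close>
  have eq: "(\<Sum>b\<in>Basis. (f' x v \<bullet> b) *\<^sub>R g' (f x) b) = g' (f x) (f' x v)" if "x \<in> S" for x v
  proof -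
    have "f x \<in> T" using that assms(5) by auto
    then have "linear (g' (f x))" using g'(1) has_derivative_linear by blast
    then have "g' (f x) (\<Sum>b\<in>Basis. (f' x v \<bullet> b) *\<^sub>R b) = (\<Sum>b\<in>Basis. (f' x v \<bullet> b) *\<^sub>R g' (f x) b)"
      by (simp add: linear_sum linear_scale)
    then show ?thesis by (simp add: euclidean_representation)
  qed
  show ?case
    unfolding Ck_on.simps
  proof (intro exI[of _ "\<lambda>x v. \<Sum>b\<in>Basis. (f' x v \<bullet> b) *\<^sub>R g' (f x) b"] conjI ballI allI)
    fix x assume x: "x \<in> S"
    then have "f x \<in> T" using assms(5) by auto
    then show "((\<lambda>x. g (f x)) has_derivative (\<lambda>v. \<Sum>b\<in>Basis. (f' x v \<bullet> b) *\<^sub>R g' (f x) b)) (at x)"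
      unfolding eq[OF x] using f' g' x has_derivative_compose by blast
  next
    fix v
    have "Ck_on k S (\<lambda>x. f' x v \<bullet> b)" for b
      by (rule Ck_on_linear[OF bounded_linear_inner_left]) (use f' in auto)
    moreover have "Ck_on k S (\<lambda>x. g' (f x) b)" for b
      by (rule Suc.IH[OF fk]) (use g' in auto)
    ultimately show "Ck_on k S (\<lambda>x. \<Sum>b\<in>Basis. (f' x v \<bullet> b) *\<^sub>R g' (f x) b)"
      by (intro Ck_on_sum Ck_on_bilinear[OF bounded_bilinear_scaleR assms(1)]) auto
  qed
qed

text \<open>The derivative is a polynomial in \<open>inverse x\<close> itself, so the induction
  hypothesis closes the step.\<close>

lemma Ck_on_inverse: "Ck_on k (- {0}) (inverse :: real \<Rightarrow> real)"
proof (induction k)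
  case 0 then show ?case by (auto intro!: continuous_on_inverse continuous_on_id)
next
  case (Suc k)
  show ?case
    unfolding Ck_on.simps
  proof (intro exI[of _ "\<lambda>x v. - (inverse x * v * inverse x)"] conjI ballI allI)
    fix x :: real assume "x \<in> - {0}"
    then show "(inverse has_derivative (\<lambda>v. - (inverse x * v * inverse x))) (at x)"
      using has_derivative_inverse'[of x UNIV] by auto
  next
    fix v :: real
    have "Ck_on k (- {0::real}) (\<lambda>x. inverse x * inverse x)"
      by (rule Ck_on_bilinear[OF bounded_bilinear_mult]) (use Suc in auto)
    then show "Ck_on k (- {0::real}) (\<lambda>x. - (inverse x * v * inverse x))"
      using Ck_on_linear[OF bounded_linear_mult_right[of "-v"]]
      by (force simp: ac_simps)
  qed
qed

lemma smooth_on_subset: "smooth_on S f \<Longrightarrow> T \<subseteq> S \<Longrightarrow> smooth_on T f"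
  and smooth_on_cong: "smooth_on S f \<Longrightarrow> open S \<Longrightarrow> (\<And>x. x \<in> S \<Longrightarrow> f x = g x) \<Longrightarrow> smooth_on S g"
  and smooth_on_const: "smooth_on S (\<lambda>x. c)"
  and smooth_on_id: "smooth_on S (\<lambda>x. x)"
  and smooth_on_linear: "bounded_linear L \<Longrightarrow> smooth_on S f \<Longrightarrow> smooth_on S (\<lambda>x. L (f x))"
  and smooth_on_add: "smooth_on S f \<Longrightarrow> smooth_on S g \<Longrightarrow> smooth_on S (\<lambda>x. f x + g x)"
  and smooth_on_bilinear: "bounded_bilinear bop \<Longrightarrow> open S \<Longrightarrow> smooth_on S h \<Longrightarrow> smooth_on S k
    \<Longrightarrow> smooth_on S (\<lambda>x. bop (h x) (k x))"
  and smooth_on_continuous: "smooth_on S f \<Longrightarrow> continuous_on S f"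
  unfolding smooth_on_def
  by (blast intro: Ck_on_subset Ck_on_cong Ck_on_const Ck_on_id Ck_on_linear Ck_on_add
      Ck_on_bilinear Ck_on_continuous)+

lemma smooth_on_compose:
  "smooth_on T g \<Longrightarrow> smooth_on S f \<Longrightarrow> open S \<Longrightarrow> open T \<Longrightarrow> f ` S \<subseteq> T \<Longrightarrow> smooth_on S (\<lambda>x. g (f x))"
  unfolding smooth_on_def using Ck_on_compose by blast

lemma smooth_on_local:
  assumes "\<And>x. x \<in> S \<Longrightarrow> \<exists>N. open N \<and> x \<in> N \<and> smooth_on N f"
  shows "smooth_on S f"
  unfolding smooth_on_def
proof (intro allI Ck_on_local)
  fix k x assume "x \<in> S"
  then show "\<exists>N. open N \<and> x \<in> N \<and> Ck_on k N f" using assms unfolding smooth_on_def by blast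
qed

lemma smooth_on_has_derivative:
  "smooth_on S f \<Longrightarrow> open S \<Longrightarrow> x \<in> S \<Longrightarrow> (f has_derivative FD f x) (at x)"
  unfolding smooth_on_def using Ck_on_Suc_FD by blast

lemma smooth_on_FD: "smooth_on S f \<Longrightarrow> open S \<Longrightarrow> smooth_on S (\<lambda>x. FD f x v)"
  unfolding smooth_on_def using Ck_on_Suc_FD by blast

lemma smooth_on_sum:
  "finite I \<Longrightarrow> (\<And>i. i \<in> I \<Longrightarrow> smooth_on S (f i)) \<Longrightarrow> smooth_on S (\<lambda>x. \<Sum>i\<in>I. f i x)"
  unfolding smooth_on_def using Ck_on_sum by blast

lemmas smooth_on_mult = smooth_on_bilinear[OF bounded_bilinear_mult]
lemmas smooth_on_scaleR = smooth_on_bilinear[OF bounded_bilinear_scaleR]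
lemmas smooth_on_inner = smooth_on_bilinear[OF bounded_bilinear_inner]
lemmas smooth_on_minus = smooth_on_linear[OF bounded_linear_minus[OF bounded_linear_ident]]
lemmas smooth_on_fst = smooth_on_linear[OF bounded_linear_fst]
lemmas smooth_on_snd = smooth_on_linear[OF bounded_linear_snd]

lemma smooth_on_diff: "smooth_on S f \<Longrightarrow> smooth_on S g \<Longrightarrow> smooth_on S (\<lambda>x. f x - g x)"
  using smooth_on_add[of S f "\<lambda>x. - g x"] smooth_on_minus by auto

lemma smooth_on_Pair:
  assumes "smooth_on S f" "smooth_on S g"
  shows "smooth_on S (\<lambda>x. (f x, g x))"
proof -
  have "smooth_on S (\<lambda>x. (f x, 0) + (0, g x))"
    using smooth_on_linear[OF bounded_linear_Pair[OF bounded_linear_ident bounded_linear_zero] assms(1)]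
      smooth_on_linear[OF bounded_linear_Pair[OF bounded_linear_zero bounded_linear_ident] assms(2)]
    by (intro smooth_on_add)
  then show ?thesis by simp
qed

lemma smooth_on_divide:
  fixes f g :: "'a::euclidean_space \<Rightarrow> real"
  assumes "open S" "smooth_on S f" "smooth_on S g" "\<And>x. x \<in> S \<Longrightarrow> g x \<noteq> 0"
  shows "smooth_on S (\<lambda>x. f x / g x)"
proof -
  have "smooth_on (- {0}) (inverse :: real \<Rightarrow> real)"
    unfolding smooth_on_def using Ck_on_inverse by blast
  then have "smooth_on S (\<lambda>x. inverse (g x))"
    by (rule smooth_on_compose) (use assms in auto)
  then show ?thesis unfolding divide_inverse using assms by (intro smooth_on_mult) auto
qed

lemmas smooth_intros = smooth_on_const smooth_on_id smooth_on_add smooth_on_diff smooth_on_minus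
  smooth_on_mult smooth_on_scaleR smooth_on_inner smooth_on_Pair smooth_on_divide
  smooth_on_sum smooth_on_fst smooth_on_snd

section \<open>Smoothness of coefficients in linear relations\<close>

text \<open>Nothing is assumed about \<open>r\<close> except the relation; taking the inner product
  with \<open>g\<close> exhibits it as a quotient of smooth functions. This is what makes
  coordinates defined by \<open>THE\<close> smooth.\<close>

lemma smooth_on_coeff1:
  fixes f g :: "'a::euclidean_space \<Rightarrow> 'b::euclidean_space"
  assumes "open S" "smooth_on S f" "smooth_on S g"
    and "\<And>x. x \<in> S \<Longrightarrow> g x \<noteq> 0" "\<And>x. x \<in> S \<Longrightarrow> f x = r x *\<^sub>R g x"
  shows "smooth_on S r"
  by (rule smooth_on_cong[of _ "\<lambda>x. (f x \<bullet> g x) / (g x \<bullet> g x)"])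
    (use assms in \<open>auto intro!: smooth_intros\<close>)

text \<open>The equality case of Cauchy-Schwarz: the component of \<open>g\<close> orthogonal to
  \<open>h\<close>, scaled by \<open>h \<bullet> h\<close>, has squared norm
  \<open>h \<bullet> h\<close> times the Gram determinant.\<close>

lemma gram_pos:
  fixes g h :: "'b::euclidean_space"
  assumes "\<And>a b. a *\<^sub>R g + b *\<^sub>R h = 0 \<Longrightarrow> a = 0 \<and> b = 0"
  shows "(g \<bullet> g) * (h \<bullet> h) - (g \<bullet> h) * (g \<bullet> h) \<noteq> 0"
proof
  assume 0: "(g \<bullet> g) * (h \<bullet> h) - (g \<bullet> h) * (g \<bullet> h) = 0"
  let ?z = "(h \<bullet> h) *\<^sub>R g + (- (g \<bullet> h)) *\<^sub>R h"
  have "?z \<bullet> ?z = (h \<bullet> h) * ((g \<bullet> g) * (h \<bullet> h) - (g \<bullet> h) * (g \<bullet> h))"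
    by (simp add: algebra_simps inner_commute)
  then have "?z = 0" using 0 by simp
  then have "h \<bullet> h = 0" using assms by blast
  then show False using assms[of 0 1] by simp
qed

text \<open>Cramer's rule for the normal equations obtained by pairing the relation with
  \<open>g\<close> and \<open>h\<close>; the denominator is the Gram determinant.\<close>

lemma smooth_on_coeff2:
  fixes f g h :: "'a::euclidean_space \<Rightarrow> 'b::euclidean_space"
  assumes S: "open S" "smooth_on S f" "smooth_on S g" "smooth_on S h"
    and indep: "\<And>x a b. x \<in> S \<Longrightarrow> a *\<^sub>R g x + b *\<^sub>R h x = 0 \<Longrightarrow> a = 0 \<and> b = 0"
    and f: "\<And>x. x \<in> S \<Longrightarrow> f x = r x *\<^sub>R g x + s x *\<^sub>R h x"
  shows "smooth_on S r" "smooth_on S s"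
proof -
  define G where "G x = (g x \<bullet> g x) * (h x \<bullet> h x) - (g x \<bullet> h x) * (g x \<bullet> h x)" for x
  have G: "G x \<noteq> 0" if "x \<in> S" for x
    unfolding G_def by (rule gram_pos) (use indep that in blast)
  have "r x = ((f x \<bullet> g x) * (h x \<bullet> h x) - (f x \<bullet> h x) * (g x \<bullet> h x)) / G x" if "x \<in> S" for x
    using G[OF that] unfolding f[OF that] G_def
    by (simp add: eq_divide_eq inner_commute) (simp add: algebra_simps inner_commute)
  moreover have "smooth_on S (\<lambda>x. ((f x \<bullet> g x) * (h x \<bullet> h x) - (f x \<bullet> h x) * (g x \<bullet> h x)) / G x)"
    unfolding G_def by (intro smooth_intros S) (use G in \<open>auto simp: G_def\<close>)
  ultimately show "smooth_on S r" using S(1) by (metis (no_types, lifting) smooth_on_cong)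
  have "s x = ((f x \<bullet> h x) * (g x \<bullet> g x) - (f x \<bullet> g x) * (g x \<bullet> h x)) / G x" if "x \<in> S" for x
    using G[OF that] unfolding f[OF that] G_def
    by (simp add: eq_divide_eq inner_commute) (simp add: algebra_simps inner_commute)
  moreover have "smooth_on S (\<lambda>x. ((f x \<bullet> h x) * (g x \<bullet> g x) - (f x \<bullet> g x) * (g x \<bullet> h x)) / G x)"
    unfolding G_def by (intro smooth_intros S) (use G in \<open>auto simp: G_def\<close>)
  ultimately show "smooth_on S s" using S(1) by (metis (no_types, lifting) smooth_on_cong)
qed

section \<open>Symmetry of second derivatives\<close>

text \<open>The mean value theorem is applied twice, once along \<open>v\<close> and once along
  \<open>w\<close>. The left-hand side is symmetric in \<open>v\<close> and \<open>w\<close>, which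
  is the source of the symmetry of the second derivative.\<close>

lemma second_difference:
  fixes f :: "'a::euclidean_space \<Rightarrow> real"
  assumes "smooth_on S f" "open S" "ball x d \<subseteq> S" "0 < t" "t * (norm v + norm w) < d"
  shows "\<exists>p\<in>cball x (t * (norm v + norm w)).
    f (x + t *\<^sub>R v + t *\<^sub>R w) - f (x + t *\<^sub>R v) - f (x + t *\<^sub>R w) + f x = t * (t * FD (\<lambda>y. FD f y v) p w)"
proof -
  have near: "x + a *\<^sub>R v + b *\<^sub>R w \<in> cball x (t * (norm v + norm w))" if "0 \<le> a" "a \<le> t" "0 \<le> b" "b \<le> t" for a b
  proof -
    have "norm (a *\<^sub>R v + b *\<^sub>R w) \<le> a * norm v + b * norm w"
      using that norm_triangle_ineq[of "a *\<^sub>R v" "b *\<^sub>R w"] by simp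
    also have "\<dots> \<le> t * (norm v + norm w)"
      using that by (simp add: distrib_left add_mono mult_right_mono)
    finally show ?thesis by (simp add: dist_norm norm_minus_commute algebra_simps)
  qed
  then have inS: "x + a *\<^sub>R v + b *\<^sub>R w \<in> S" if "0 \<le> a" "a \<le> t" "0 \<le> b" "b \<le> t" for a b
    using assms(3,5) near[OF that] unfolding subset_iff mem_ball mem_cball by (meson le_less_trans)
  have along: "((\<lambda>s. g (p + s *\<^sub>R z)) has_real_derivative FD g (p + s *\<^sub>R z) z) (at s)"
    if "smooth_on S g" "p + s *\<^sub>R z \<in> S" for g :: "'a \<Rightarrow> real" and p z s
  proof -
    have g': "(g has_derivative FD g (p + s *\<^sub>R z)) (at (p + s *\<^sub>R z))"
      using smooth_on_has_derivative[OF that(1) assms(2) that(2)] .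
    have "((\<lambda>s. p + s *\<^sub>R z) has_derivative (\<lambda>h. h *\<^sub>R z)) (at s)"
      by (auto intro!: derivative_eq_intros)
    from has_derivative_compose[OF this g'] show ?thesis
      by (simp add: has_field_derivative_def linear_scale has_derivative_linear[OF g'] mult_commute_abs)
  qed
  \<comment> \<open>The second difference is the increment over \<open>[0, t]\<close> of a function
    of one variable that is already a difference in the direction \<open>w\<close>.\<close>
  let ?g = "\<lambda>s. f (x + t *\<^sub>R w + s *\<^sub>R v) - f (x + s *\<^sub>R v)"
  have "\<exists>\<xi>. 0 < \<xi> \<and> \<xi> < t \<and> ?g t - ?g 0 = (t - 0) * (FD f (x + t *\<^sub>R w + \<xi> *\<^sub>R v) v - FD f (x + \<xi> *\<^sub>R v) v)"
  proof (rule MVT2[OF assms(4)])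
    fix s assume s: "0 \<le> s" "s \<le> t"
    show "(?g has_real_derivative FD f (x + t *\<^sub>R w + s *\<^sub>R v) v - FD f (x + s *\<^sub>R v) v) (at s)"
      by (intro DERIV_diff along assms(1))
        (use inS[of s t] inS[of s 0] s assms(4) in \<open>auto simp: algebra_simps\<close>)
  qed
  then obtain \<xi> where \<xi>: "0 < \<xi>" "\<xi> < t"
    "?g t - ?g 0 = t * (FD f (x + t *\<^sub>R w + \<xi> *\<^sub>R v) v - FD f (x + \<xi> *\<^sub>R v) v)" by auto
  let ?h = "\<lambda>s. FD f (x + \<xi> *\<^sub>R v + s *\<^sub>R w) v"
  have "\<exists>\<zeta>. 0 < \<zeta> \<and> \<zeta> < t \<and> ?h t - ?h 0 = (t - 0) * FD (\<lambda>y. FD f y v) (x + \<xi> *\<^sub>R v + \<zeta> *\<^sub>R w) w"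
    by (rule MVT2[OF assms(4)]) (rule along[OF smooth_on_FD[OF assms(1,2)]], use inS \<xi> in auto)
  then obtain \<zeta> where \<zeta>: "0 < \<zeta>" "\<zeta> < t"
    "?h t - ?h 0 = t * FD (\<lambda>y. FD f y v) (x + \<xi> *\<^sub>R v + \<zeta> *\<^sub>R w) w" by auto
  have "f (x + t *\<^sub>R v + t *\<^sub>R w) - f (x + t *\<^sub>R v) - f (x + t *\<^sub>R w) + f x = ?g t - ?g 0"
    by (simp add: algebra_simps)
  also have "\<dots> = t * (?h t - ?h 0)" using \<xi>(3) by (simp add: algebra_simps)
  also have "\<dots> = t * (t * FD (\<lambda>y. FD f y v) (x + \<xi> *\<^sub>R v + \<zeta> *\<^sub>R w) w)" using \<zeta>(3) by simp
  finally show ?thesis using near[of \<xi> \<zeta>] \<xi> \<zeta> by force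
qed

text \<open>The same second difference equals \<open>t * t\<close> times a value of either mixed
  derivative near \<open>x\<close>; continuity of both gives the limit for small
  \<open>t\<close>.\<close>

lemma FD_FD_symmetric_real:
  fixes f :: "'a::euclidean_space \<Rightarrow> real"
  assumes "smooth_on S f" "open S" "x \<in> S"
  shows "FD (\<lambda>y. FD f y v) x w = FD (\<lambda>y. FD f y w) x v"
proof -
  obtain d where d: "d > 0" "ball x d \<subseteq> S" using assms(2,3) open_contains_ball by blast
  let ?A = "\<lambda>p. FD (\<lambda>y. FD f y v) p w" and ?B = "\<lambda>p. FD (\<lambda>y. FD f y w) p v"
  have cont: "continuous_on S ?A" "continuous_on S ?B"
    using assms by (intro smooth_on_continuous smooth_on_FD; simp)+
  have "\<bar>?A x - ?B x\<bar> \<le> e" if "e > 0" for e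
  proof -
    have "isCont ?A x" "isCont ?B x" using cont assms continuous_on_eq_continuous_at by blast+
    note c = this[unfolded continuous_at_eps_delta, rule_format, OF half_gt_zero[OF \<open>e > 0\<close>]]
    obtain r where r: "r > 0" "\<And>p. dist p x < r \<Longrightarrow> dist (?A p) (?A x) < e / 2" using c(1) by blast
    obtain s where s: "s > 0" "\<And>p. dist p x < s \<Longrightarrow> dist (?B p) (?B x) < e / 2" using c(2) by blast
    define m where "m = min d (min r s)"
    have m: "m > 0" "m \<le> d" "m \<le> r" "m \<le> s" using d r s by (auto simp: m_def)
    \<comment> \<open>The summand 1 avoids a zero denominator when \<open>v\<close> and
      \<open>w\<close> vanish; the factor 2 keeps the intermediate points strictly within distance
      \<open>m\<close>.\<close>
    define t where "t = m / (2 * (norm v + norm w + 1))"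
    have np: "norm v + norm w + 1 > 0" by (simp add: add_nonneg_pos)
    have t: "t > 0" unfolding t_def using m np by simp
    have tm: "t * (norm v + norm w) < m"
    proof -
      have "t * (norm v + norm w) \<le> t * (norm v + norm w + 1)" using t by simp
      also have "\<dots> = m / 2" unfolding t_def using np by (simp add: field_simps)
      finally show ?thesis using m by simp
    qed
    have "t * (norm v + norm w) < d" "t * (norm w + norm v) < d" using tm m by (auto simp: add.commute)
    then obtain p q where p: "p \<in> cball x (t * (norm v + norm w))"
        "f (x + t *\<^sub>R v + t *\<^sub>R w) - f (x + t *\<^sub>R v) - f (x + t *\<^sub>R w) + f x = t * (t * ?A p)"
      and q: "q \<in> cball x (t * (norm w + norm v))"
        "f (x + t *\<^sub>R w + t *\<^sub>R v) - f (x + t *\<^sub>R w) - f (x + t *\<^sub>R v) + f x = t * (t * ?B q)"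
      using second_difference[OF assms(1,2) d(2) t] by meson
    have "t * (t * ?A p) = t * (t * ?B q)" using p(2) q(2) by (simp add: algebra_simps)
    then have "?A p = ?B q" using t by simp
    moreover have "dist p x < r" "dist q x < s"
      using p(1) q(1) tm m by (auto simp: dist_commute add.commute)
    ultimately show ?thesis using r(2)[of p] s(2)[of q] unfolding dist_real_def by linarith
  qed
  then show ?thesis using field_le_epsilon[of "\<bar>?A x - ?B x\<bar>" 0] by simp
qed

lemma FD_inner:
  assumes "smooth_on S f" "open S" "x \<in> S"
  shows "FD (\<lambda>x. f x \<bullet> i) x v = FD f x v \<bullet> i"
  using FD_eqI[OF has_derivative_inner_left[OF smooth_on_has_derivative[OF assms]]] by metis

lemma FD_FD_symmetric:
  fixes f :: "'a::euclidean_space \<Rightarrow> 'b::euclidean_space"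
  assumes "smooth_on S f" "open S" "x \<in> S"
  shows "FD (\<lambda>y. FD f y v) x w = FD (\<lambda>y. FD f y w) x v"
proof (rule euclidean_eqI)
  fix i :: 'b assume "i \<in> Basis"
  have *: "FD (\<lambda>y. FD f y v) x w \<bullet> i = FD (\<lambda>y. FD (\<lambda>x. f x \<bullet> i) y v) x w" for v w
  proof -
    have "FD (\<lambda>y. FD f y v) x w \<bullet> i = FD (\<lambda>y. FD f y v \<bullet> i) x w"
      using FD_inner[OF smooth_on_FD[OF assms(1,2)] assms(2,3)] by simp
    also have "\<dots> = FD (\<lambda>y. FD (\<lambda>x. f x \<bullet> i) y v) x w"
      using FD_cong_open[OF assms(2,3), of "\<lambda>y. FD f y v \<bullet> i" "\<lambda>y. FD (\<lambda>x. f x \<bullet> i) y v"]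
        FD_inner[OF assms(1,2)] by simp
    finally show ?thesis .
  qed
  have "smooth_on S (\<lambda>x. f x \<bullet> i)" using smooth_on_inner[OF assms(2,1) smooth_on_const] .
  then show "FD (\<lambda>y. FD f y v) x w \<bullet> i = FD (\<lambda>y. FD f y w) x v \<bullet> i"
    unfolding * using FD_FD_symmetric_real[OF _ assms(2,3)] by blast
qed

section \<open>Covector fields and the exterior derivative in coordinates\<close>

lemma linear_Basis_sum:
  fixes a :: "'b::euclidean_space \<Rightarrow> real"
  assumes "linear a"
  shows "a h = (\<Sum>b\<in>Basis. (h \<bullet> b) * a b)"
proof -
  have "a h = a (\<Sum>b\<in>Basis. (h \<bullet> b) *\<^sub>R b)" by (simp add: euclidean_representation)
  also have "\<dots> = (\<Sum>b\<in>Basis. (h \<bullet> b) * a b)" using assms by (simp add: linear_sum linear_scale)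
  finally show ?thesis .
qed

text \<open>The parameter space may differ from the space on which the covectors act. The charts of
  Y need covectors on E that depend on a point of E together with a group element.\<close>

definition smooth_covec :: "'f::euclidean_space set \<Rightarrow> ('f \<Rightarrow> 'e::euclidean_space \<Rightarrow> real) \<Rightarrow> bool" where
  "smooth_covec T \<alpha> \<longleftrightarrow> (\<forall>y\<in>T. linear (\<alpha> y)) \<and> (\<forall>h. smooth_on T (\<lambda>y. \<alpha> y h))"

lemma smooth_covec_apply:
  assumes "smooth_covec T \<alpha>" "open S" "open T" "smooth_on S F" "F ` S \<subseteq> T" "smooth_on S G"
  shows "smooth_on S (\<lambda>u. \<alpha> (F u) (G u))"
proof -
  have "smooth_on S (\<lambda>u. \<alpha> (F u) b)" for b
    using assms smooth_on_compose[of T "\<lambda>y. \<alpha> y b" S F] by (auto simp: smooth_covec_def)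
  then have "smooth_on S (\<lambda>u. \<Sum>b\<in>Basis. (G u \<bullet> b) * \<alpha> (F u) b)"
    using assms by (intro smooth_intros) auto
  then show ?thesis
    by (rule smooth_on_cong)
      (use assms linear_Basis_sum[of "\<alpha> (F _)"] in \<open>auto simp: smooth_covec_def image_subset_iff\<close>)
qed

lemma linear_cmult:
  fixes f :: "'e::real_vector \<Rightarrow> real"
  shows "linear f \<Longrightarrow> linear (\<lambda>x. k * f x)"
  using linear_compose_scale_right[of f k] by simp

lemma smooth_covec_comb:
  assumes "smooth_covec S \<alpha>" "smooth_covec S \<beta>" "open S" "smooth_on S r" "smooth_on S s"
  shows "smooth_covec S (\<lambda>x h. r x * \<alpha> x h + s x * \<beta> x h)"
  using assms unfolding smooth_covec_def
  by (auto intro!: smooth_on_add smooth_on_mult linear_compose_add linear_cmult)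

lemma smooth_covec_fst:
  fixes K :: "'k::euclidean_space set"
  assumes "smooth_covec S \<alpha>" "open S" "open K"
  shows "smooth_covec (S \<times> K) (\<lambda>z. \<alpha> (fst z))"
  unfolding smooth_covec_def
proof (intro conjI ballI allI)
  show "linear (\<alpha> (fst z))" if "z \<in> S \<times> K" for z using assms(1) that by (auto simp: smooth_covec_def)
  show "smooth_on (S \<times> K) (\<lambda>z. \<alpha> (fst z) h)" for h
    by (rule smooth_on_compose[of S "\<lambda>u. \<alpha> u h", OF _ smooth_on_fst[OF smooth_on_id]])
      (use assms in \<open>auto simp: smooth_covec_def open_Times\<close>)
qed

lemma FD_covec:
  assumes "smooth_covec T \<alpha>" "open T" "y \<in> T"
  shows "FD (\<lambda>y. \<alpha> y g) y z = (\<Sum>b\<in>Basis. (g \<bullet> b) * FD (\<lambda>y. \<alpha> y b) y z)"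
proof -
  have "((\<lambda>y. \<Sum>b\<in>Basis. (g \<bullet> b) * \<alpha> y b) has_derivative (\<lambda>z. \<Sum>b\<in>Basis. (g \<bullet> b) * FD (\<lambda>y. \<alpha> y b) y z)) (at y)"
    using assms
    by (auto intro!: has_derivative_sum has_derivative_mult_right smooth_on_has_derivative[of T] simp:
        smooth_covec_def)
  then have "((\<lambda>y. \<alpha> y g) has_derivative (\<lambda>z. \<Sum>b\<in>Basis. (g \<bullet> b) * FD (\<lambda>y. \<alpha> y b) y z)) (at y)"
    by (rule has_derivative_transform_open[OF _ assms(2,3)])
      (use assms linear_Basis_sum[of "\<alpha> _" g] in \<open>auto simp: smooth_covec_def\<close>)
  then show ?thesis by (rule FD_eqI[THEN fun_cong])
qed

text \<open>The product rule for the pairing of a covector field along \<open>F\<close> with the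
  vector field \<open>G\<close>, obtained from the expansion of \<open>G\<close> in the
  basis.\<close>

lemma FD_covec_apply:
  assumes \<alpha>: "smooth_covec T \<alpha>" and S: "open S" "open T" "smooth_on S F" "F ` S \<subseteq> T" "smooth_on S G" "x \<in> S"
  shows "FD (\<lambda>u. \<alpha> (F u) (G u)) x h = FD (\<lambda>y. \<alpha> y (G x)) (F x) (FD F x h) + \<alpha> (F x) (FD G x h)"
proof -
  have Fx: "F x \<in> T" using S by auto
  have F': "(F has_derivative FD F x) (at x)" and G': "(G has_derivative FD G x) (at x)"
    using S smooth_on_has_derivative by blast+
  have "((\<lambda>u. \<alpha> (F u) b) has_derivative (\<lambda>h. FD (\<lambda>y. \<alpha> y b) (F x) (FD F x h))) (at x)" for b
    using has_derivative_compose[OF F', of "\<lambda>y. \<alpha> y b"] smooth_on_has_derivative[OF _ S(2) Fx] \<alpha>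
    unfolding smooth_covec_def by blast
  then have "((\<lambda>u. \<Sum>b\<in>Basis. (G u \<bullet> b) * \<alpha> (F u) b) has_derivative
      (\<lambda>h. \<Sum>b\<in>Basis. (G x \<bullet> b) * FD (\<lambda>y. \<alpha> y b) (F x) (FD F x h) + (FD G x h \<bullet> b) * \<alpha> (F x) b)) (at x)"
    by (intro has_derivative_sum has_derivative_mult has_derivative_inner_left G')
  then have "((\<lambda>u. \<alpha> (F u) (G u)) has_derivative
      (\<lambda>h. \<Sum>b\<in>Basis. (G x \<bullet> b) * FD (\<lambda>y. \<alpha> y b) (F x) (FD F x h) + (FD G x h \<bullet> b) * \<alpha> (F x) b)) (at x)"
    by (rule has_derivative_transform_open[OF _ S(1,6)])
      (use \<alpha> S linear_Basis_sum[of "\<alpha> (F _)"] in \<open>auto simp: smooth_covec_def image_subset_iff\<close>)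
  then have "FD (\<lambda>u. \<alpha> (F u) (G u)) x h =
      (\<Sum>b\<in>Basis. (G x \<bullet> b) * FD (\<lambda>y. \<alpha> y b) (F x) (FD F x h) + (FD G x h \<bullet> b) * \<alpha> (F x) b)"
    by (rule FD_eqI[THEN fun_cong])
  then show ?thesis
    using FD_covec[OF \<alpha> S(2) Fx, of "G x" "FD F x h"] linear_Basis_sum[of "\<alpha> (F x)" "FD G x h"] \<alpha> Fx
    by (simp add: sum.distrib smooth_covec_def)
qed

text \<open>The exterior derivative evaluated on constant vector fields, whose bracket
  vanishes.\<close>

definition dcov :: "('f::euclidean_space \<Rightarrow> 'f \<Rightarrow> real) \<Rightarrow> 'f \<Rightarrow> 'f \<Rightarrow> 'f \<Rightarrow> real" where
  "dcov \<alpha> y h k = FD (\<lambda>y. \<alpha> y k) y h - FD (\<lambda>y. \<alpha> y h) y k"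

text \<open>By the product rule each term contains \<open>\<alpha>\<close> applied to a second
  derivative of \<open>F\<close>; these two contributions cancel by symmetry.\<close>

lemma dcov_pullback:
  assumes \<alpha>: "smooth_covec T \<alpha>" and S: "open S" "open T" "smooth_on S F" "F ` S \<subseteq> T" "x \<in> S"
  shows "dcov (\<lambda>u h. \<alpha> (F u) (FD F u h)) x h k = dcov \<alpha> (F x) (FD F x h) (FD F x k)"
  unfolding dcov_def
  by (simp add: FD_covec_apply[OF \<alpha> S(1-4) smooth_on_FD[OF S(3,1)] S(5)] FD_FD_symmetric[OF S(3,1,5), of h k])

lemma dcov_cong:
  assumes "open S" "x \<in> S" "\<And>y h. y \<in> S \<Longrightarrow> \<alpha> y h = \<beta> y h"
  shows "dcov \<alpha> x = dcov \<beta> x"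
proof -
  have "FD (\<lambda>y. \<alpha> y k) x = FD (\<lambda>y. \<beta> y k) x" for k
    by (rule FD_cong_open[OF assms(1,2)]) (rule assms(3))
  then show ?thesis unfolding dcov_def by simp
qed

text \<open>In \<open>d(f \<alpha>) = df \<and> \<alpha> + f d\<alpha>\<close> the first term
  vanishes on the kernel of \<open>\<alpha>\<close>.\<close>

lemma dcov_scale:
  assumes "smooth_covec T \<alpha>" "open T" "y \<in> T" "smooth_on T f" "\<alpha> y h = 0" "\<alpha> y k = 0"
  shows "dcov (\<lambda>y h. f y * \<alpha> y h) y h k = f y * dcov \<alpha> y h k"
proof -
  have "FD (\<lambda>y. f y * \<alpha> y h) y k = f y * FD (\<lambda>y. \<alpha> y h) y k + FD f y k * \<alpha> y h" for h k
    using FD_eqI[OF has_derivative_mult[OF smooth_on_has_derivative smooth_on_has_derivative], of T f y T "\<lambda>y.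
        \<alpha> y h"]
      assms by (auto simp: smooth_covec_def fun_eq_iff)
  then show ?thesis using assms by (simp add: dcov_def algebra_simps)
qed

lemma dcov_zero:
  assumes "smooth_covec T \<alpha>" "open T" "y \<in> T"
  shows "dcov \<alpha> y 0 k = 0"
proof -
  have "FD (\<lambda>y. \<alpha> y 0) y = FD (\<lambda>y. 0 :: real) y"
    by (rule FD_cong_open[OF assms(2,3)]) (use assms(1) linear_0 in \<open>auto simp: smooth_covec_def\<close>)
  also have "\<dots> = (\<lambda>h. 0)" by (rule FD_eqI) simp
  finally have "FD (\<lambda>y. \<alpha> y 0) y = (\<lambda>h. 0)" .
  moreover have "linear (FD (\<lambda>y. \<alpha> y k) y)"
    using smooth_on_has_derivative[OF _ assms(2,3)] assms(1) has_derivative_linear unfolding smooth_covec_def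
        by blast
  ultimately show ?thesis by (simp add: dcov_def linear_0)
qed

lemma dcov_smooth:
  assumes "smooth_covec T \<alpha>" "open T" "smooth_on T h" "smooth_on T k"
  shows "smooth_on T (\<lambda>y. dcov \<alpha> y (h y) (k y))"
proof -
  have FDs: "smooth_on T (\<lambda>y. FD (\<lambda>z. \<alpha> z (k' y)) y (h' y))" if hk: "smooth_on T h'" "smooth_on T k'" for h' k'
  proof (rule smooth_on_cong[OF _ assms(2)])
    show "smooth_on T (\<lambda>y. \<Sum>b\<in>Basis. (k' y \<bullet> b) * (\<Sum>c\<in>Basis. (h' y \<bullet> c) * FD (\<lambda>z. \<alpha> z b) y c))"
      using assms hk by (intro smooth_intros smooth_on_FD) (auto simp: smooth_covec_def)
    fix y assume y: "y \<in> T"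
    have "linear (FD (\<lambda>z. \<alpha> z b) y)" for b
      using assms(1,2) y smooth_on_has_derivative has_derivative_linear unfolding smooth_covec_def by blast
    then show "(\<Sum>b\<in>Basis. (k' y \<bullet> b) * (\<Sum>c\<in>Basis. (h' y \<bullet> c) * FD (\<lambda>z. \<alpha> z b) y c)) = FD (\<lambda>z. \<alpha> z (k' y)) y (h' y)"
      unfolding FD_covec[OF assms(1,2) y, of "k' y" "h' y"]
      by (intro sum.cong refl arg_cong2[of _ _ _ _ "(*)"] linear_Basis_sum[symmetric])
  qed
  show ?thesis unfolding dcov_def using FDs assms by (intro smooth_intros)
qed

section \<open>Calculus on manifolds\<close>

text \<open>The chart conditions of \<open>smooth_manifold\<close>, separated so that they can be
  proved for the atlases of E, Y and \<open>Y2\<close> as well.\<close>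

definition smooth_atlas :: "('p, 'e::euclidean_space) atlas \<Rightarrow> bool" where
  "smooth_atlas A \<longleftrightarrow>
     (\<forall>c\<in>A. inj_on (snd c) (fst c) \<and> open (snd c ` fst c)) \<and>
     (\<forall>c\<in>A. \<forall>d\<in>A. open (snd c ` (fst c \<inter> fst d)) \<and>
        smooth_on (snd c ` (fst c \<inter> fst d)) (snd d \<circ> cinv c))"

lemma smooth_manifold_atlas: "smooth_manifold A \<Longrightarrow> smooth_atlas A"
  by (simp add: smooth_manifold_def smooth_atlas_def)

lemma
  assumes "smooth_atlas A" "c \<in> A"
  shows chart_inj: "inj_on (snd c) (fst c)"
    and chart_open: "open (snd c ` fst c)"
    and cinv_chart [simp]: "p \<in> fst c \<Longrightarrow> cinv c (snd c p) = p"
    and cinv_in: "u \<in> snd c ` fst c \<Longrightarrow> cinv c u \<in> fst c"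
    and chart_cinv: "u \<in> snd c ` fst c \<Longrightarrow> snd c (cinv c u) = u"
proof -
  show *: "inj_on (snd c) (fst c)" "open (snd c ` fst c)"
    using assms by (auto simp: smooth_atlas_def)
  show "p \<in> fst c \<Longrightarrow> cinv c (snd c p) = p" by (rule the_inv_into_f_f[OF *(1)])
  show "u \<in> snd c ` fst c \<Longrightarrow> cinv c u \<in> fst c" by (auto simp: the_inv_into_f_f[OF *(1)])
  show "u \<in> snd c ` fst c \<Longrightarrow> snd c (cinv c u) = u" by (rule f_the_inv_into_f[OF *(1)])
qed

lemma transition_smooth:
  assumes "smooth_atlas A" "c \<in> A" "d \<in> A"
  shows "open (snd c ` (fst c \<inter> fst d))" "smooth_on (snd c ` (fst c \<inter> fst d)) (snd d \<circ> cinv c)"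
  using assms by (auto simp: smooth_atlas_def)

lemma chart_at_in:
  assumes "p \<in> points A"
  shows "chart_at A p \<in> A" "p \<in> fst (chart_at A p)"
proof -
  have "\<exists>c. c \<in> A \<and> p \<in> fst c" using assms by (auto simp: points_def)
  from someI_ex[OF this] show "chart_at A p \<in> A" "p \<in> fst (chart_at A p)"
    by (auto simp: chart_at_def)
qed

lemma pointsI: "c \<in> A \<Longrightarrow> p \<in> fst c \<Longrightarrow> p \<in> points A"
  by (auto simp: points_def)

lemma topspace_mtop [simp]: "topspace (mtop A) = points A"
proof -
  have "\<Union>{{p \<in> fst c. snd c p \<in> Q} | c Q. c \<in> A \<and> open Q} = points A"
    by (auto simp: points_def) (metis (mono_tags, lifting) UNIV_I mem_Collect_eq open_UNIV)
  then show ?thesis unfolding mtop_def topology_generated_by_topspace .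
qed

lemma openin_chart_preimage: "c \<in> A \<Longrightarrow> open Q \<Longrightarrow> openin (mtop A) {p \<in> fst c. snd c p \<in> Q}"
  unfolding mtop_def by (rule topology_generated_by_Basis) blast

lemma openin_chart_domain: "c \<in> A \<Longrightarrow> openin (mtop A) (fst c)"
  using openin_chart_preimage[of c A UNIV] by simp

lemma openin_mtop_locally:
  assumes "\<And>p. p \<in> U \<Longrightarrow> \<exists>c\<in>A. \<exists>Q. p \<in> fst c \<and> open Q \<and> snd c p \<in> Q \<and> {q \<in> fst c. snd c q \<in> Q} \<subseteq> U"
  shows "openin (mtop A) U"
proof (subst openin_subopen, intro ballI)
  fix p assume "p \<in> U"
  then obtain c Q where "c \<in> A" "p \<in> fst c" "open Q" "snd c p \<in> Q" "{q \<in> fst c. snd c q \<in> Q} \<subseteq> U"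
    using assms by blast
  then show "\<exists>T. openin (mtop A) T \<and> p \<in> T \<and> T \<subseteq> U"
    using openin_chart_preimage[of c A Q] by (intro exI[of _ "{q \<in> fst c. snd c q \<in> Q}"]) auto
qed

text \<open>Induction over the generation of the topology. For a generating set the claim is
  continuity of a transition map; for intersections it uses injectivity of the chart.\<close>

lemma openin_chart_image:
  assumes A: "smooth_atlas A" "c \<in> A" and "openin (mtop A) U"
  shows "open (snd c ` (fst c \<inter> U))"
proof -
  have "generate_topology_on {{p \<in> fst c. snd c p \<in> Q} | c Q. c \<in> A \<and> open Q} U"
    using assms(3) unfolding mtop_def by (rule openin_topology_generated_by)
  then show ?thesis
  proof induction
    case Empty then show ?case by simp
  next
    case (Int a b)
    have "snd c ` (fst c \<inter> (a \<inter> b)) = snd c ` (fst c \<inter> a) \<inter> snd c ` (fst c \<inter> b)"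
      using inj_on_image_Int[OF chart_inj[OF A], of "fst c \<inter> a" "fst c \<inter> b"]
      by (simp add: Int_ac)
    then show ?case using Int.IH by auto
  next
    case (UN K)
    have "snd c ` (fst c \<inter> \<Union>K) = (\<Union>k\<in>K. snd c ` (fst c \<inter> k))" by auto
    then show ?case using UN.IH by auto
  next
    case (Basis s)
    then obtain d Q where d: "s = {p \<in> fst d. snd d p \<in> Q}" "d \<in> A" "open Q" by auto
    have "snd c ` (fst c \<inter> s) = snd c ` (fst c \<inter> fst d) \<inter> (snd d \<circ> cinv c) -` Q"
      using A by (auto simp: d)
    then show ?case
      using continuous_open_preimage[OF smooth_on_continuous] transition_smooth[OF A d(2)] d(3)
      by metis
  qed
qed

section \<open>Smooth maps and the chain rule in charts\<close>

lemma smooth_map_singleton: "smooth_map P A B F \<Longrightarrow> p \<in> P \<Longrightarrow> smooth_map {p} A B F"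
  and smooth_map_iff: "smooth_map P A B F \<longleftrightarrow> (\<forall>p\<in>P. smooth_map {p} A B F)"
  by (auto simp: smooth_map_def)

lemma smooth_map_subset: "smooth_map P A B F \<Longrightarrow> Q \<subseteq> P \<Longrightarrow> smooth_map Q A B F"
  by (auto simp: smooth_map_def)

text \<open>\<open>smooth_map\<close> provides one pair of charts around a point. Composing with
  transition maps on both sides gives any pair, and shrinking \<open>W\<close> also keeps the image
  inside \<open>V\<close>.\<close>

lemma smooth_map_charts:
  assumes A: "smooth_atlas A" "c \<in> A" "p \<in> fst c"
    and B: "smooth_atlas B" "d \<in> B" "F p \<in> fst d" and F: "smooth_map {p} A B F"
    and V: "openin (mtop B) V" "F p \<in> V"
  obtains W where "open W" "snd c p \<in> W" "W \<subseteq> snd c ` fst c" "F ` cinv c ` W \<subseteq> fst d \<inter> V"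
    "smooth_on W (snd d \<circ> F \<circ> cinv c)"
proof -
  obtain c0 d0 W0 where c0: "c0 \<in> A" "p \<in> fst c0" and d0: "d0 \<in> B" "F p \<in> fst d0"
    and W0: "open W0" "snd c0 p \<in> W0" "W0 \<subseteq> snd c0 ` fst c0" "F ` cinv c0 ` W0 \<subseteq> fst d0"
      "smooth_on W0 (snd d0 \<circ> F \<circ> cinv c0)"
    using F unfolding smooth_map_def by blast
  note [simp] = cinv_chart[OF A(1)] cinv_chart[OF B(1)]
  define S where "S = snd c ` (fst c \<inter> fst c0)"
  define W1 where "W1 = S \<inter> (snd c0 \<circ> cinv c) -` W0"
  have S: "open S" "smooth_on S (snd c0 \<circ> cinv c)"
    unfolding S_def using transition_smooth[OF A(1,2) c0(1)] by auto
  have W1: "open W1" unfolding W1_def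
    using continuous_open_preimage[OF smooth_on_continuous[OF S(2)] S(1) W0(1)] .
  define f where "f = (\<lambda>u. (snd d0 \<circ> F \<circ> cinv c0) ((snd c0 \<circ> cinv c) u))"
  have f: "smooth_on W1 f" unfolding f_def
    by (rule smooth_on_compose[OF W0(5) smooth_on_subset[OF S(2)] W1 W0(1)]) (auto simp: W1_def)
  \<comment> \<open>\<open>T\<close> is the region where the change of target chart is defined and
    the point lies in \<open>V\<close>.\<close>
  define T where "T = snd d0 ` (fst d0 \<inter> (fst d \<inter> V))"
  have T: "open T" unfolding T_def
    using openin_chart_image[OF B(1) d0(1)] openin_chart_domain[OF B(2)] V(1) by blast
  define W where "W = W1 \<inter> f -` T"
  have W: "open W" unfolding W_def
    using continuous_open_preimage[OF smooth_on_continuous[OF f] W1 T] .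
  have *: "cinv c u \<in> fst c \<and> F (cinv c u) \<in> fst d0 \<inter> (fst d \<inter> V) \<and> f u = snd d0 (F (cinv c u))
      \<and> u \<in> snd c ` fst c"
    if u: "u \<in> W" for u
  proof -
    from u obtain q where q: "q \<in> fst c" "q \<in> fst c0" "u = snd c q" "snd c0 q \<in> W0"
      using A(2) by (auto simp: W_def W1_def S_def)
    then have fu: "f u = snd d0 (F q)" "F q \<in> fst d0"
      using W0(4) A(2) c0(1) by (auto simp: f_def image_subset_iff)
    then have "snd d0 (F q) \<in> T" using u by (simp add: W_def)
    then have "F q \<in> fst d \<inter> V"
      using fu(2) chart_inj[OF B(1) d0(1)] unfolding T_def by (auto simp: inj_on_def)
    then show ?thesis using q fu A(2) by auto
  qed
  show ?thesis
  proof (rule that[OF W])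
    show "snd c p \<in> W"
      using A c0 d0 W0 B V by (auto simp: W_def W1_def S_def f_def T_def)
    show "W \<subseteq> snd c ` fst c" "F ` cinv c ` W \<subseteq> fst d \<inter> V" using * by auto
    have TV: "T \<subseteq> snd d0 ` (fst d0 \<inter> fst d)" by (auto simp: T_def)
    have "smooth_on W (\<lambda>u. (snd d \<circ> cinv d0) (f u))"
      by (rule smooth_on_compose[OF smooth_on_subset[OF transition_smooth(2)[OF B(1) d0(1) B(2)] TV]
            smooth_on_subset[OF f] W T]) (auto simp: W_def)
    then show "smooth_on W (snd d \<circ> F \<circ> cinv c)"
      by (rule smooth_on_cong[OF _ W]) (use * d0 in auto)
  qed
qed

text \<open>The differential in freely chosen charts. \<open>tangent_map\<close>,
  \<open>tvec\<close> and \<open>tcoord\<close> are all instances, so one chain rule governs maps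
  and changes of coordinates alike.\<close>

definition dmap :: "('p, 'e::euclidean_space) chart \<Rightarrow> ('q, 'f::euclidean_space) chart \<Rightarrow> ('p \<Rightarrow> 'q)
    \<Rightarrow> 'p \<Rightarrow> 'e \<Rightarrow> 'f" where
  "dmap c d F p = FD (snd d \<circ> F \<circ> cinv c) (snd c p)"

lemma tangent_map_dmap: "tangent_map A B F p = dmap (chart_at A p) (chart_at B (F p)) F p"
  and tvec_dmap: "tvec A c p = dmap c (chart_at A p) id p"
  and tcoord_dmap: "tcoord A c p = dmap (chart_at A p) c id p"
  by (auto simp: fun_eq_iff tangent_map_def tvec_def tcoord_def dmap_def)

lemma dmap_has_derivative:
  assumes "smooth_atlas A" "c \<in> A" "p \<in> fst c" "smooth_atlas B" "d \<in> B" "F p \<in> fst d" "smooth_map {p} A B F"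
  shows "(snd d \<circ> F \<circ> cinv c has_derivative dmap c d F p) (at (snd c p))"
proof -
  obtain W where "open W" "snd c p \<in> W" "smooth_on W (snd d \<circ> F \<circ> cinv c)"
    by (rule smooth_map_charts[OF assms openin_topspace]) (use pointsI[OF assms(5,6)] in auto)
  then show ?thesis unfolding dmap_def using smooth_on_has_derivative by blast
qed

lemma dmap_linear:
  assumes "smooth_atlas A" "c \<in> A" "p \<in> fst c" "smooth_atlas B" "d \<in> B" "F p \<in> fst d" "smooth_map {p} A B F"
  shows "linear (dmap c d F p)"
  using dmap_has_derivative[OF assms] has_derivative_linear by blast

lemma smooth_map_comp:
  assumes A: "smooth_atlas A" "smooth_atlas B" "smooth_atlas C"
    and F: "smooth_map {p} A B F" "smooth_map {F p} B C G"
  shows "smooth_map {p} A C (G \<circ> F)"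
    and "\<lbrakk>c \<in> A; p \<in> fst c; d \<in> B; F p \<in> fst d; e \<in> C; G (F p) \<in> fst e\<rbrakk>
      \<Longrightarrow> dmap c e (G \<circ> F) p v = dmap d e G (F p) (dmap c d F p v)"
proof -
  have *: "\<exists>W. open W \<and> snd c p \<in> W \<and> W \<subseteq> snd c ` fst c \<and> (G \<circ> F) ` cinv c ` W \<subseteq> fst e \<and>
        smooth_on W (snd e \<circ> (G \<circ> F) \<circ> cinv c) \<and>
        dmap c e (G \<circ> F) p = (\<lambda>v. dmap d e G (F p) (dmap c d F p v))"
    if c: "c \<in> A" "p \<in> fst c" "d \<in> B" "F p \<in> fst d" "e \<in> C" "G (F p) \<in> fst e" for c d e
  proof -
    note [simp] = cinv_chart[OF A(1)] cinv_chart[OF A(2)]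
    obtain W2 where W2: "open W2" "snd d (F p) \<in> W2" "W2 \<subseteq> snd d ` fst d" "G ` cinv d ` W2 \<subseteq> fst e"
      "smooth_on W2 (snd e \<circ> G \<circ> cinv d)"
      by (rule smooth_map_charts[OF A(2) c(3,4) A(3) c(5,6) F(2) openin_topspace])
        (use pointsI[OF c(5,6)] in auto)
    have N: "openin (mtop B) {q \<in> fst d. snd d q \<in> W2}" "F p \<in> {q \<in> fst d. snd d q \<in> W2}"
      using openin_chart_preimage[OF c(3) W2(1)] c W2 by auto
    obtain W where W: "open W" "snd c p \<in> W" "W \<subseteq> snd c ` fst c"
      "F ` cinv c ` W \<subseteq> fst d \<inter> {q \<in> fst d. snd d q \<in> W2}" "smooth_on W (snd d \<circ> F \<circ> cinv c)"
      by (rule smooth_map_charts[OF A(1) c(1,2) A(2) c(3,4) F(1) N])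
    have Wd: "F (cinv c u) \<in> fst d" "snd d (F (cinv c u)) \<in> W2" if "u \<in> W" for u using W(4) that by auto
    then have eq: "(snd e \<circ> G \<circ> cinv d) ((snd d \<circ> F \<circ> cinv c) u) = (snd e \<circ> (G \<circ> F) \<circ> cinv c) u"
      if "u \<in> W" for u using that c by auto
    have "G (F (cinv c u)) \<in> fst e" if "u \<in> W" for u
      using Wd[OF that] W2(4) c by (auto simp: image_subset_iff)
    moreover have "smooth_on W (\<lambda>u. (snd e \<circ> G \<circ> cinv d) ((snd d \<circ> F \<circ> cinv c) u))"
      by (rule smooth_on_compose[OF W2(5) W(5,1) W2(1)]) (use Wd in auto)
    then have "smooth_on W (snd e \<circ> (G \<circ> F) \<circ> cinv c)"
      by (rule smooth_on_cong[OF _ W(1)]) (use eq in auto)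
    moreover have "((\<lambda>u. (snd e \<circ> G \<circ> cinv d) ((snd d \<circ> F \<circ> cinv c) u)) has_derivative
        (\<lambda>v. dmap d e G (F p) (dmap c d F p v))) (at (snd c p))"
      by (rule has_derivative_compose[OF dmap_has_derivative[OF A(1) c(1,2) A(2) c(3,4) F(1)]])
        (use dmap_has_derivative[OF A(2) c(3,4) A(3) c(5,6) F(2)] cinv_chart[OF A(1) c(1,2)] in \<open>simp add: o_def\<close>)
    then have "(snd e \<circ> (G \<circ> F) \<circ> cinv c has_derivative
        (\<lambda>v. dmap d e G (F p) (dmap c d F p v))) (at (snd c p))"
      by (rule has_derivative_transform_open[OF _ W(1,2)]) (use eq in auto)
    then have "dmap c e (G \<circ> F) p = (\<lambda>v. dmap d e G (F p) (dmap c d F p v))"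
      unfolding dmap_def by (rule FD_eqI)
    ultimately show ?thesis using W by (intro exI[of _ W]) auto
  qed
  have "p \<in> points A" "F p \<in> points B" "G (F p) \<in> points C"
    using F unfolding smooth_map_def by (auto intro: pointsI)
  note ch = chart_at_in[OF this(1)] chart_at_in[OF this(2)] chart_at_in[OF this(3)]
  from *[OF ch] show "smooth_map {p} A C (G \<circ> F)"
    unfolding smooth_map_def using ch(1,2,5,6)
    by (auto intro!: bexI[of _ "chart_at A p"] bexI[of _ "chart_at C (G (F p))"])
  show "\<lbrakk>c \<in> A; p \<in> fst c; d \<in> B; F p \<in> fst d; e \<in> C; G (F p) \<in> fst e\<rbrakk>
      \<Longrightarrow> dmap c e (G \<circ> F) p v = dmap d e G (F p) (dmap c d F p v)"
    using *[of c d e] by metis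
qed

lemma smooth_map_id: "smooth_atlas A \<Longrightarrow> p \<in> points A \<Longrightarrow> smooth_map {p} A A id"
  unfolding smooth_map_def
proof (intro ballI)
  fix q assume *: "smooth_atlas A" "p \<in> points A" "q \<in> {p}"
  let ?c = "chart_at A p"
  have c: "?c \<in> A" "p \<in> fst ?c" using * chart_at_in by auto
  have "smooth_on (snd ?c ` fst ?c) (snd ?c \<circ> id \<circ> cinv ?c)"
    using smooth_on_cong[OF smooth_on_id chart_open[OF *(1) c(1)]] chart_cinv[OF *(1) c(1)] by simp
  then show "\<exists>c\<in>A. \<exists>d\<in>A. \<exists>W. q \<in> fst c \<and> id q \<in> fst d \<and> open W \<and> snd c q \<in> W \<and> W \<subseteq> snd c ` fst c
      \<and> id ` cinv c ` W \<subseteq> fst d \<and> smooth_on W (snd d \<circ> id \<circ> cinv c)"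
    using c * chart_open[OF *(1) c(1)] cinv_in[OF *(1) c(1)]
    by (intro bexI[of _ ?c] exI[of _ "snd ?c ` fst ?c"]) auto
qed

lemma dmap_id:
  assumes "smooth_atlas A" "c \<in> A" "p \<in> fst c"
  shows "dmap c c id p v = v"
proof -
  have "(snd c \<circ> id \<circ> cinv c has_derivative (\<lambda>x. x)) (at (snd c p))"
    by (rule has_derivative_transform_open[OF has_derivative_ident chart_open[OF assms(1,2)]])
      (use assms chart_cinv[OF assms(1,2)] in auto)
  then show ?thesis unfolding dmap_def using FD_eqI by metis
qed

lemma smooth_map_cong:
  fixes A :: "('p, 'e::euclidean_space) atlas" and B :: "('q, 'f::euclidean_space) atlas" and d :: "('q, 'f) chart"
  assumes "smooth_atlas A" "smooth_atlas B" "smooth_map {p} A B F" "openin (mtop A) U" "p \<in> U" "\<And>q. q \<in> U \<Longrightarrow> F q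
      = G q"
  shows "smooth_map {p} A B G"
    and "\<lbrakk>c \<in> A; p \<in> fst c\<rbrakk> \<Longrightarrow> dmap c d F p = dmap c d G p"
    and "tangent_map A B F p = tangent_map A B G p"
proof -
  obtain c d W where c: "c \<in> A" "d \<in> B" "p \<in> fst c" "F p \<in> fst d" "open W" "snd c p \<in> W"
     "W \<subseteq> snd c ` fst c" "F ` cinv c ` W \<subseteq> fst d" "smooth_on W (snd d \<circ> F \<circ> cinv c)"
    using assms(3) unfolding smooth_map_def by blast
  let ?W = "W \<inter> snd c ` (fst c \<inter> U)"
  have W: "open ?W" using openin_chart_image[OF assms(1) c(1) assms(4)] c by auto
  have eq: "F (cinv c u) = G (cinv c u)" if "u \<in> ?W" for u
    using that assms(6) cinv_chart[OF assms(1) c(1)] by auto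
  have "smooth_on ?W (snd d \<circ> F \<circ> cinv c)" using smooth_on_subset c by blast
  then have "smooth_on ?W (snd d \<circ> G \<circ> cinv c)"
    by (rule smooth_on_cong[OF _ W]) (use eq in auto)
  moreover have "G (cinv c u) \<in> fst d" if "u \<in> ?W" for u using c(8) eq[OF that, symmetric] that by auto
  then have "G ` cinv c ` ?W \<subseteq> fst d" by blast
  ultimately show "smooth_map {p} A B G"
    unfolding smooth_map_def using c assms(5,6) W
    by (intro ballI bexI[of _ c] bexI[of _ d] exI[of _ ?W]) auto
  show *: "dmap c d F p = dmap c d G p" if "c \<in> A" "p \<in> fst c" for c and d :: "('q, 'f) chart"
    unfolding dmap_def
    by (rule FD_cong_open[OF openin_chart_image[OF assms(1) that(1) assms(4)]])
      (use that assms(5,6) cinv_chart[OF assms(1) that(1)] in auto)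
  show "tangent_map A B F p = tangent_map A B G p"
    unfolding tangent_map_dmap using *[OF chart_at_in[OF pointsI[OF c(1,3)]]] assms(6)[OF assms(5)] by simp
qed

lemma smooth_map_points:
  assumes "smooth_map {p} A B F"
  shows "p \<in> points A" "F p \<in> points B"
  using assms unfolding smooth_map_def by (auto intro: pointsI)

lemma tangent_map_comp:
  assumes "smooth_atlas A" "smooth_atlas B" "smooth_atlas C"
    and "smooth_map {p} A B F" "smooth_map {F p} B C G"
  shows "tangent_map A C (G \<circ> F) p v = tangent_map B C G (F p) (tangent_map A B F p v)"
  unfolding tangent_map_dmap o_apply[of G F p]
  by (rule smooth_map_comp(2)[OF assms])
    (rule chart_at_in smooth_map_points(1)[OF assms(4)] smooth_map_points[OF assms(5)])+

lemma tangent_map_id: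
  assumes "smooth_atlas A" "p \<in> points A"
  shows "tangent_map A A id p v = v"
  using dmap_id[OF assms(1) chart_at_in[OF assms(2)], of v] by (simp add: tangent_map_dmap)

lemma linear_tangent_map:
  assumes "smooth_atlas A" "smooth_atlas B" "smooth_map {p} A B F"
  shows "linear (tangent_map A B F p)"
  unfolding tangent_map_dmap
  by (rule dmap_linear[OF assms(1) _ _ assms(2) _ _ assms(3)])
    (rule chart_at_in smooth_map_points[OF assms(3)])+

text \<open>The chain rule for \<open>id \<circ> id\<close>, read in the chart \<open>c\<close> and
  the preferred chart, makes \<open>tvec\<close> and \<open>tcoord\<close> mutually inverse.\<close>

lemma
  assumes A: "smooth_atlas A" "c \<in> A" "p \<in> fst c"
  shows tvec_tcoord: "tvec A c p (tcoord A c p v) = v"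
    and tcoord_tvec: "tcoord A c p (tvec A c p v) = v"
    and linear_tvec: "linear (tvec A c p)"
    and linear_tcoord: "linear (tcoord A c p)"
proof -
  have p: "p \<in> points A" by (rule pointsI[OF A(2,3)])
  note ch = chart_at_in[OF p] and id = smooth_map_id[OF A(1) p]
  have *: "dmap d' e id p (dmap c' d' id p v) = dmap c' e id p v"
    if "c' \<in> A" "d' \<in> A" "e \<in> A" "p \<in> fst c'" "p \<in> fst d'" "p \<in> fst e" for c' d' e v
  proof -
    have "dmap c' e (id \<circ> id) p v = dmap d' e id (id p) (dmap c' d' id p v)"
      by (rule smooth_map_comp(2)[OF A(1) A(1) A(1) id]) (use id that in simp_all)
    then show ?thesis by simp
  qed
  show "tvec A c p (tcoord A c p v) = v" "tcoord A c p (tvec A c p v) = v"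
    unfolding tvec_dmap tcoord_dmap using * A ch dmap_id[OF A(1)] by auto
  show "linear (tvec A c p)" "linear (tcoord A c p)"
    unfolding tvec_dmap tcoord_dmap using dmap_linear[OF A(1) _ _ A(1) _ _ id] A ch by auto
qed

text \<open>The chain rule for \<open>F \<circ> id\<close> and for \<open>id \<circ> F\<close>,
  which are the same map: it moves the computation from preferred charts to \<open>c\<close> and
  \<open>d\<close>.\<close>

lemma tangent_map_tvec:
  assumes "smooth_atlas A" "smooth_atlas B" "smooth_map {p} A B F"
    and "c \<in> A" "p \<in> fst c" "d \<in> B" "F p \<in> fst d"
  shows "tangent_map A B F p (tvec A c p h) = tvec B d (F p) (dmap c d F p h)"
proof -
  have p: "p \<in> points A" "F p \<in> points B" by (rule pointsI[OF assms(4,5)] pointsI[OF assms(6,7)])+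
  have "dmap c (chart_at B (F p)) (F \<circ> id) p h
      = dmap (chart_at A p) (chart_at B (F p)) F (id p) (dmap c (chart_at A p) id p h)"
    by (rule smooth_map_comp(2)[OF assms(1,1,2) smooth_map_id[OF assms(1) p(1)]])
      (use assms chart_at_in[OF p(1)] chart_at_in[OF p(2)] in simp_all)
  moreover have "dmap c (chart_at B (F p)) (id \<circ> F) p h = dmap d (chart_at B (F p)) id (F p) (dmap c d F p h)"
    by (rule smooth_map_comp(2)[OF assms(1,2,2,3) smooth_map_id[OF assms(2) p(2)]])
      (use assms chart_at_in[OF p(2)] in simp_all)
  ultimately show ?thesis by (simp add: tangent_map_dmap tvec_dmap)
qed

section \<open>Differential forms in charts and naturality of d\<close>

text \<open>The coefficients of a form in a fixed chart. Since the preferred chart can change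
  discontinuously with the point, only after conversion by \<open>tvec\<close> do the covectors form
  a smooth family.\<close>

definition formc :: "('p, 'e::euclidean_space) atlas \<Rightarrow> ('p, 'e) chart \<Rightarrow> ('p \<Rightarrow> 'e \<Rightarrow> real) \<Rightarrow> 'e \<Rightarrow> 'e \<Rightarrow> real" where
  "formc A c \<alpha> u h = \<alpha> (cinv c u) (tvec A c (cinv c u) h)"

lemma ext_deriv_dcov: "ext_deriv A \<alpha> p v w = dcov (formc A (chart_at A p) \<alpha>) (snd (chart_at A p) p) v w"
  by (simp add: ext_deriv_def Let_def dcov_def formc_def)

lemma form_on_covec:
  assumes "smooth_atlas A" "c \<in> A" "form_on A U \<alpha>"
  shows "smooth_covec (snd c ` (fst c \<inter> U)) (formc A c \<alpha>)"
  unfolding smooth_covec_def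
proof (intro conjI ballI allI)
  fix y assume "y \<in> snd c ` (fst c \<inter> U)"
  then obtain p where p: "p \<in> fst c" "p \<in> U" "y = snd c p" by auto
  then have "linear (\<alpha> p)" "linear (tvec A c p)"
    using assms linear_tvec[OF assms(1,2)] by (auto simp: form_on_def)
  then show "linear (formc A c \<alpha> y)"
    using p linear_compose[of "tvec A c p" "\<alpha> p"] cinv_chart[OF assms(1,2)]
    by (simp add: o_def formc_def[abs_def])
next
  fix h show "smooth_on (snd c ` (fst c \<inter> U)) (\<lambda>y. formc A c \<alpha> y h)"
    using assms by (simp add: formc_def form_on_def)
qed

lemma form_on_subset: "form_on A U \<alpha> \<Longrightarrow> V \<subseteq> U \<Longrightarrow> form_on A V \<alpha>"
  unfolding form_on_def by (meson Int_mono image_mono order_refl smooth_on_subset subsetD)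

definition pull :: "('p, 'e::euclidean_space) atlas \<Rightarrow> ('q, 'f::euclidean_space) atlas \<Rightarrow> ('p \<Rightarrow> 'q)
    \<Rightarrow> ('q \<Rightarrow> 'f \<Rightarrow> real) \<Rightarrow> 'p \<Rightarrow> 'e \<Rightarrow> real" where
  "pull A B F \<beta> p v = \<beta> (F p) (tangent_map A B F p v)"

lemma smooth_map_near:
  assumes "smooth_atlas A" "smooth_atlas B" "smooth_map {p} A B F" "c \<in> A" "d \<in> B" "W \<subseteq> snd c ` fst c"
    "open W" "F ` cinv c ` W \<subseteq> fst d" "smooth_on W (snd d \<circ> F \<circ> cinv c)" "u \<in> W"
  shows "smooth_map {cinv c u} A B F"
  unfolding smooth_map_def
proof (intro ballI bexI[of _ c] bexI[of _ d] exI[of _ W])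
  fix q assume q: "q \<in> {cinv c u}"
  have u: "u \<in> snd c ` fst c" using assms by blast
  have "cinv c u \<in> fst c" "snd c (cinv c u) = u" by (rule cinv_in[OF assms(1,4) u] chart_cinv[OF assms(1,4) u])+
  then show "q \<in> fst c \<and> F q \<in> fst d \<and> open W \<and> snd c q \<in> W \<and> W \<subseteq> snd c ` fst c \<and>
      F ` cinv c ` W \<subseteq> fst d \<and> smooth_on W (snd d \<circ> F \<circ> cinv c)"
    using assms q by auto
qed (use assms in auto)

text \<open>In charts the pull-back of a form is the pull-back by the coordinate expression of
  \<open>F\<close>. \<open>W\<close> is shrunk so that its image stays where \<open>\<beta>\<close>
  is known to be smooth.\<close>

lemma formc_pull:
  assumes A: "smooth_atlas A" "smooth_atlas B" "smooth_map {p} A B F" "c \<in> A" "p \<in> fst c" "d \<in> B" "F p \<in> fst d"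
    and V: "openin (mtop B) V" "F p \<in> V" "form_on B V \<beta>"
  obtains W where "open W" "snd c p \<in> W" "W \<subseteq> snd c ` fst c" "smooth_on W (snd d \<circ> F \<circ> cinv c)"
    "(snd d \<circ> F \<circ> cinv c) ` W \<subseteq> snd d ` (fst d \<inter> V)"
    "\<And>u h. u \<in> W \<Longrightarrow> formc A c (pull A B F \<beta>) u h
      = formc B d \<beta> ((snd d \<circ> F \<circ> cinv c) u) (FD (snd d \<circ> F \<circ> cinv c) u h)"
proof -
  obtain W where W: "open W" "snd c p \<in> W" "W \<subseteq> snd c ` fst c" "F ` cinv c ` W \<subseteq> fst d \<inter> V"
    "smooth_on W (snd d \<circ> F \<circ> cinv c)"
    using smooth_map_charts[OF A(1,4,5,2,6,7,3) V(1,2)] by metis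
  show ?thesis
  proof (rule that[OF W(1-3,5)])
    have "F (cinv c u) \<in> fst d \<inter> V" if "u \<in> W" for u using W(4) that by blast
    then show "(snd d \<circ> F \<circ> cinv c) ` W \<subseteq> snd d ` (fst d \<inter> V)" by auto
    fix u h assume u: "u \<in> W"
    have q: "cinv c u \<in> fst c" "snd c (cinv c u) = u" "F (cinv c u) \<in> fst d"
      using cinv_in[OF A(1,4), of u] chart_cinv[OF A(1,4), of u] W(3,4) u by blast+
    have "F ` cinv c ` W \<subseteq> fst d" using W(4) by auto
    then have sm: "smooth_map {cinv c u} A B F"
      by (rule smooth_map_near[OF A(1-4,6) W(3,1) _ W(5) u])
    show "formc A c (pull A B F \<beta>) u h
      = formc B d \<beta> ((snd d \<circ> F \<circ> cinv c) u) (FD (snd d \<circ> F \<circ> cinv c) u h)"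
      using tangent_map_tvec[OF A(1,2) sm A(4) q(1) A(6) q(3), of h] cinv_chart[OF A(2,6) q(3)]
      unfolding formc_def pull_def dmap_def q(2) by simp
  qed
qed

lemma form_on_cong:
  assumes "smooth_atlas A" "openin (mtop A) U" "form_on A U \<alpha>" "\<And>p. p \<in> U \<Longrightarrow> \<alpha> p = \<beta> p"
  shows "form_on A U \<beta>"
  unfolding form_on_def
proof (intro conjI ballI allI)
  fix c h assume c: "c \<in> A"
  show "smooth_on (snd c ` (fst c \<inter> U)) (\<lambda>u. \<beta> (cinv c u) (tvec A c (cinv c u) h))"
    by (rule smooth_on_cong[of _ "\<lambda>u. \<alpha> (cinv c u) (tvec A c (cinv c u) h)"])
      (use assms c openin_chart_image[OF assms(1) c assms(2)] cinv_chart[OF assms(1) c] in \<open>auto simp: form_on_def\<close>)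
qed (use assms in \<open>auto simp: form_on_def\<close>)

lemma form_on_localI:
  assumes "smooth_atlas A" "\<And>p. p \<in> U \<Longrightarrow> linear (\<alpha> p)"
    and "\<And>p c h. p \<in> U \<Longrightarrow> c \<in> A \<Longrightarrow> p \<in> fst c \<Longrightarrow>
      \<exists>W. open W \<and> snd c p \<in> W \<and> smooth_on W (\<lambda>u. formc A c \<alpha> u h)"
  shows "form_on A U \<alpha>"
  unfolding form_on_def
proof (intro conjI ballI allI smooth_on_local)
  fix c h x assume "c \<in> A" "x \<in> snd c ` (fst c \<inter> U)"
  then show "\<exists>N. open N \<and> x \<in> N \<and> smooth_on N (\<lambda>u. \<alpha> (cinv c u) (tvec A c (cinv c u) h))"
    using assms(3) unfolding formc_def by fast
qed (use assms in auto)

lemma form_on_pull: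
  assumes A: "smooth_atlas A" "smooth_atlas B" "smooth_map U A B F"
    and V: "openin (mtop B) V" "F ` U \<subseteq> V" "form_on B V \<beta>"
  shows "form_on A U (pull A B F \<beta>)"
proof (rule form_on_localI[OF A(1)])
  fix p assume p: "p \<in> U"
  have F: "smooth_map {p} A B F" by (rule smooth_map_singleton[OF A(3) p])
  show "linear (pull A B F \<beta> p)"
    using linear_compose[OF linear_tangent_map[OF A(1,2) F], of "\<beta> (F p)"] V p
    by (auto simp: form_on_def pull_def[abs_def] o_def)
  fix c h assume c: "c \<in> A" "p \<in> fst c"
  have Fp: "F p \<in> points B" "F p \<in> V" using smooth_map_points[OF F] V(2) p by auto
  note d = chart_at_in[OF Fp(1)]
  let ?d = "chart_at B (F p)" let ?f = "snd ?d \<circ> F \<circ> cinv c"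
  obtain W where W: "open W" "snd c p \<in> W" "W \<subseteq> snd c ` fst c" "smooth_on W ?f"
    "?f ` W \<subseteq> snd ?d ` (fst ?d \<inter> V)"
    "\<And>u h. u \<in> W \<Longrightarrow> formc A c (pull A B F \<beta>) u h = formc B ?d \<beta> (?f u) (FD ?f u h)"
    using formc_pull[OF A(1,2) F c d V(1) Fp(2) V(3)] by metis
  have "smooth_on W (\<lambda>u. formc B ?d \<beta> (?f u) (FD ?f u h))"
    by (rule smooth_covec_apply[OF form_on_covec[OF A(2) d(1) V(3)] W(1) openin_chart_image[OF A(2) d(1) V(1)]
        W(4,5) smooth_on_FD[OF W(4,1)]])
  then have "smooth_on W (\<lambda>u. formc A c (pull A B F \<beta>) u h)"
    by (rule smooth_on_cong[OF _ W(1)]) (use W(6) in auto)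
  then show "\<exists>W. open W \<and> snd c p \<in> W \<and> smooth_on W (\<lambda>u. formc A c (pull A B F \<beta>) u h)"
    using W by blast
qed

lemma dcov_formc_pull:
  assumes A: "smooth_atlas A" "smooth_atlas B" "smooth_map {p} A B F" "c \<in> A" "p \<in> fst c" "d \<in> B" "F p \<in> fst d"
    and V: "openin (mtop B) V" "F p \<in> V" "form_on B V \<beta>"
  shows "dcov (formc A c (pull A B F \<beta>)) (snd c p) h k
    = dcov (formc B d \<beta>) (snd d (F p)) (dmap c d F p h) (dmap c d F p k)"
proof -
  let ?f = "snd d \<circ> F \<circ> cinv c"
  obtain W where W: "open W" "snd c p \<in> W" "W \<subseteq> snd c ` fst c" "smooth_on W ?f"
    "?f ` W \<subseteq> snd d ` (fst d \<inter> V)"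
    "\<And>u h. u \<in> W \<Longrightarrow> formc A c (pull A B F \<beta>) u h = formc B d \<beta> (?f u) (FD ?f u h)"
    using formc_pull[OF assms] by metis
  have "dcov (formc A c (pull A B F \<beta>)) (snd c p) h k
      = dcov (\<lambda>u h. formc B d \<beta> (?f u) (FD ?f u h)) (snd c p) h k"
    by (rule arg_cong[where f = "\<lambda>D. D h k"], rule dcov_cong[OF W(1,2)], rule W(6))
  also have "\<dots> = dcov (formc B d \<beta>) (?f (snd c p)) (FD ?f (snd c p) h) (FD ?f (snd c p) k)"
    by (rule dcov_pullback[OF form_on_covec[OF A(2,6) V(3)] W(1) openin_chart_image[OF A(2,6) V(1)] W(4,5,2)])
  finally show ?thesis unfolding dmap_def using cinv_chart[OF A(1,4,5)] by simp
qed

lemma ext_deriv_pull: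
  assumes A: "smooth_atlas A" "smooth_atlas B" "smooth_map {p} A B F"
    and V: "openin (mtop B) V" "F p \<in> V" "form_on B V \<beta>"
  shows "ext_deriv A (pull A B F \<beta>) p v w
    = ext_deriv B \<beta> (F p) (tangent_map A B F p v) (tangent_map A B F p w)"
  unfolding ext_deriv_dcov tangent_map_dmap
  by (rule dcov_formc_pull[OF A _ _ _ _ V]) (rule chart_at_in smooth_map_points[OF A(3)])+

lemma dcov_formc_cong:
  assumes "smooth_atlas A" "c \<in> A" "p \<in> fst c" "openin (mtop A) U" "p \<in> U" "\<And>q. q \<in> U \<Longrightarrow> \<alpha> q = \<beta> q"
  shows "dcov (formc A c \<alpha>) (snd c p) = dcov (formc A c \<beta>) (snd c p)"
  by (rule dcov_cong[OF openin_chart_image[OF assms(1,2,4)]])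
    (use assms cinv_chart[OF assms(1,2)] in \<open>auto simp: formc_def\<close>)

lemma ext_deriv_cong:
  assumes "smooth_atlas A" "openin (mtop A) U" "p \<in> U" "\<And>q. q \<in> U \<Longrightarrow> \<alpha> q = \<beta> q"
  shows "ext_deriv A \<alpha> p = ext_deriv A \<beta> p"
proof -
  have "p \<in> points A" using openin_subset[OF assms(2)] assms(3) by auto
  then show ?thesis
    using dcov_formc_cong[OF assms(1) chart_at_in assms(2-4)] by (intro ext) (simp add: ext_deriv_dcov)
qed

text \<open>Naturality applied to the identity, read from the chart \<open>c\<close> to the
  preferred chart: \<open>ext_deriv\<close> does not depend on the chart in which it is
  computed.\<close>

lemma ext_deriv_chart:
  assumes A: "smooth_atlas A" "c \<in> A" "p \<in> fst c"
    and V: "openin (mtop A) V" "p \<in> V" "form_on A V \<alpha>"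
  shows "ext_deriv A \<alpha> p (tvec A c p h) (tvec A c p k) = dcov (formc A c \<alpha>) (snd c p) h k"
proof -
  have p: "p \<in> points A" by (rule pointsI[OF A(2,3)])
  have "dcov (formc A c \<alpha>) (snd c p) = dcov (formc A c (pull A A id \<alpha>)) (snd c p)"
    by (rule dcov_formc_cong[OF A openin_topspace])
      (use p tangent_map_id[OF A(1)] in \<open>auto simp: pull_def fun_eq_iff\<close>)
  moreover have "dcov (formc A c (pull A A id \<alpha>)) (snd c p) h k = ext_deriv A \<alpha> p (tvec A c p h) (tvec A c p k)"
    unfolding ext_deriv_dcov tvec_dmap
    using dcov_formc_pull[OF A(1) A(1) smooth_map_id[OF A(1) p] A(2,3) chart_at_in(1)[OF p], of V \<alpha>]
      chart_at_in(2)[OF p] V by simp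
  ultimately show ?thesis by simp
qed

lemma ext_deriv_zero:
  assumes "smooth_atlas A" "openin (mtop A) U" "p \<in> U" "form_on A U \<alpha>"
  shows "ext_deriv A \<alpha> p 0 v = 0"
proof -
  have p: "p \<in> points A" using openin_subset[OF assms(2)] assms(3) by auto
  note c = chart_at_in[OF p]
  show ?thesis
    unfolding ext_deriv_dcov
    by (rule dcov_zero[OF form_on_covec[OF assms(1) c(1) assms(4)] openin_chart_image[OF assms(1) c(1) assms(2)]])
      (use c assms in auto)
qed

lemma openin_smooth_preimage:
  assumes A: "smooth_atlas A" "smooth_atlas B" "openin (mtop A) U" "smooth_map U A B F" "openin (mtop B) V"
  shows "openin (mtop A) {p \<in> U. F p \<in> V}"
proof (rule openin_mtop_locally)
  fix p assume p: "p \<in> {p \<in> U. F p \<in> V}"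
  then have F: "smooth_map {p} A B F" using smooth_map_singleton[OF A(4)] by auto
  note c = chart_at_in[OF smooth_map_points(1)[OF F]] and d = chart_at_in[OF smooth_map_points(2)[OF F]]
  let ?c = "chart_at A p"
  have FV: "F p \<in> V" using p by auto
  obtain W where W: "open W" "snd ?c p \<in> W" "W \<subseteq> snd ?c ` fst ?c" "F ` cinv ?c ` W \<subseteq> fst (chart_at B (F p)) \<inter> V"
    "smooth_on W (snd (chart_at B (F p)) \<circ> F \<circ> cinv ?c)"
    by (rule smooth_map_charts[OF A(1) c A(2) d F A(5) FV])
  let ?Q = "W \<inter> snd ?c ` (fst ?c \<inter> U)"
  have "open ?Q" using W(1) openin_chart_image[OF A(1) c(1) A(3)] by auto
  moreover have "{q \<in> fst ?c. snd ?c q \<in> ?Q} \<subseteq> {p \<in> U. F p \<in> V}"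
  proof
    fix q assume q: "q \<in> {q \<in> fst ?c. snd ?c q \<in> ?Q}"
    then obtain q' where q': "q' \<in> fst ?c" "q' \<in> U" "snd ?c q = snd ?c q'" by auto
    then have "q = q'" using chart_inj[OF A(1) c(1)] q by (auto dest: inj_onD)
    moreover have "F (cinv ?c (snd ?c q)) \<in> V" using W(4) q by blast
    ultimately show "q \<in> {p \<in> U. F p \<in> V}" using q' cinv_chart[OF A(1) c(1), of q] q by simp
  qed
  ultimately show "\<exists>c\<in>A. \<exists>Q. p \<in> fst c \<and> open Q \<and> snd c p \<in> Q \<and> {q \<in> fst c. snd c q \<in> Q} \<subseteq> {p \<in> U. F p \<in> V}"
    using c W(2) p by (intro bexI[of _ ?c] exI[of _ ?Q]) auto
qed

lemma smooth_on_chart_map: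
  assumes "smooth_map {p} A B F" "smooth_atlas A" "smooth_atlas B" "c \<in> A" "p \<in> fst c" "d \<in> B" "F p \<in> fst d"
  obtains W where "open W" "snd c p \<in> W" "W \<subseteq> snd c ` fst c" "F ` cinv c ` W \<subseteq> fst d"
    "smooth_on W (snd d \<circ> F \<circ> cinv c)"
  by (rule smooth_map_charts[OF assms(2,4,5,3,6,7,1) openin_topspace])
    (use pointsI[OF assms(6,7)] in auto)

lemma smooth_on_charts:
  assumes A: "smooth_atlas A" "smooth_atlas B" "smooth_map U A B F" "c \<in> A" "d \<in> B"
    and W: "W \<subseteq> snd c ` (fst c \<inter> U)" "F ` cinv c ` W \<subseteq> fst d"
  shows "smooth_on W (snd d \<circ> F \<circ> cinv c)"
proof (rule smooth_on_local)
  fix u assume u: "u \<in> W"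
  then obtain p where p: "p \<in> fst c" "p \<in> U" "u = snd c p" using W by auto
  then have q: "cinv c u = p" using cinv_chart[OF A(1,4)] by simp
  then have Fp: "F p \<in> fst d" using W(2) u by blast
  obtain N where "open N" "snd c p \<in> N" "N \<subseteq> snd c ` fst c" "F ` cinv c ` N \<subseteq> fst d" "smooth_on N (snd d \<circ> F \<circ>
      cinv c)"
    by (rule smooth_on_chart_map[OF smooth_map_singleton[OF A(3) p(2)] A(1,2,4) p(1) A(5) Fp])
  then show "\<exists>N. open N \<and> u \<in> N \<and> smooth_on N (snd d \<circ> F \<circ> cinv c)" using p(3) by blast
qed

section \<open>Atlases adapted to a fibration\<close>

text \<open>An index \<open>(c, W, G)\<close> stands for a chart \<open>c\<close> of the base, an open subset \<open>W\<close> of its domain over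
  which the fibration is trivialised, and a fibre coordinate \<open>G\<close> with values in the model fibre \<open>K\<close>.\<close>

locale fibred_atlas =
  fixes B :: "('b, 'e::euclidean_space) atlas" and T :: "'p set" and pr :: "'p \<Rightarrow> 'b"
    and I :: "(('b, 'e) chart \<times> 'b set \<times> ('p \<Rightarrow> 'f::euclidean_space)) set" and K :: "'f set"
  assumes base: "smooth_atlas B"
    and open_K: "open K"
    and idx: "(c, W, G) \<in> I \<Longrightarrow> c \<in> B \<and> openin (mtop B) W \<and> W \<subseteq> fst c"
    and fib: "(c, W, G) \<in> I \<Longrightarrow> x \<in> W \<Longrightarrow> bij_betw G {y \<in> T. pr y = x} K"
    and trans: "(c, W, G) \<in> I \<Longrightarrow> (c', W', G') \<in> I \<Longrightarrow>
      smooth_on (snd c ` (W \<inter> W') \<times> K) (\<lambda>z. G' (the_inv_into {y \<in> T. pr y = cinv c (fst z)} G (snd z)))"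
begin

definition bchart :: "('b, 'e) chart \<times> 'b set \<times> ('p \<Rightarrow> 'f) \<Rightarrow> ('p, 'e \<times> 'f) chart" where
  "bchart = (\<lambda>(c, W, G). ({y \<in> T. pr y \<in> W}, \<lambda>y. (snd c (pr y), G y)))"

definition atl :: "('p, 'e \<times> 'f) atlas" where
  "atl = bchart ` I"

lemma fst_bchart: "fst (bchart (c, W, G)) = {y \<in> T. pr y \<in> W}"
  and snd_bchart: "snd (bchart (c, W, G)) y = (snd c (pr y), G y)"
  by (auto simp: bchart_def)

lemma bchart_image:
  assumes i: "(c, W, G) \<in> I"
  shows "snd (bchart (c, W, G)) ` {y \<in> T. pr y \<in> W \<inter> V} = snd c ` (W \<inter> V) \<times> K"
proof -
  have "G ` {y \<in> T. pr y = x} = K" if "x \<in> W" for x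
    using fib[OF i that] by (simp add: bij_betw_def)
  then have "K = {g. \<exists>y\<in>T. pr y = x \<and> g = G y}" if "x \<in> W" for x using that by blast
  then show ?thesis unfolding snd_bchart by auto
qed

lemma bchart_inj:
  assumes i: "(c, W, G) \<in> I"
  shows "inj_on (snd (bchart (c, W, G))) (fst (bchart (c, W, G)))"
proof (rule inj_onI)
  fix y z assume yz: "y \<in> fst (bchart (c, W, G))" "z \<in> fst (bchart (c, W, G))"
    "snd (bchart (c, W, G)) y = snd (bchart (c, W, G)) z"
  then have "pr y \<in> W" "pr z \<in> W" "snd c (pr y) = snd c (pr z)" "G y = G z" "y \<in> T" "z \<in> T"
    by (auto simp: fst_bchart snd_bchart)
  moreover from this have "pr y = pr z"
    using chart_inj[OF base, of c] idx[OF i] by (meson inj_onD subsetD)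
  ultimately show "y = z" using fib[OF i, of "pr y"] by (auto simp: bij_betw_def dest: inj_onD)
qed

lemma
  assumes i: "(c, W, G) \<in> I" and z: "fst z \<in> snd c ` W" "snd z \<in> K"
  shows cinv_bchart: "cinv (bchart (c, W, G)) z = the_inv_into {y \<in> T. pr y = cinv c (fst z)} G (snd z)"
    and pr_cinv_bchart: "cinv (bchart (c, W, G)) z \<in> T" "pr (cinv (bchart (c, W, G)) z) = cinv c (fst z)"
      "G (cinv (bchart (c, W, G)) z) = snd z"
proof -
  obtain x where x: "x \<in> W" "fst z = snd c x" using z by auto
  have cx: "cinv c (fst z) = x" using cinv_chart[OF base] idx[OF i] x by auto
  let ?y = "the_inv_into {y \<in> T. pr y = x} G (snd z)"
  note f = fib[OF i x(1), unfolded bij_betw_def]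
  have y: "?y \<in> {y \<in> T. pr y = x}" by (rule the_inv_into_into) (use f z in auto)
  have Gy: "G ?y = snd z" by (rule f_the_inv_into_f) (use f z in auto)
  have "cinv (bchart (c, W, G)) z = ?y"
    by (rule the_inv_into_f_eq[OF bchart_inj[OF i]]) (use x y Gy in \<open>auto simp: fst_bchart snd_bchart prod_eq_iff\<close>)
  then show "cinv (bchart (c, W, G)) z = the_inv_into {y \<in> T. pr y = cinv c (fst z)} G (snd z)"
     "cinv (bchart (c, W, G)) z \<in> T" "pr (cinv (bchart (c, W, G)) z) = cinv c (fst z)"
      "G (cinv (bchart (c, W, G)) z) = snd z"
    using cx y Gy by auto
qed

lemma open_bchart_image: "(c, W, G) \<in> I \<Longrightarrow> openin (mtop B) V \<Longrightarrow> open (snd c ` (W \<inter> V) \<times> K)"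
  using openin_chart_image[OF base, of c "W \<inter> V"] idx[of c W G] open_K
  by (auto intro!: open_Times simp: Int_absorb1 le_infI1)

text \<open>A transition map splits into a transition of the base, which ignores the fibre, and the
  change of fibre coordinate, which is the locale assumption \<open>trans\<close>.\<close>

lemma smooth_atlas_atl: "smooth_atlas atl"
  unfolding smooth_atlas_def
proof (intro conjI ballI)
  fix C assume "C \<in> atl"
  then obtain c W G where C: "C = bchart (c, W, G)" "(c, W, G) \<in> I" by (auto simp: atl_def)
  note i = idx[OF C(2)]
  show "inj_on (snd C) (fst C)" using bchart_inj C by simp
  have "snd C ` fst C = snd c ` (W \<inter> W) \<times> K"
    using bchart_image[OF C(2), of W] by (simp add: C fst_bchart)
  then show "open (snd C ` fst C)" using open_bchart_image[OF C(2), of W] i by simp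
next
  fix C C' assume "C \<in> atl" "C' \<in> atl"
  then obtain c W G c' W' G' where C: "C = bchart (c, W, G)" "(c, W, G) \<in> I"
    and C': "C' = bchart (c', W', G')" "(c', W', G') \<in> I" by (auto simp: atl_def)
  note i = idx[OF C(2)] and i' = idx[OF C'(2)]
  let ?S = "snd c ` (W \<inter> W') \<times> K"
  have "fst C \<inter> fst C' = {y \<in> T. pr y \<in> W \<inter> W'}" by (auto simp: C C' fst_bchart)
  then have img: "snd C ` (fst C \<inter> fst C') = ?S"
    using bchart_image[OF C(2), of W'] by (simp add: C)
  have opS: "open ?S" using open_bchart_image[OF C(2)] i' by simp
  then show "open (snd C ` (fst C \<inter> fst C'))" using img by simp
  have opc: "open (snd c ` (W \<inter> W'))" 
    using openin_chart_image[OF base, of c "W \<inter> W'"] i i' by (simp add: Int_absorb1 le_infI1 openin_Int)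
  have "smooth_on (snd c ` (W \<inter> W')) (snd c' \<circ> cinv c)"
    by (rule smooth_on_subset[OF transition_smooth(2)[OF base]]) (use i i' in auto)
  then have "smooth_on ?S (\<lambda>z. (snd c' \<circ> cinv c) (fst z))"
    by (rule smooth_on_compose[OF _ smooth_on_fst[OF smooth_on_id] opS opc]) auto
  then have "smooth_on ?S (\<lambda>z. ((snd c' \<circ> cinv c) (fst z), G' (the_inv_into {y \<in> T. pr y = cinv c (fst z)} G
      (snd z))))"
    by (intro smooth_on_Pair trans[OF C(2) C'(2)])
  then show "smooth_on (snd C ` (fst C \<inter> fst C')) (snd C' \<circ> cinv C)"
    unfolding img
  proof (rule smooth_on_cong[OF _ opS])
    fix z assume z: "z \<in> ?S"
    then have "fst z \<in> snd c ` W" "snd z \<in> K" by auto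
    from cinv_bchart[OF C(2) this] pr_cinv_bchart[OF C(2) this]
    show "((snd c' \<circ> cinv c) (fst z), G' (the_inv_into {y \<in> T. pr y = cinv c (fst z)} G (snd z))) = (snd C' \<circ>
        cinv C) z"
      by (simp add: C C' snd_bchart)
  qed
qed

lemma bchart_in: "i \<in> I \<Longrightarrow> bchart i \<in> atl"
  by (auto simp: atl_def)

lemma bchart_range:
  assumes i: "(c, W, G) \<in> I"
  shows "snd (bchart (c, W, G)) ` fst (bchart (c, W, G)) = snd c ` W \<times> K"
  using bchart_image[OF i, of W] by (simp add: fst_bchart)

lemma open_bchart_range:
  assumes i: "(c, W, G) \<in> I"
  shows "open (snd c ` W \<times> K)" "open (snd c ` W)"
  using open_bchart_image[OF i, of W] openin_chart_image[OF base, of c W] idx[OF i]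
  by (auto simp: Int_absorb1)

text \<open>In an adapted chart the projection is \<open>fst\<close>, which is its own
  derivative.\<close>

lemma pr_smooth_bchart:
  assumes i: "(c, W, G) \<in> I" and y: "y \<in> T" "pr y \<in> W"
  shows "smooth_map {y} atl B pr"
    and "dmap (bchart (c, W, G)) c pr y h = fst h"
    and "tangent_map atl B pr y (tvec atl (bchart (c, W, G)) y h) = tvec B c (pr y) (fst h)"
proof -
  let ?C = "bchart (c, W, G)" let ?S = "snd c ` W \<times> K"
  note [simp] = fst_bchart snd_bchart
  have cW: "c \<in> B" "openin (mtop B) W" "W \<subseteq> fst c" using idx[OF i] by auto
  have eq: "fst z = (snd c \<circ> pr \<circ> cinv ?C) z" if "z \<in> ?S" for z
  proof -
    have z: "fst z \<in> snd c ` W" "snd z \<in> K" using that by auto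
    show ?thesis using pr_cinv_bchart[OF i z] chart_cinv[OF base cW(1), of "fst z"] cW z by auto
  qed
  have Cy: "snd ?C y \<in> ?S" using bchart_range[OF i] y by (metis (no_types, lifting) fst_bchart imageI
      mem_Collect_eq)
  have sm: "smooth_on ?S (snd c \<circ> pr \<circ> cinv ?C)"
    by (rule smooth_on_cong[OF smooth_on_fst[OF smooth_on_id] open_bchart_range(1)[OF i]]) (use eq in auto)
  show pr: "smooth_map {y} atl B pr"
    unfolding smooth_map_def
  proof (intro ballI bexI[of _ ?C] bexI[of _ c] exI[of _ ?S])
    have "pr ` cinv ?C ` ?S \<subseteq> fst c"
    proof clarify
      fix u g assume z: "u \<in> W" "g \<in> K"
      then show "pr (cinv ?C (snd c u, g)) \<in> fst c"
        using pr_cinv_bchart[OF i, of "(snd c u, g)"] cinv_chart[OF base cW(1), of u] cW by auto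
    qed
    then show "q \<in> fst ?C \<and> pr q \<in> fst c \<and> open ?S \<and> snd ?C q \<in> ?S \<and> ?S \<subseteq> snd ?C ` fst ?C \<and>
        pr ` cinv ?C ` ?S \<subseteq> fst c \<and> smooth_on ?S (snd c \<circ> pr \<circ> cinv ?C)" if "q \<in> {y}" for q
      using that y Cy sm bchart_range[OF i] open_bchart_range(1)[OF i] cW by auto
  qed (use bchart_in[OF i] cW in auto)
  have "FD fst (snd ?C y) = dmap ?C c pr y"
    unfolding dmap_def by (rule FD_cong_open[OF open_bchart_range(1)[OF i] Cy eq])
  moreover have "FD fst (snd ?C y) = fst" by (rule FD_eqI) (auto intro!: derivative_eq_intros)
  ultimately show d: "dmap ?C c pr y h = fst h" by simp
  show "tangent_map atl B pr y (tvec atl ?C y h) = tvec B c (pr y) (fst h)"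
    using tangent_map_tvec[OF smooth_atlas_atl base pr bchart_in[OF i] _ cW(1), of h] y cW d by auto
qed

lemma smooth_map_into:
  assumes i: "(c, W, G) \<in> I" and "c0 \<in> A" "p \<in> fst c0" "open W0" "snd c0 p \<in> W0" "W0 \<subseteq> snd c0 ` fst c0"
    and "\<And>u. u \<in> W0 \<Longrightarrow> F (cinv c0 u) \<in> T \<and> pr (F (cinv c0 u)) \<in> W"
    and "smooth_on W0 (\<lambda>u. snd c (pr (F (cinv c0 u))))" "smooth_on W0 (\<lambda>u. G (F (cinv c0 u)))"
    and "smooth_atlas A"
  shows "smooth_map {p} A atl F"
  unfolding smooth_map_def
proof (intro ballI bexI[of _ c0] bexI[of _ "bchart (c, W, G)"] exI[of _ W0])
  have "smooth_on W0 (snd (bchart (c, W, G)) \<circ> F \<circ> cinv c0)"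
    unfolding o_def snd_bchart by (intro smooth_on_Pair assms)
  moreover have "F p \<in> T \<and> pr (F p) \<in> W" using assms(7)[OF assms(5)] cinv_chart[OF assms(10,2,3)] by simp
  ultimately show "q \<in> fst c0 \<and> F q \<in> fst (bchart (c, W, G)) \<and> open W0 \<and> snd c0 q \<in> W0 \<and> W0 \<subseteq> snd c0 ` fst c0 \<and>
        F ` cinv c0 ` W0 \<subseteq> fst (bchart (c, W, G)) \<and> smooth_on W0 (snd (bchart (c, W, G)) \<circ> F \<circ> cinv c0)"
    if "q \<in> {p}" for q
    using that assms by (auto simp: fst_bchart)
qed (use bchart_in[OF i] assms in auto)

end

text \<open>Covectors are identified with vectors, so that coefficients in linear relations between
  covector fields can be computed by inner products.\<close>

definition cvec :: "('e::euclidean_space \<Rightarrow> real) \<Rightarrow> 'e" where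
  "cvec a = (\<Sum>b\<in>Basis. a b *\<^sub>R b)"

lemma cvec_inner: "linear a \<Longrightarrow> cvec a \<bullet> h = a h"
  using linear_Basis_sum[of a h] by (simp add: cvec_def inner_sum_right inner_commute[of _ h] mult.commute)

lemma cvec_comb: "cvec (\<lambda>h. r * a h + s * b h) = r *\<^sub>R cvec a + s *\<^sub>R cvec b"
  and cvec_scale: "cvec (\<lambda>h. r * a h) = r *\<^sub>R cvec a"
  by (simp_all add: cvec_def scaleR_sum_right algebra_simps sum.distrib)

lemma cvec_smooth:
  assumes "\<And>h. smooth_on S (\<lambda>y. \<alpha> y h)" "open S"
  shows "smooth_on S (\<lambda>y. cvec (\<alpha> y))"
  unfolding cvec_def using assms by (intro smooth_intros) auto

text \<open>Subtracting from \<open>v\<close> its multiple of \<open>z\<close> with the same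
  \<open>s\<close>-value leaves a vector in the kernel of \<open>s\<close>, hence of
  \<open>t\<close>.\<close>

lemma proportional_covectors:
  fixes s t :: "'e::real_vector \<Rightarrow> real"
  assumes "linear s" "linear t" "{v. s v = 0} \<subseteq> {v. t v = 0}" "s z \<noteq> 0"
  shows "t = (\<lambda>v. (t z / s z) * s v)"
proof
  fix v
  have "s (v - (s v / s z) *\<^sub>R z) = 0" using assms by (simp add: linear_diff linear_scale)
  then have "t (v - (s v / s z) *\<^sub>R z) = 0" using assms by blast
  then show "t v = (t z / s z) * s v" using assms by (simp add: linear_diff linear_scale)
qed

lemma smooth_covec_cvec: "smooth_covec S \<alpha> \<Longrightarrow> open S \<Longrightarrow> smooth_on S (\<lambda>y. cvec (\<alpha> y))"
  unfolding smooth_covec_def by (intro cvec_smooth) auto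

text \<open>The factor between \<open>\<beta>\<close> and \<open>\<alpha>\<close> is only given
  point by point, but is automatically smooth; on the kernel its differential then drops
  out.\<close>

lemma ext_deriv_scale:
  assumes A: "smooth_atlas A" and U: "openin (mtop A) U" "p \<in> U"
    and \<alpha>: "form_on A U \<alpha>" and \<beta>: "form_on A U \<beta>" and \<beta>r: "\<And>q. q \<in> U \<Longrightarrow> \<exists>r. \<beta> q = (\<lambda>v. r * \<alpha> q v)"
    and nz: "\<And>q. q \<in> U \<Longrightarrow> \<exists>v. \<alpha> q v \<noteq> 0"
    and r: "\<beta> p = (\<lambda>v. r * \<alpha> p v)" and uv: "\<alpha> p u = 0" "\<alpha> p v = 0"
  shows "ext_deriv A \<beta> p u v = r * ext_deriv A \<alpha> p u v"
proof -
  have p: "p \<in> points A" using openin_subset[OF U(1)] U(2) by auto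
  let ?c = "chart_at A p"
  note c = chart_at_in[OF p]
  let ?S = "snd ?c ` (fst ?c \<inter> U)"
  have opS: "open ?S" by (rule openin_chart_image[OF A c(1) U(1)])
  have pS: "snd ?c p \<in> ?S" using c(2) U(2) by auto
  obtain \<rho> where \<rho>: "\<And>q. q \<in> U \<Longrightarrow> \<beta> q = (\<lambda>v. \<rho> q * \<alpha> q v)" using \<beta>r by metis
  note cov = form_on_covec[OF A c(1) \<alpha>] form_on_covec[OF A c(1) \<beta>]
  have q: "cinv ?c y \<in> fst ?c" "cinv ?c y \<in> U" if "y \<in> ?S" for y
    using that cinv_chart[OF A c(1)] by auto
  have nzc: "\<exists>h. formc A ?c \<alpha> y h \<noteq> 0" if "y \<in> ?S" for y
    using nz[OF q(2)[OF that]] tvec_tcoord[OF A c(1) q(1)[OF that]] unfolding formc_def by metis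
  have eq: "formc A ?c \<beta> y h = \<rho> (cinv ?c y) * formc A ?c \<alpha> y h" if "y \<in> ?S" for y h
    using \<rho>[OF q(2)[OF that]] by (simp add: formc_def)
  have "smooth_on ?S (\<lambda>y. \<rho> (cinv ?c y))"
  proof (rule smooth_on_coeff1[OF opS smooth_covec_cvec[OF cov(2) opS] smooth_covec_cvec[OF cov(1) opS]])
    fix y assume y: "y \<in> ?S"
    have "linear (formc A ?c \<alpha> y)" using cov(1) y unfolding smooth_covec_def by blast
    from cvec_inner[OF this] nzc[OF y] show "cvec (formc A ?c \<alpha> y) \<noteq> 0" by (metis inner_zero_left)
    have "formc A ?c \<beta> y = (\<lambda>h. \<rho> (cinv ?c y) * formc A ?c \<alpha> y h)" using eq[OF y] by blast
    then show "cvec (formc A ?c \<beta> y) = \<rho> (cinv ?c y) *\<^sub>R cvec (formc A ?c \<alpha> y)" by (simp add: cvec_scale)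
  qed
  \<comment> \<open>At \<open>p\<close> itself the chart \<open>?c\<close> is the preferred one, so
    vectors agree with their components.\<close>
  moreover have tv: "tvec A ?c p h = h" for h unfolding tvec_dmap by (rule dmap_id[OF A c])
  have fp: "formc A ?c \<alpha> (snd ?c p) h = \<alpha> p h" for h
    using cinv_chart[OF A c] tv by (simp add: formc_def)
  ultimately have "dcov (\<lambda>y h. \<rho> (cinv ?c y) * formc A ?c \<alpha> y h) (snd ?c p) u v
      = \<rho> (cinv ?c (snd ?c p)) * dcov (formc A ?c \<alpha>) (snd ?c p) u v"
    using uv by (intro dcov_scale[OF cov(1) opS pS]) (simp_all only: fp)
  moreover have "dcov (formc A ?c \<beta>) (snd ?c p) = dcov (\<lambda>y h. \<rho> (cinv ?c y) * formc A ?c \<alpha> y h) (snd ?c p)"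
    by (rule dcov_cong[OF opS pS]) (rule eq)
  moreover have "\<rho> p = r"
  proof -
    obtain z where "\<alpha> p z \<noteq> 0" using nz[OF U(2)] by blast
    then show ?thesis using fun_cong[OF trans[OF \<rho>[OF U(2), symmetric] r], of z] by simp
  qed
  ultimately show ?thesis using cinv_chart[OF A c] unfolding ext_deriv_dcov by simp
qed

section \<open>The bundle E\<close>

lemma line_subbundle_span:
  assumes "line_subbundle A T" "p \<in> points A" "X \<in> T p" "X \<noteq> 0"
  shows "T p = {a *\<^sub>R X | a. True}"
proof -
  obtain Y where Y: "T p = span {Y}" using assms(1,2) unfolding line_subbundle_def by meson
  then obtain k where k: "X = k *\<^sub>R Y" using assms(3) by (auto simp: span_singleton)
  then have a: "a *\<^sub>R Y = (a / k) *\<^sub>R X" for a using assms(4) by auto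
  have b: "a *\<^sub>R X = (a * k) *\<^sub>R Y" for a using k by simp
  show ?thesis unfolding Y span_singleton using a b by blast
qed

lemma line_subbundle_nonzero:
  assumes "line_subbundle A T" "p \<in> points A"
  obtains X where "X \<in> T p" "X \<noteq> 0"
proof -
  obtain X where "X \<noteq> 0" "T p = span {X}" using assms unfolding line_subbundle_def by meson
  then show ?thesis using that[of X] by (simp add: span_base)
qed

definition Ecoord :: "('m \<Rightarrow> covector) \<Rightarrow> 'm contact_covector \<Rightarrow> real" where
  "Ecoord \<theta> e = (THE r. snd e = (\<lambda>v. r * \<theta> (fst e) v))"

lemma Ecoord_eq: "\<theta> x z \<noteq> 0 \<Longrightarrow> Ecoord \<theta> (x, \<lambda>v. r * \<theta> x v) = r"
  unfolding Ecoord_def by (rule the_equality) (auto dest: fun_cong[of _ _ z])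

definition Eidx :: "'m mfd3 \<Rightarrow> 'm dist3 \<Rightarrow> 'm dist3 \<Rightarrow> (('m, real^3) chart \<times> 'm set \<times>
    ('m contact_covector \<Rightarrow> real)) set" where
  "Eidx M T1 T2 = {(c, W, Ecoord \<theta>) | c W \<theta>.
      c \<in> M \<and> openin (mtop M) W \<and> W \<subseteq> fst c \<and> form_on M W \<theta> \<and> kernel_on W (dsum T1 T2) \<theta>}"

lemma EidxI:
  assumes "c \<in> M" "openin (mtop M) W" "W \<subseteq> fst c" "form_on M W \<theta>" "kernel_on W (dsum T1 T2) \<theta>"
  shows "(c, W, Ecoord \<theta>) \<in> Eidx M T1 T2"
  unfolding Eidx_def using assms by blast

lemma EidxE:
  assumes "i \<in> Eidx M T1 T2"
  obtains c W \<theta> where "i = (c, W, Ecoord \<theta>)" "c \<in> M" "openin (mtop M) W" "W \<subseteq> fst c" "form_on M W \<theta>"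
    "kernel_on W (dsum T1 T2) \<theta>"
  using assms unfolding Eidx_def by blast

locale enriched =
  fixes M :: "'m mfd3" and T1 T2 L :: "'m dist3"
  assumes M: "smooth_manifold M" and en: "enriched_path_structure M T1 T2 L"
begin

abbreviation "D \<equiv> dsum T1 T2"
abbreviation "E \<equiv> E_set M T1 T2"
abbreviation "EA \<equiv> E_atlas M T1 T2"

lemma atlas_M: "smooth_atlas M"
  using M by (rule smooth_manifold_atlas)

lemma lines: "line_subbundle M T1" "line_subbundle M T2" "line_subbundle M L"
  using en by (auto simp: enriched_path_structure_def path_structure_def)

section \<open>Frames adapted to the splitting\<close>

definition frame_at :: "'m \<Rightarrow> real^3 \<Rightarrow> real^3 \<Rightarrow> real^3 \<Rightarrow> bool" where
  "frame_at x X1 X2 X \<longleftrightarrow> x \<in> points M \<and> X1 \<in> T1 x \<and> X2 \<in> T2 x \<and> X \<in> L x \<and> X1 \<noteq> 0 \<and> X2 \<noteq> 0 \<and> X \<noteq> 0"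

lemma frame_at_exists: "x \<in> points M \<Longrightarrow> \<exists>X1 X2 X. frame_at x X1 X2 X"
  using lines line_subbundle_nonzero unfolding frame_at_def by meson

lemma
  assumes f: "frame_at x X1 X2 X"
  shows frame_lines: "T1 x = {a *\<^sub>R X1 | a. True}" "T2 x = {a *\<^sub>R X2 | a. True}" "L x = {a *\<^sub>R X | a. True}"
    and frame_span: "\<exists>a b c. v = a *\<^sub>R X1 + b *\<^sub>R X2 + c *\<^sub>R X"
    and frame_indep: "a *\<^sub>R X1 + b *\<^sub>R X2 + c *\<^sub>R X = 0 \<Longrightarrow> a = 0 \<and> b = 0 \<and> c = 0"
    and frame_D: "D x = {a *\<^sub>R X1 + b *\<^sub>R X2 | a b. True}"
proof -
  have x: "x \<in> points M" using f by (simp add: frame_at_def)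
  show l: "T1 x = {a *\<^sub>R X1 | a. True}" "T2 x = {a *\<^sub>R X2 | a. True}" "L x = {a *\<^sub>R X | a. True}"
    using f line_subbundle_span[OF lines(1) x] line_subbundle_span[OF lines(2) x] line_subbundle_span[OF lines(3) x]
    by (auto simp: frame_at_def)
  have ex: "\<exists>!(v1, v2, l). v1 \<in> T1 x \<and> v2 \<in> T2 x \<and> l \<in> L x \<and> v = v1 + v2 + l" for v
    using en x unfolding enriched_path_structure_def by blast
  then obtain v1 v2 l where "v1 \<in> T1 x" "v2 \<in> T2 x" "l \<in> L x" "v = v1 + v2 + l" by blast
  then show "\<exists>a b c. v = a *\<^sub>R X1 + b *\<^sub>R X2 + c *\<^sub>R X" unfolding l by blast
  show "D x = {a *\<^sub>R X1 + b *\<^sub>R X2 | a b. True}" unfolding dsum_def l by blast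
  have uniq: "v1 = w1 \<and> v2 = w2 \<and> l = k" if "v1 \<in> T1 x" "v2 \<in> T2 x" "l \<in> L x"
    "w1 \<in> T1 x" "w2 \<in> T2 x" "k \<in> L x" "v1 + v2 + l = w1 + w2 + k" for v1 v2 l w1 w2 k
    using ex[of "v1 + v2 + l"] that unfolding Ex1_def by (metis (mono_tags, lifting) Pair_inject case_prodI)
  show "a = 0 \<and> b = 0 \<and> c = 0" if "a *\<^sub>R X1 + b *\<^sub>R X2 + c *\<^sub>R X = 0"
  proof -
    have "a *\<^sub>R X1 \<in> T1 x" "b *\<^sub>R X2 \<in> T2 x" "c *\<^sub>R X \<in> L x" "0 \<in> T1 x" "0 \<in> T2 x" "0 \<in> L x"
      unfolding l by (auto intro: exI[of _ 0])
    from uniq[OF this] that have "a *\<^sub>R X1 = 0" "b *\<^sub>R X2 = 0" "c *\<^sub>R X = 0" by auto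
    then show ?thesis using f by (simp add: frame_at_def)
  qed
qed

text \<open>\<open>X\<close> lies outside \<open>D\<close> because it is independent of
  \<open>X1\<close> and \<open>X2\<close>.\<close>

lemma frame_kernel:
  assumes f: "frame_at x X1 X2 X" and t: "{v. t v = 0} = D x"
  shows "t X1 = 0" "t X2 = 0" "t X \<noteq> 0"
proof -
  have "X1 = 1 *\<^sub>R X1 + 0 *\<^sub>R X2" "X2 = 0 *\<^sub>R X1 + 1 *\<^sub>R X2" by auto
  then have "X1 \<in> D x" "X2 \<in> D x" unfolding frame_D[OF f] by blast+
  then show "t X1 = 0" "t X2 = 0" using t by auto
  show "t X \<noteq> 0"
  proof
    assume "t X = 0"
    then obtain a b where "X = a *\<^sub>R X1 + b *\<^sub>R X2" using t frame_D[OF f] by blast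
    then have "a *\<^sub>R X1 + b *\<^sub>R X2 + (-1) *\<^sub>R X = 0" by simp
    then show False using frame_indep[OF f, of a b "-1"] by simp
  qed
qed

lemma kernel_nonzero:
  assumes "x \<in> points M" "{v. t v = 0} = D x"
  obtains z where "t z \<noteq> 0"
  using frame_at_exists[OF assms(1)] frame_kernel(3)[OF _ assms(2)] by blast

lemma contact_form:
  assumes "x \<in> points M"
  obtains U \<theta> where "openin (mtop M) U" "x \<in> U" "form_on M U \<theta>" "kernel_on U D \<theta>"
  using en assms unfolding enriched_path_structure_def path_structure_def contact_distribution_def by meson

lemma openin_points: "openin (mtop M) W \<Longrightarrow> x \<in> W \<Longrightarrow> x \<in> points M"
  using openin_subset by fastforce

lemma kernel_ratio:
  fixes s t :: covector
  assumes x: "x \<in> points M" and s: "linear s" "{v. s v = 0} = D x" and t: "linear t" "{v. t v = 0} = D x"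
  obtains r where "r \<noteq> 0" "t = (\<lambda>v. r * s v)"
proof -
  obtain z where z: "s z \<noteq> 0" using kernel_nonzero[OF x s(2)] .
  moreover have "t z \<noteq> 0" using z s t by auto
  ultimately show ?thesis using that[of "t z / s z"] proportional_covectors[OF s(1) t(1) _ z] s t by auto
qed

section \<open>Trivialisations of E and the tautological form\<close>

lemma E_fib:
  assumes W: "x \<in> points M" "linear (\<theta> x)" "{v. \<theta> x v = 0} = D x"
  shows "bij_betw (Ecoord \<theta>) {e \<in> E. fst e = x} (- {0})"
proof (rule bij_betwI[where g = "\<lambda>r. (x, \<lambda>v. r * \<theta> x v)"])
  obtain z where z: "\<theta> x z \<noteq> 0" using kernel_nonzero W by blast
  have *: "e = (x, \<lambda>v. Ecoord \<theta> e * \<theta> x v) \<and> Ecoord \<theta> e \<noteq> 0" if e: "e \<in> {e \<in> E. fst e = x}" for e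
  proof -
    have "linear (snd e)" "{v. snd e v = 0} = D x" using e by (auto simp: E_set_def)
    then obtain r where "r \<noteq> 0" "snd e = (\<lambda>v. r * \<theta> x v)" using kernel_ratio[OF W(1-3)] by blast
    then have "e = (x, \<lambda>v. r * \<theta> x v)" "r \<noteq> 0" using e by (auto simp: prod_eq_iff)
    then show ?thesis using Ecoord_eq[of \<theta> x z r, OF z] by simp
  qed
  show "Ecoord \<theta> \<in> {e \<in> E. fst e = x} \<rightarrow> - {0}" using * by blast
  show "(x, \<lambda>v. Ecoord \<theta> e * \<theta> x v) = e" if "e \<in> {e \<in> E. fst e = x}" for e using *[OF that] by simp
  show "(\<lambda>r. (x, \<lambda>v. r * \<theta> x v)) \<in> - {0} \<rightarrow> {e \<in> E. fst e = x}"
    using W linear_compose_scale_right[OF W(2)] by (auto simp: E_set_def)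
  show "Ecoord \<theta> (x, \<lambda>v. r * \<theta> x v) = r" for r by (rule Ecoord_eq[of \<theta> x z r, OF z])
qed

lemma form_kernel:
  assumes "form_on M W \<theta>" "kernel_on W D \<theta>" "x \<in> W"
  shows "linear (\<theta> x)" "{v. \<theta> x v = 0} = D x"
  using assms by (auto simp: form_on_def kernel_on_def)

lemma formc_M_nonzero:
  assumes "c \<in> M" "x \<in> fst c" "{v. \<theta> x v = 0} = D x" "linear (\<theta> x)"
  shows "cvec (formc M c \<theta> (snd c x)) \<noteq> 0"
proof
  assume 0: "cvec (formc M c \<theta> (snd c x)) = 0"
  have x: "x \<in> points M" using assms pointsI by metis
  have lin: "linear (formc M c \<theta> (snd c x))"
    using linear_compose[OF linear_tvec[OF atlas_M assms(1,2)] assms(4)] cinv_chart[OF atlas_M assms(1,2)]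
    by (simp add: formc_def[abs_def] o_def)
  obtain z where z: "\<theta> x z \<noteq> 0" using kernel_nonzero[OF x assms(3)] .
  have "formc M c \<theta> (snd c x) (tcoord M c x z) = \<theta> x z"
    using cinv_chart[OF atlas_M assms(1,2)] tvec_tcoord[OF atlas_M assms(1,2)] by (simp add: formc_def)
  then show False using cvec_inner[OF lin, of "tcoord M c x z"] 0 z by simp
qed

lemma E_fibred: "fibred_atlas M E fst (Eidx M T1 T2) (- {0})"
proof
  show "smooth_atlas M" by (rule atlas_M)
  show "open (- {0 :: real})" by auto
  show "c \<in> M \<and> openin (mtop M) W \<and> W \<subseteq> fst c" if "(c, W, G) \<in> Eidx M T1 T2" for c W G
    using that by (auto elim: EidxE)
  show "bij_betw G {y \<in> E. fst y = x} (- {0})" if iW: "(c, W, G) \<in> Eidx M T1 T2" "x \<in> W" for c W G x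
  proof -
    obtain \<theta> where \<theta>: "G = Ecoord \<theta>" "openin (mtop M) W" "form_on M W \<theta>" "kernel_on W D \<theta>"
      using iW(1) by (auto elim: EidxE)
    show ?thesis
      unfolding \<theta>(1) by (rule E_fib[of x \<theta>, OF openin_points[OF \<theta>(2) iW(2)] form_kernel[OF \<theta>(3,4) iW(2)]])
  qed
  fix c W G c' W' G' assume i: "(c, W, G) \<in> Eidx M T1 T2" and i': "(c', W', G') \<in> Eidx M T1 T2"
  obtain \<theta> where \<theta>: "G = Ecoord \<theta>" "c \<in> M" "openin (mtop M) W" "W \<subseteq> fst c" "form_on M W \<theta>" "kernel_on W D \<theta>"
    using i by (auto elim: EidxE)
  obtain \<theta>' where \<theta>': "G' = Ecoord \<theta>'" "openin (mtop M) W'" "W' \<subseteq> fst c'" "form_on M W' \<theta>'" "kernel_on W' D \<theta>'"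
    using i' by (auto elim: EidxE)
  let ?S = "snd c ` (W \<inter> W')" and ?K = "- {0 :: real}"
  have WW: "fst c \<inter> (W \<inter> W') = W \<inter> W'" using \<theta>(4) by auto
  have opS: "open ?S" using openin_chart_image[OF atlas_M \<theta>(2) openin_Int[OF \<theta>(3) \<theta>'(2)]] by (simp add: WW)
  have opSK: "open (?S \<times> ?K)" by (intro open_Times opS) auto
  have sm: "smooth_on ?S (\<lambda>u. cvec (formc M c \<alpha> u))" if "form_on M (W \<inter> W') \<alpha>" for \<alpha>
    using smooth_covec_cvec[OF form_on_covec[OF atlas_M \<theta>(2) that]] opS by (simp add: WW)
  have sm2: "smooth_on (?S \<times> ?K) (\<lambda>z. cvec (formc M c \<alpha> (fst z)))" if "form_on M (W \<inter> W') \<alpha>" for \<alpha>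
    by (rule smooth_on_compose[OF sm[OF that] smooth_on_fst[OF smooth_on_id] opSK opS]) auto
  have f: "form_on M (W \<inter> W') \<theta>" "form_on M (W \<inter> W') \<theta>'"
    using form_on_subset[OF \<theta>(5)] form_on_subset[OF \<theta>'(4)] by auto
  show "smooth_on (?S \<times> ?K) (\<lambda>z. G' (the_inv_into {y \<in> E. fst y = cinv c (fst z)} G (snd z)))"
  \<comment> \<open>The new coordinate of \<open>r \<theta>\<close> is the coefficient of
    \<open>r \<theta>\<close> with respect to \<open>\<theta>'\<close>, and both are smooth covector
    fields.\<close>
  proof (rule smooth_on_coeff1[OF opSK _ sm2[OF f(2)]])
    show "smooth_on (?S \<times> ?K) (\<lambda>z. snd z *\<^sub>R cvec (formc M c \<theta> (fst z)))"
      by (intro smooth_intros opSK sm2[OF f(1)])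
    fix z assume "z \<in> ?S \<times> ?K"
    then obtain x where x: "x \<in> W" "x \<in> W'" "fst z = snd c x" "snd z \<noteq> 0"
      by (auto simp only: mem_Times_iff Compl_iff singleton_iff)
    have cx: "cinv c (fst z) = x" "x \<in> fst c" using x \<theta>(4) cinv_chart[OF atlas_M \<theta>(2)] by auto
    have xM: "x \<in> points M" using openin_points \<theta>(3) x by blast
    note k = form_kernel[OF \<theta>(5,6) x(1)] and k' = form_kernel[OF \<theta>'(4,5) x(2)]
    show "cvec (formc M c \<theta>' (fst z)) \<noteq> 0" using formc_M_nonzero[of c x \<theta>', OF \<theta>(2) cx(2) k'(2,1)] x(3) by simp
    obtain q where q: "\<theta> x q \<noteq> 0" using kernel_nonzero[OF xM k(2)] .
    have e: "the_inv_into {y \<in> E. fst y = x} G (snd z) = (x, \<lambda>v. snd z * \<theta> x v)" (is "_ = ?e")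
    proof (rule the_inv_into_f_eq)
      show "inj_on G {y \<in> E. fst y = x}" using E_fib[of x \<theta>, OF xM k] \<theta>(1) by (simp add: bij_betw_def)
      show "G ?e = snd z" unfolding \<theta>(1) by (rule Ecoord_eq[of \<theta> x q "snd z", OF q])
      show "?e \<in> {y \<in> E. fst y = x}"
        using k xM x(4) linear_compose_scale_right[OF k(1)] by (auto simp: E_set_def)
    qed
    obtain r where r: "\<theta> x = (\<lambda>v. r * \<theta>' x v)" using kernel_ratio[OF xM k' k] by blast
    obtain q' where q': "\<theta>' x q' \<noteq> 0" using kernel_nonzero[OF xM k'(2)] .
    have "G' ?e = snd z * r"
      using Ecoord_eq[of \<theta>' x q' "snd z * r", OF q'] unfolding \<theta>'(1) r by (simp add: mult.assoc)
    moreover have "formc M c \<theta> (fst z) = (\<lambda>h. r * formc M c \<theta>' (fst z) h)"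
      unfolding formc_def cx r ..
    ultimately show "snd z *\<^sub>R cvec (formc M c \<theta> (fst z)) =
        G' (the_inv_into {y \<in> E. fst y = cinv c (fst z)} G (snd z)) *\<^sub>R cvec (formc M c \<theta>' (fst z))"
      unfolding cx e by (simp add: cvec_scale)
  qed
qed

sublocale E: fibred_atlas M E fst "Eidx M T1 T2" "- {0}"
  by (rule E_fibred)

lemma EA_eq: "EA = E.atl"
proof -
  have "EA = {E.bchart (c, W, Ecoord \<theta>) | c W \<theta>.
      c \<in> M \<and> openin (mtop M) W \<and> W \<subseteq> fst c \<and> form_on M W \<theta> \<and> kernel_on W (dsum T1 T2) \<theta>}"
    unfolding E_atlas_def E.bchart_def Ecoord_def[abs_def] by simp
  also have "\<dots> = E.atl" unfolding E.atl_def by (blast intro: EidxI elim: EidxE)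
  finally show ?thesis .
qed

lemma atlas_E: "smooth_atlas EA"
  unfolding EA_eq by (rule E.smooth_atlas_atl)

lemma E_chart_exists:
  assumes "x \<in> points M" "c \<in> M" "x \<in> fst c"
  obtains W \<theta> where "x \<in> W" "W \<subseteq> fst c" "openin (mtop M) W" "form_on M W \<theta>" "kernel_on W D \<theta>"
proof -
  obtain U \<theta> where U: "openin (mtop M) U" "x \<in> U" "form_on M U \<theta>" "kernel_on U D \<theta>"
    using contact_form[OF assms(1)] .
  show ?thesis
  proof (rule that[of "U \<inter> fst c" \<theta>])
    show "openin (mtop M) (U \<inter> fst c)" using U openin_chart_domain[OF assms(2)] by auto
    show "form_on M (U \<inter> fst c) \<theta>" using form_on_subset[OF U(3)] by auto
    show "kernel_on (U \<inter> fst c) D \<theta>" using U(4) by (auto simp: kernel_on_def)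
  qed (use U assms in auto)
qed

lemma points_EA: "points EA = E"
proof
  show "points EA \<subseteq> E" unfolding EA_eq points_def E.atl_def by (auto simp: E.bchart_def)
  show "E \<subseteq> points EA"
  proof
    fix e assume e: "e \<in> E"
    then have x: "fst e \<in> points M" by (auto simp: E_set_def)
    note c = chart_at_in[OF x]
    obtain W \<theta> where W: "fst e \<in> W" "W \<subseteq> fst (chart_at M (fst e))" "openin (mtop M) W" "form_on M W \<theta>"
        "kernel_on W D \<theta>"
      using E_chart_exists[OF x c] .
    have "e \<in> fst (E.bchart (chart_at M (fst e), W, Ecoord \<theta>))" using e W by (simp add: E.fst_bchart)
    then show "e \<in> points EA"
      unfolding EA_eq using pointsI[OF E.bchart_in[OF EidxI[OF c(1) W(3,2,4,5)]]] by blast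
  qed
qed

lemma
  assumes i: "c \<in> M" "openin (mtop M) W" "W \<subseteq> fst c" "form_on M W \<theta>" "kernel_on W D \<theta>"
    and e: "e \<in> E" "fst e \<in> W"
  shows E_proj_tvec: "E_proj M T1 T2 e (tvec EA (E.bchart (c, W, Ecoord \<theta>)) e h) = tvec M c (fst e) (fst h)"
    and E_snd: "snd e = (\<lambda>v. Ecoord \<theta> e * \<theta> (fst e) v)"
proof -
  show "E_proj M T1 T2 e (tvec EA (E.bchart (c, W, Ecoord \<theta>)) e h) = tvec M c (fst e) (fst h)"
    unfolding E_proj_def EA_eq by (rule E.pr_smooth_bchart(3)[OF EidxI[OF i] e])
  note k = form_kernel[OF i(4,5) e(2)]
  have xM: "fst e \<in> points M" using openin_points i e by blast
  have "linear (snd e)" "{v. snd e v = 0} = D (fst e)" using e by (auto simp: E_set_def)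
  then obtain r where r: "snd e = (\<lambda>v. r * \<theta> (fst e) v)" using kernel_ratio[OF xM k] by blast
  obtain z where z: "\<theta> (fst e) z \<noteq> 0" using kernel_nonzero[OF xM k(2)] .
  show "snd e = (\<lambda>v. Ecoord \<theta> e * \<theta> (fst e) v)"
    using Ecoord_eq[of \<theta> "fst e" z r, OF z] r by (metis prod.collapse)
qed

lemma fst_smooth_E:
  assumes "e \<in> E" shows "smooth_map {e} EA M fst"
proof -
  have x: "fst e \<in> points M" using assms by (auto simp: E_set_def)
  note c = chart_at_in[OF x]
  obtain W \<theta> where W: "fst e \<in> W" "W \<subseteq> fst (chart_at M (fst e))" "openin (mtop M) W" "form_on M W \<theta>" "kernel_on
      W D \<theta>"
    using E_chart_exists[OF x c] .
  then show ?thesis unfolding EA_eq using E.pr_smooth_bchart(1)[OF EidxI[OF c(1) W(3,2,4,5)] assms] by blast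
qed

lemma linear_E_proj: "e \<in> E \<Longrightarrow> linear (E_proj M T1 T2 e)"
  unfolding E_proj_def by (rule linear_tangent_map[OF atlas_E atlas_M fst_smooth_E])

lemma E_proj_surj: 
  assumes "e \<in> E" shows "\<exists>h. E_proj M T1 T2 e h = v"
proof -
  have x: "fst e \<in> points M" using assms by (auto simp: E_set_def)
  note c = chart_at_in[OF x]
  obtain W \<theta> where W: "fst e \<in> W" "W \<subseteq> fst (chart_at M (fst e))" "openin (mtop M) W" "form_on M W \<theta>" "kernel_on
      W D \<theta>"
    using E_chart_exists[OF x c] .
  show ?thesis
    using E_proj_tvec[OF c(1) W(3,2,4,5) assms W(1), of "(tcoord M (chart_at M (fst e)) (fst e) v, 0)"]
      tvec_tcoord[OF atlas_M c] unfolding fst_conv by metis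
qed

text \<open>A point of E with fibre coordinate \<open>r\<close> is the covector
  \<open>r \<theta>\<close>, and the projection to M is \<open>fst\<close> in the chart. So the
  tautological form is \<open>r \<theta>\<close>.\<close>

lemma formc_E_taut:
  assumes i: "c \<in> M" "openin (mtop M) W" "W \<subseteq> fst c" "form_on M W \<theta>" "kernel_on W D \<theta>"
    and z: "z \<in> snd c ` W \<times> - {0}"
  shows "formc EA (E.bchart (c, W, Ecoord \<theta>)) (E_taut M T1 T2) z h = snd z * formc M c \<theta> (fst z) (fst h)"
proof -
  let ?C = "E.bchart (c, W, Ecoord \<theta>)"
  have z: "fst z \<in> snd c ` W" "snd z \<in> - {0}" using assms(6) by auto
  note C = E.pr_cinv_bchart[OF EidxI[OF i] z]
  have fW: "fst (cinv ?C z) \<in> W" using C(2) z cinv_chart[OF atlas_M i(1)] i(3) by auto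
  show ?thesis
    unfolding formc_def E_taut_def o_apply E_proj_tvec[OF i C(1) fW] E_snd[OF i C(1) fW]
    unfolding C by simp
qed

lemma E_taut_form: "form_on EA E (E_taut M T1 T2)"
proof (rule form_on_localI[OF atlas_E])
  fix e assume e: "e \<in> E"
  have "linear (snd e)" using e by (auto simp: E_set_def)
  then show "linear (E_taut M T1 T2 e)"
    unfolding E_taut_def using linear_compose[OF linear_E_proj[OF e]] by blast
next
  fix e C and h :: E_model assume e: "e \<in> E" "C \<in> EA" "e \<in> fst C"
  obtain c W \<theta> where C: "C = E.bchart (c, W, Ecoord \<theta>)"
    "c \<in> M" "openin (mtop M) W" "W \<subseteq> fst c" "form_on M W \<theta>" "kernel_on W D \<theta>"
    using e(2) unfolding EA_eq E.atl_def by (blast elim: EidxE)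
  let ?S = "snd c ` W" and ?K = "- {0 :: real}"
  note op = E.open_bchart_range[OF EidxI[OF C(2-6)]]
  have WW: "fst c \<inter> W = W" using C by auto
  have "smooth_on ?S (\<lambda>u. formc M c \<theta> u (fst h))"
    using form_on_covec[OF atlas_M C(2,5)] by (simp add: smooth_covec_def WW)
  then have "smooth_on (?S \<times> ?K) (\<lambda>z. formc M c \<theta> (fst z) (fst h))"
    by (rule smooth_on_compose[OF _ smooth_on_fst[OF smooth_on_id] op]) auto
  then have "smooth_on (?S \<times> ?K) (\<lambda>z. snd z * formc M c \<theta> (fst z) (fst h))"
    by (intro smooth_intros op)
  then have "smooth_on (?S \<times> ?K) (\<lambda>z. formc EA C (E_taut M T1 T2) z h)"
    by (rule smooth_on_cong[OF _ op(1)]) (unfold C(1), rule formc_E_taut[OF C(2-6), symmetric])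
  moreover have "snd C e \<in> ?S \<times> ?K"
    using E.bchart_range[OF EidxI[OF C(2-6)]] e(3) C(1) by blast
  ultimately show "\<exists>N. open N \<and> snd C e \<in> N \<and> smooth_on N (\<lambda>u. formc EA C (E_taut M T1 T2) u h)"
    by (intro exI[of _ "?S \<times> ?K"] conjI op(1))
qed

lemma openin_E: "openin (mtop EA) E"
  using openin_topspace[of "mtop EA"] by (simp add: points_EA)

text \<open>From \<open>d(r \<theta>) = dr \<and> \<theta> + r d\<theta>\<close>: inserting the
  fibre direction leaves \<open>\<theta>\<close>. This later forces \<open>\<phi>\<close> to be
  nonzero on the fibre direction.\<close>

lemma ext_deriv_E_taut_vertical:
  assumes i: "c \<in> M" "openin (mtop M) W" "W \<subseteq> fst c" "form_on M W \<theta>" "kernel_on W D \<theta>"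
    and e: "e \<in> E" "fst e \<in> W"
  shows "ext_deriv EA (E_taut M T1 T2) e
      (tvec EA (E.bchart (c, W, Ecoord \<theta>)) e (0, 1)) (tvec EA (E.bchart (c, W, Ecoord \<theta>)) e (k, 0))
    = \<theta> (fst e) (tvec M c (fst e) k)"
proof -
  let ?C = "E.bchart (c, W, Ecoord \<theta>)" let ?S = "snd c ` W \<times> - {0 :: real}"
  let ?\<theta> = "formc M c \<theta>"
  note ix = EidxI[OF i] and op = E.open_bchart_range[OF EidxI[OF i]]
  have CE: "?C \<in> EA" "e \<in> fst ?C" unfolding EA_eq using E.bchart_in[OF ix] e by (auto simp: E.fst_bchart)
  let ?z = "snd ?C e"
  have z: "?z \<in> ?S" using E.bchart_range[OF ix] CE by blast
  have WW: "fst c \<inter> W = W" using i by auto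
  have cov: "smooth_covec (snd c ` W) ?\<theta>" using form_on_covec[OF atlas_M i(1,4)] by (simp add: WW)
  have fz: "fst ?z \<in> snd c ` W" "fst ?z = snd c (fst e)" using z by (auto simp: E.snd_bchart)
  have \<theta>0: "?\<theta> u 0 = 0" if "u \<in> snd c ` W" for u using cov that unfolding smooth_covec_def by (blast intro:
      linear_0)
  have "ext_deriv EA (E_taut M T1 T2) e (tvec EA ?C e (0, 1)) (tvec EA ?C e (k, 0))
      = dcov (formc EA ?C (E_taut M T1 T2)) ?z (0, 1) (k, 0)"
    by (rule ext_deriv_chart[OF atlas_E CE openin_E e(1) E_taut_form])
  also have "\<dots> = dcov (\<lambda>z h. snd z * ?\<theta> (fst z) (fst h)) ?z (0, 1) (k, 0)"
    by (rule arg_cong[where f = "\<lambda>D. D (0, 1) (k, 0)"], rule dcov_cong[OF op(1) z], rule formc_E_taut[OF i])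
  also have "\<dots> = FD (\<lambda>z. snd z * ?\<theta> (fst z) k) ?z (0, 1) - FD (\<lambda>z. snd z * ?\<theta> (fst z) 0) ?z (k, 0)"
    by (simp add: dcov_def)
  \<comment> \<open>The tautological form vanishes on the fibre direction at every point of the
    chart, so its derivative vanishes too.\<close>
  also have "FD (\<lambda>z. snd z * ?\<theta> (fst z) 0) ?z = FD (\<lambda>z. 0 :: real) ?z"
    by (rule FD_cong_open[OF op(1) z]) (use \<theta>0 in auto)
  also have "FD (\<lambda>z. 0 :: real) ?z = (\<lambda>h. 0)" by (rule FD_eqI) simp
  also have "FD (\<lambda>z. snd z * ?\<theta> (fst z) k) ?z = (\<lambda>h. snd ?z * FD (\<lambda>u. ?\<theta> u k) (fst ?z) (fst h) + snd h * ?\<theta>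
      (fst ?z) k)"
  proof (rule FD_eqI, rule has_derivative_mult)
    have "((\<lambda>u. ?\<theta> u k) has_derivative FD (\<lambda>u. ?\<theta> u k) (fst ?z)) (at (fst ?z))"
      using smooth_on_has_derivative[OF _ op(2) fz(1)] cov unfolding smooth_covec_def by blast
    then show "((\<lambda>z. ?\<theta> (fst z) k) has_derivative (\<lambda>h. FD (\<lambda>u. ?\<theta> u k) (fst ?z) (fst h))) (at ?z)"
      by (rule has_derivative_compose[rotated]) (auto intro!: derivative_eq_intros)
  qed (auto intro!: derivative_eq_intros)
  finally show ?thesis
    using fz(2) cinv_chart[OF atlas_M i(1), of "fst e"] e i
      linear_0[OF has_derivative_linear[OF smooth_on_has_derivative[OF _ op(2) fz(1), of "\<lambda>u. ?\<theta> u k"]]] cov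
    by (auto simp: formc_def smooth_covec_def)
qed

end

section \<open>The bundle Y\<close>

text \<open>The system is triangular: the first relation yields \<open>a\<close> and
  \<open>v1\<close>, the second \<open>v2\<close>, and once these are known the third yields
  \<open>s\<close>. The independence assumptions make the coefficients recoverable. It serves both
  the transition maps of Y and the smoothness of the embedding.\<close>

lemma smooth_Y_act:
  fixes w z1 z2 z3 w1 w2 f :: "'a::euclidean_space \<Rightarrow> 'e::euclidean_space \<Rightarrow> real"
    and a v1 v2 s :: "'a \<Rightarrow> real"
  assumes S: "open S" and sm: "smooth_covec S w" "smooth_covec S z1" "smooth_covec S z2" "smooth_covec S z3"
      "smooth_covec S w1" "smooth_covec S w2" "smooth_covec S f"
    and a: "\<And>x. x \<in> S \<Longrightarrow> a x \<noteq> 0"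
    and w1: "\<And>x h. x \<in> S \<Longrightarrow> w1 x h = a x * z1 x h + v1 x * w x h"
    and w2: "\<And>x h. x \<in> S \<Longrightarrow> w2 x h = (1 / a x) * z2 x h + v2 x * w x h"
    and f: "\<And>x h. x \<in> S \<Longrightarrow> f x h = z3 x h - 1/2 * a x * v2 x * z1 x h + 1/2 * (1 / a x) * v1 x * z2 x h + s x *
        w x h"
    and indep: "\<And>x. x \<in> S \<Longrightarrow> \<exists>h. w x h = 0 \<and> z1 x h \<noteq> 0" "\<And>x. x \<in> S \<Longrightarrow> \<exists>h. w x h = 0 \<and> z2 x h \<noteq> 0"
      "\<And>x. x \<in> S \<Longrightarrow> \<exists>h. w x h \<noteq> 0"
  shows "smooth_on S (\<lambda>x. (a x, v1 x, v2 x, s x))"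
proof -
  note cv = smooth_covec_cvec[OF _ S]
  have ind: "r = 0 \<and> t = 0" if "x \<in> S" "r *\<^sub>R cvec (z x) + t *\<^sub>R cvec (w x) = 0"
    "smooth_covec S z" "\<exists>h. w x h = 0 \<and> z x h \<noteq> 0" for x r t z
  proof -
    have "r * z x h + t * w x h = 0" for h
      using arg_cong[OF that(2), of "\<lambda>c. c \<bullet> h"] sm(1) that(1,3)
      by (simp add: inner_left_distrib cvec_inner smooth_covec_def)
    then show ?thesis using that(4) indep(3)[OF that(1)] by (metis add_0 mult_eq_0_iff mult_zero_right
        add.right_neutral)
  qed
  have A: "smooth_on S a" "smooth_on S v1"
    by (rule smooth_on_coeff2[OF S cv[OF sm(5)] cv[OF sm(2)] cv[OF sm(1)]];
        use ind[OF _ _ sm(2) indep(1)] w1 in \<open>auto simp: cvec_comb[symmetric] intro!: arg_cong[of _ _ cvec]\<close>)+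
  have B: "smooth_on S v2"
    by (rule smooth_on_coeff2(2)[OF S cv[OF sm(6)] cv[OF sm(3)] cv[OF sm(1)], of "\<lambda>x. 1 / a x" v2];
        use ind[OF _ _ sm(3) indep(2)] w2 in \<open>auto simp: cvec_comb[symmetric] intro!: arg_cong[of _ _ cvec]\<close>)
  \<comment> \<open>\<open>g\<close> collects everything in the third relation except
    \<open>s * w\<close>; the factors 1 give it the shape required by
    \<open>smooth_covec_comb\<close>.\<close>
  define g where "g = (\<lambda>x h. 1 * (1 * f x h + (-1) * z3 x h) + 1 *
      ((1/2 * a x * v2 x) * z1 x h + (- (1/2 * (1 / a x) * v1 x)) * z2 x h))"
  have g: "smooth_covec S g" unfolding g_def
    by (intro smooth_covec_comb sm S smooth_on_const; (intro smooth_intros S A B a)?)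
  have "smooth_on S s"
  proof (rule smooth_on_coeff1[OF S cv[OF g] cv[OF sm(1)]])
    fix x assume x: "x \<in> S"
    then show "cvec (w x) \<noteq> 0" using ind[OF x, of 0 z1 1] sm(2) indep(1)[OF x] by auto
    have "g x = (\<lambda>h. s x * w x h)" using f[OF x] by (auto simp: g_def fun_eq_iff)
    then show "cvec (g x) = s x *\<^sub>R cvec (w x)" by (simp add: cvec_scale)
  qed
  then show ?thesis using A B by (intro smooth_on_Pair)
qed

lemma Y_act_sel:
  "Y_act g (w, w1, w2, f) = (w, \<lambda>h. fst g * w1 h + fst (snd g) * w h,
      \<lambda>h. (1 / fst g) * w2 h + fst (snd (snd g)) * w h,
      \<lambda>h. f h - 1/2 * fst g * fst (snd (snd g)) * w1 h + 1/2 * (1 / fst g) * fst (snd g) * w2 h + snd (snd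
          (snd g)) * w h)"
  by (cases g) simp

type_synonym Y_group = "real \<times> real \<times> real \<times> real"

definition Ysec :: "'m mfd3 \<Rightarrow> 'm dist3 \<Rightarrow> 'm dist3 \<Rightarrow> ('m contact_covector \<Rightarrow> E_covector) \<Rightarrow>
    ('m contact_covector \<Rightarrow> E_covector) \<Rightarrow> ('m contact_covector \<Rightarrow> E_covector) \<Rightarrow> 'm contact_covector \<Rightarrow> E_coframe" where
  "Ysec M T1 T2 \<eta>1 \<eta>2 \<psi> e = (E_taut M T1 T2 e, \<eta>1 e, \<eta>2 e, \<psi> e)"

definition Ycoord :: "('m contact_covector \<Rightarrow> E_coframe) \<Rightarrow> 'm Y_point \<Rightarrow> Y_group" where
  "Ycoord q y = (THE g. fst g \<noteq> 0 \<and> snd y = Y_act g (q (fst y)))"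

definition Ysection :: "'m mfd3 \<Rightarrow> 'm dist3 \<Rightarrow> 'm dist3 \<Rightarrow> (('m contact_covector), E_model) chart \<Rightarrow> 'm
    contact_covector set \<Rightarrow>
   ('m contact_covector \<Rightarrow> E_covector) \<Rightarrow>
    ('m contact_covector \<Rightarrow> E_covector) \<Rightarrow> ('m contact_covector \<Rightarrow> E_covector) \<Rightarrow> bool" where
  "Ysection M T1 T2 c V \<eta>1 \<eta>2 \<psi> \<longleftrightarrow> c \<in> E_atlas M T1 T2 \<and> openin (mtop (E_atlas M T1 T2)) V \<and> V \<subseteq> fst c \<and>
      form_on (E_atlas M T1 T2) V \<eta>1 \<and> form_on (E_atlas M T1 T2) V \<eta>2 \<and>
      form_on (E_atlas M T1 T2) V \<psi> \<and>
      (\<forall>e\<in>V. Ysec M T1 T2 \<eta>1 \<eta>2 \<psi> e \<in> Y_fibre M T1 T2 e)"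

definition Yidx :: "'m mfd3 \<Rightarrow> 'm dist3 \<Rightarrow> 'm dist3 \<Rightarrow>
    (('m contact_covector, E_model) chart \<times> 'm contact_covector set \<times> ('m Y_point \<Rightarrow> Y_group)) set" where
  "Yidx M T1 T2 = {(c, V, Ycoord (Ysec M T1 T2 \<eta>1 \<eta>2 \<psi>)) | c V \<eta>1 \<eta>2 \<psi>. Ysection M T1 T2 c V \<eta>1 \<eta>2 \<psi>}"

lemma YidxI: "Ysection M T1 T2 c V \<eta>1 \<eta>2 \<psi> \<Longrightarrow> (c, V, Ycoord (Ysec M T1 T2 \<eta>1 \<eta>2 \<psi>)) \<in> Yidx M T1 T2"
  unfolding Yidx_def by blast

lemma YidxE:
  assumes "i \<in> Yidx M T1 T2"
  obtains c V \<eta>1 \<eta>2 \<psi> where "i = (c, V, Ycoord (Ysec M T1 T2 \<eta>1 \<eta>2 \<psi>))" "Ysection M T1 T2 c V \<eta>1 \<eta>2 \<psi>"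
  using assms unfolding Yidx_def by blast

definition YK :: "Y_group set" where
  "YK = {g. fst g \<noteq> 0}"

lemma open_YK: "open YK"
proof -
  have eq: "YK = (- {0}) \<times> UNIV" by (auto simp: YK_def)
  show ?thesis unfolding eq by (intro open_Times open_UNIV) auto
qed

context enriched
begin

abbreviation "YS \<equiv> Y_set M T1 T2"
abbreviation "YA \<equiv> Y_atlas M T1 T2"
abbreviation "Yf \<equiv> Y_fibre M T1 T2"
abbreviation "taut \<equiv> E_taut M T1 T2"

section \<open>The structure group acts simply transitively on the fibres of Y\<close>

lemma E_frame_lifts:
  assumes e: "e \<in> E"
  obtains X1 X2 X h1 h2 h3 where "frame_at (fst e) X1 X2 X" "E_proj M T1 T2 e h1 = X1"
    "E_proj M T1 T2 e h2 = X2" "E_proj M T1 T2 e h3 = X"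
    "taut e h1 = 0" "taut e h2 = 0" "taut e h3 \<noteq> 0"
    "snd e X1 = 0" "snd e X2 = 0" "snd e X \<noteq> 0" "linear (snd e)"
proof -
  have x: "fst e \<in> points M" and t: "linear (snd e)" "{v. snd e v = 0} = D (fst e)"
    using e by (auto simp: E_set_def)
  obtain X1 X2 X where f: "frame_at (fst e) X1 X2 X" using frame_at_exists[OF x] by blast
  obtain h1 h2 h3 where h: "E_proj M T1 T2 e h1 = X1" "E_proj M T1 T2 e h2 = X2" "E_proj M T1 T2 e h3 = X"
    using E_proj_surj[OF e] by metis
  show ?thesis using that[OF f h] frame_kernel[OF f t(2)] h t(1) by (simp add: E_taut_def)
qed

lemma Yf_values:
  assumes q: "(w, w1, w2, f) \<in> Yf e" and fr: "frame_at (fst e) X1 X2 X"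
    and h: "E_proj M T1 T2 e h1 = X1" "E_proj M T1 T2 e h2 = X2"
  shows "w1 h1 \<noteq> 0" "w1 h2 = 0" "w2 h1 = 0" "w2 h2 \<noteq> 0"
proof -
  from q obtain t1 t2 where t1: "linear t1" "\<forall>v\<in>T2 (fst e). t1 v = 0" "\<exists>v\<in>T1 (fst e). t1 v \<noteq> 0"
      "w1 = t1 \<circ> E_proj M T1 T2 e"
    and t2: "linear t2" "\<forall>v\<in>T1 (fst e). t2 v = 0" "\<exists>v\<in>T2 (fst e). t2 v \<noteq> 0" "w2 = t2 \<circ> E_proj M T1 T2 e"
    unfolding Y_fibre_def by blast
  have "X1 \<in> T1 (fst e)" "X2 \<in> T2 (fst e)" using fr by (auto simp: frame_at_def)
  moreover have "t1 X1 \<noteq> 0" "t2 X2 \<noteq> 0"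
    using t1(3) t2(3) t1(1) t2(1) unfolding frame_lines(1,2)[OF fr] by (auto simp: linear_scale)
  ultimately show "w1 h1 \<noteq> 0" "w1 h2 = 0" "w2 h1 = 0" "w2 h2 \<noteq> 0"
    using t1 t2 h by auto
qed

text \<open>Expanding \<open>\<omega>1 \<and> \<omega>2\<close> for the new coframe produces cross
  terms with \<open>\<omega>\<close>; the terms with coefficient 1/2 in the new
  \<open>\<phi>\<close>, doubled by the factor in \<open>2 \<phi> \<and> \<omega>\<close>, cancel
  them. The term with \<open>s\<close> disappears because
  \<open>\<omega> \<and> \<omega> = 0\<close>.\<close>

lemma Y_act_in_Yf:
  assumes e: "e \<in> E" and q: "q \<in> Yf e" and g: "fst g \<noteq> 0"
  shows "Y_act g q \<in> Yf e"
proof -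
  obtain w w1 w2 f where q': "q = (w, w1, w2, f)" by (cases q)
  obtain a v1 v2 s where g': "g = (a, v1, v2, s)" by (cases g)
  have a: "a \<noteq> 0" using g g' by simp
  from q obtain t1 t2 where lin: "linear w" "linear w1" "linear w2" "linear f"
    and bij: "bij (\<lambda>v. (w v, w1 v, w2 v, f v))" and w: "w = taut e"
    and t1: "linear t1" "\<forall>v\<in>T2 (fst e). t1 v = 0" "\<exists>v\<in>T1 (fst e). t1 v \<noteq> 0"
      "w1 = t1 \<circ> E_proj M T1 T2 e"
    and t2: "linear t2" "\<forall>v\<in>T1 (fst e). t2 v = 0" "\<exists>v\<in>T2 (fst e). t2 v \<noteq> 0" "w2 = t2 \<circ> E_proj M T1 T2 e"
    and d: "\<And>u v. ext_deriv EA taut e u v = 2 * wedge f w u v + wedge w1 w2 u v"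
    unfolding Y_fibre_def q' by blast
  have t: "linear (snd e)" "{v. snd e v = 0} = D (fst e)" using e by (auto simp: E_set_def)
  obtain X1 X2 X where fr: "frame_at (fst e) X1 X2 X" using frame_at_exists[of "fst e"] e by (fastforce simp:
      E_set_def)
  have tT: "\<forall>v\<in>T1 (fst e). snd e v = 0" "\<forall>v\<in>T2 (fst e). snd e v = 0"
    using frame_kernel[OF fr t(2)] t(1) unfolding frame_lines(1,2)[OF fr] by (auto simp: linear_scale)
  let ?A = "\<lambda>(p0, p1, p2, p3). (p0, a * p1 + v1 * p0, (1 / a) * p2 + v2 * p0,
     p3 - 1/2 * a * v2 * p1 + 1/2 * (1 / a) * v1 * p2 + s * p0)"
  \<comment> \<open>The inverse of \<open>?A\<close>: the second and third entries are solved first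
    and then substituted into the fourth.\<close>
  let ?B = "\<lambda>(p0, p1, p2, p3). (p0, (p1 - v1 * p0) / a, (p2 - v2 * p0) * a,
     p3 + 1/2 * v2 * (p1 - v1 * p0) - 1/2 * v1 * (p2 - v2 * p0) - s * p0)"
  have "bij ?A"
    by (rule bij_betw_byWitness[where f' = ?B]) (use a in \<open>auto simp: field_simps\<close>)
  from bij_comp[OF bij this]
  have bij': "bij (\<lambda>v. (w v, a * w1 v + v1 * w v, (1 / a) * w2 v + v2 * w v,
      f v - 1/2 * a * v2 * w1 v + 1/2 * (1 / a) * v1 * w2 v + s * w v))"
    by (simp add: o_def)
  have l: "linear (\<lambda>v. a * w1 v + v1 * w v)" "linear (\<lambda>v. (1 / a) * w2 v + v2 * w v)"
    "linear (\<lambda>v. f v - 1/2 * a * v2 * w1 v + 1/2 * (1 / a) * v1 * w2 v + s * w v)"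
    by (intro linear_compose_add linear_compose_sub linear_cmult lin)+
  have t1': "linear (\<lambda>v. a * t1 v + v1 * snd e v)" "linear (\<lambda>v. (1 / a) * t2 v + v2 * snd e v)"
    by (intro linear_compose_add linear_cmult t1 t2 t)+
  show ?thesis
    unfolding Y_fibre_def q' g' Y_act.simps mem_Collect_eq case_prod_conv
  proof (intro conjI lin l bij' w allI)
    show "\<exists>t1. linear t1 \<and> (\<forall>v\<in>T2 (fst e). t1 v = 0) \<and> (\<exists>v\<in>T1 (fst e). t1 v \<noteq> 0) \<and>
        (\<lambda>h. a * w1 h + v1 * w h) = t1 \<circ> E_proj M T1 T2 e"
      by (rule exI[of _ "\<lambda>v. a * t1 v + v1 * snd e v"]) (use t1 t1' tT a w in \<open>auto simp: E_taut_def\<close>)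
    show "\<exists>t2. linear t2 \<and> (\<forall>v\<in>T1 (fst e). t2 v = 0) \<and> (\<exists>v\<in>T2 (fst e). t2 v \<noteq> 0) \<and>
        (\<lambda>h. (1 / a) * w2 h + v2 * w h) = t2 \<circ> E_proj M T1 T2 e"
      by (rule exI[of _ "\<lambda>v. (1 / a) * t2 v + v2 * snd e v"]) (use t2 t1' tT a w in \<open>auto simp: E_taut_def\<close>)
    show "ext_deriv EA taut e u v = 2 * wedge (\<lambda>h. f h - 1/2 * a * v2 * w1 h + 1/2 * (1 / a) * v1 * w2 h + s *
        w h) w u v
       + wedge (\<lambda>h. a * w1 h + v1 * w h) (\<lambda>h. (1 / a) * w2 h + v2 * w h) u v" for u v
      unfolding d wedge_def using a by (simp add: field_simps)
  qed
qed

text \<open>The adapted covectors agree up to factors on lifts of \<open>X1\<close> and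
  \<open>X2\<close>, hence up to multiples of \<open>\<omega>\<close>. The equation for the exterior
  derivative, common to both coframes, then forces the two factors to be inverse to each other and
  determines \<open>\<phi>\<close> up to a multiple of \<open>\<omega>\<close>.\<close>

lemma Y_act_transitive:
  assumes e: "e \<in> E" and q: "q \<in> Yf e" "q' \<in> Yf e"
  obtains g where "fst g \<noteq> 0" "q' = Y_act g q"
proof -
  obtain w z1 z2 z3 w' w1 w2 f where qq: "q = (w, z1, z2, z3)" "q' = (w', w1, w2, f)" by (cases q, cases q')
  obtain X1 X2 X h1 h2 h3 where fr: "frame_at (fst e) X1 X2 X" and h: "E_proj M T1 T2 e h1 = X1"
    "E_proj M T1 T2 e h2 = X2" "E_proj M T1 T2 e h3 = X"
    and th: "taut e h1 = 0" "taut e h2 = 0" "taut e h3 \<noteq> 0"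
    and t: "snd e X1 = 0" "snd e X2 = 0" "snd e X \<noteq> 0" "linear (snd e)"
    using E_frame_lifts[OF e] .
  have w: "w = taut e" "w' = taut e" using q unfolding qq Y_fibre_def by auto
  have hor: "\<exists>t. linear t \<and> \<alpha> = t \<circ> E_proj M T1 T2 e" if "\<alpha> \<in> {z1, z2, w1, w2}" for \<alpha>
    using that q unfolding qq Y_fibre_def by blast
  note v = Yf_values[OF q(1)[unfolded qq] fr h(1,2)] and v' = Yf_values[OF q(2)[unfolded qq] fr h(1,2)]
  \<comment> \<open>The difference comes from a covector on M vanishing on \<open>X1\<close> and
    \<open>X2\<close>, that is on \<open>D\<close>, so it is proportional to the contact
    covector.\<close>
  have multiple: "\<exists>r. \<forall>h. \<alpha> h - k * \<beta> h = r * w h"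
    if \<alpha>: "\<alpha> \<in> {z1, z2, w1, w2}" "\<beta> \<in> {z1, z2, w1, w2}" "\<alpha> h1 = k * \<beta> h1" "\<alpha> h2 = k * \<beta> h2" for \<alpha> \<beta> k
  proof -
    obtain s where s: "linear s" "\<alpha> = s \<circ> E_proj M T1 T2 e" using hor[OF \<alpha>(1)] by blast
    obtain s' where s': "linear s'" "\<beta> = s' \<circ> E_proj M T1 T2 e" using hor[OF \<alpha>(2)] by blast
    have "(\<lambda>v. s v - k * s' v) = (\<lambda>v. ((s X - k * s' X) / snd e X) * snd e v)"
    proof (rule proportional_covectors[OF t(4) _ _ t(3)])
      show "linear (\<lambda>v. s v - k * s' v)" by (intro linear_compose_sub linear_cmult s s')
      show "{v. snd e v = 0} \<subseteq> {v. s v - k * s' v = 0}"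
      proof
        fix v assume v: "v \<in> {v. snd e v = 0}"
        obtain a b c where abc: "v = a *\<^sub>R X1 + b *\<^sub>R X2 + c *\<^sub>R X" using frame_span[OF fr] by blast
        then have "c = 0" using v t by (simp add: linear_add linear_scale)
        then show "v \<in> {v. s v - k * s' v = 0}"
          using abc \<alpha>(3,4) s s' h by (simp add: linear_add linear_scale algebra_simps)
      qed
    qed
    from fun_cong[OF this] show ?thesis unfolding s(2) s'(2) w E_taut_def o_apply by blast
  qed
  define a where "a = w1 h1 / z1 h1"
  define b where "b = w2 h2 / z2 h2"
  have a: "a \<noteq> 0" unfolding a_def using v v' by simp
  have "\<exists>r. \<forall>h. w1 h - a * z1 h = r * w h"
    by (rule multiple) (use v v' in \<open>simp_all add: a_def\<close>)
  then obtain v1 where v1: "\<And>h. w1 h - a * z1 h = v1 * w h" by blast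
  have "\<exists>r. \<forall>h. w2 h - b * z2 h = r * w h"
    by (rule multiple) (use v v' in \<open>simp_all add: b_def\<close>)
  then obtain v2 where v2: "\<And>h. w2 h - b * z2 h = v2 * w h" by blast
  have d: "2 * wedge z3 w u v + wedge z1 z2 u v = 2 * wedge f w u v + wedge w1 w2 u v" for u v
  proof -
    have "ext_deriv EA taut e u v = 2 * wedge z3 w u v + wedge z1 z2 u v"
      using q(1) unfolding qq Y_fibre_def by blast
    moreover have "ext_deriv EA taut e u v = 2 * wedge f w u v + wedge w1 w2 u v"
      using q(2) unfolding qq Y_fibre_def w by blast
    ultimately show ?thesis by simp
  qed
  \<comment> \<open>On \<open>h1\<close> and \<open>h2\<close> the form \<open>\<omega>\<close>
    vanishes, so only the two products \<open>\<omega>1 \<and> \<omega>2\<close> remain to be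
    compared.\<close>
  have "a * b = 1"
    using d[of h1 h2] v v' th unfolding wedge_def w a_def b_def by simp
  then have b: "b = 1 / a" using a by (simp add: field_simps)
  define g where "g h = f h - (z3 h - 1/2 * a * v2 * z1 h + 1/2 * (1 / a) * v1 * z2 h)" for h
  have w1: "w1 h = a * z1 h + v1 * w h" and w2: "w2 h = (1 / a) * z2 h + v2 * w h" for h
    using v1[of h] v2[of h] unfolding b by simp_all
  \<comment> \<open>The wedge of \<open>g\<close> with \<open>\<omega>\<close> vanishes; evaluating
    at \<open>h3\<close>, where \<open>\<omega>\<close> is nonzero, makes \<open>g\<close> a
    multiple of \<open>\<omega>\<close>.\<close>
  have "2 * (g u * w v - g v * w u) = 0" for u v
    using d[of u v] a unfolding g_def wedge_def w1 w2 by (simp add: field_simps)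
  then have gw: "g u * w h3 = g h3 * w u" for u by (metis mult_eq_0_iff right_minus_eq zero_neq_numeral)
  have gh: "g h = (g h3 / w h3) * w h" for h using gw[of h] th(3) w by (simp add: field_simps)
  have f: "f h = z3 h - 1/2 * a * v2 * z1 h + 1/2 * (1 / a) * v1 * z2 h + (g h3 / w h3) * w h" for h
    using gh[of h] unfolding g_def[of h] by linarith
  have "w' = w" using w by simp
  moreover have "w1 = (\<lambda>h. a * z1 h + v1 * w h)" "w2 = (\<lambda>h. (1 / a) * z2 h + v2 * w h)"
    "f = (\<lambda>h. z3 h - 1/2 * a * v2 * z1 h + 1/2 * (1 / a) * v1 * z2 h + (g h3 / w h3) * w h)"
    by (rule ext, rule w1) (rule ext, rule w2, rule ext, rule f)
  ultimately have "q' = Y_act (a, v1, v2, g h3 / w h3) q"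
    unfolding qq Y_act.simps prod.inject by blast
  then show ?thesis using that a by auto
qed

lemma Y_act_inj:
  assumes "q \<in> Yf e" "Y_act g q = Y_act g' q" "fst g \<noteq> 0" "fst g' \<noteq> 0"
  shows "g = g'"
proof -
  obtain w w1 w2 f where q: "q = (w, w1, w2, f)" by (cases q)
  obtain a v1 v2 s a' v1' v2' s' where g: "g = (a, v1, v2, s)" "g' = (a', v1', v2', s')" by (cases g, cases g')
  have "bij (\<lambda>v. (w v, w1 v, w2 v, f v))" using assms(1) unfolding q Y_fibre_def by blast
  then have "surj (\<lambda>v. (w v, w1 v, w2 v, f v))" by (rule bij_is_surj)
  \<comment> \<open>Vectors dual to \<open>w1\<close> and to \<open>w\<close>: the first reads off
    \<open>a\<close>, the second reads off \<open>v1\<close>, \<open>v2\<close> and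
    \<open>s\<close>.\<close>
  then obtain h k where h: "(0, 1, 0, 0) = (w h, w1 h, w2 h, f h)" and k: "(1, 0, 0, 0) = (w k, w1 k, w2 k, f k)"
    unfolding surj_def by metis
  have eq: "a * w1 h + v1 * w h = a' * w1 h + v1' * w h"
      "(1 / a) * w2 h + v2 * w h = (1 / a') * w2 h + v2' * w h"
      "f h - 1/2 * a * v2 * w1 h + 1/2 * (1 / a) * v1 * w2 h + s * w h =
       f h - 1/2 * a' * v2' * w1 h + 1/2 * (1 / a') * v1' * w2 h + s' * w h" for h
    using assms(2) unfolding q g Y_act.simps prod.inject fun_eq_iff by blast+
  show ?thesis unfolding g using eq(1)[of h] eq[of k] h k by simp
qed

lemma Ycoord_eqI:
  assumes "q (fst y) \<in> Yf (fst y)" "fst g \<noteq> 0" "snd y = Y_act g (q (fst y))"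
  shows "Ycoord q y = g"
  unfolding Ycoord_def by (rule the_equality) (use assms Y_act_inj in auto)

lemma Ycoord:
  assumes "y \<in> YS" "q (fst y) \<in> Yf (fst y)"
  shows "snd y = Y_act (Ycoord q y) (q (fst y))" "fst (Ycoord q y) \<noteq> 0"
proof -
  have e: "fst y \<in> E" "snd y \<in> Yf (fst y)" using assms(1) by (auto simp: Y_set_def)
  obtain g where g: "fst g \<noteq> 0" "snd y = Y_act g (q (fst y))"
    using Y_act_transitive[OF e(1) assms(2) e(2)] .
  then have "Ycoord q y = g" using Ycoord_eqI[of q y g, OF assms(2)] by blast
  then show "snd y = Y_act (Ycoord q y) (q (fst y))" "fst (Ycoord q y) \<noteq> 0" using g by auto
qed

lemma Y_fib:
  assumes e: "e \<in> E" and q: "q e \<in> Yf e"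
  shows "bij_betw (Ycoord q) {y \<in> YS. fst y = e} YK"
proof (rule bij_betwI[where g = "\<lambda>g. (e, Y_act g (q e))"])
  show "Ycoord q \<in> {y \<in> YS. fst y = e} \<rightarrow> YK" using Ycoord(2) q by (auto simp: YK_def)
  show "(\<lambda>g. (e, Y_act g (q e))) \<in> YK \<rightarrow> {y \<in> YS. fst y = e}"
    using Y_act_in_Yf[OF e q] e by (auto simp: YK_def Y_set_def simp del: Y_act.simps)
  show "(e, Y_act (Ycoord q y) (q e)) = y" if "y \<in> {y \<in> YS. fst y = e}" for y
    using that Ycoord(1)[of y q] q by (metis (mono_tags, lifting) mem_Collect_eq prod.collapse)
  show "Ycoord q (e, Y_act g (q e)) = g" if "g \<in> YK" for g
    using that q by (intro Ycoord_eqI) (auto simp: YK_def)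
qed

lemma Ysection_charts:
  assumes s: "Ysection M T1 T2 C V \<eta>1 \<eta>2 \<psi>"
  shows "C \<in> EA" "openin (mtop EA) V" "V \<subseteq> fst C" "form_on EA V \<eta>1" "form_on EA V \<eta>2" "form_on EA V \<psi>"
    "e \<in> V \<Longrightarrow> Ysec M T1 T2 \<eta>1 \<eta>2 \<psi> e \<in> Yf e" "e \<in> V \<Longrightarrow> e \<in> E" "form_on EA V taut"
proof -
  show *: "C \<in> EA" "openin (mtop EA) V" "V \<subseteq> fst C" "form_on EA V \<eta>1" "form_on EA V \<eta>2" "form_on EA V \<psi>"
    "e \<in> V \<Longrightarrow> Ysec M T1 T2 \<eta>1 \<eta>2 \<psi> e \<in> Yf e" using s by (auto simp: Ysection_def)
  have "V \<subseteq> E" using openin_subset[OF *(2)] by (simp add: points_EA)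
  then show "e \<in> V \<Longrightarrow> e \<in> E" "form_on EA V taut" using form_on_subset[OF E_taut_form] by auto
qed

lemma Y_indep:
  assumes "e \<in> E" "(w, z1, z2, z3) \<in> Yf e"
  shows "\<exists>h. w h = 0 \<and> z1 h \<noteq> 0" "\<exists>h. w h = 0 \<and> z2 h \<noteq> 0" "\<exists>h. w h \<noteq> 0"
proof -
  have "bij (\<lambda>v. (w v, z1 v, z2 v, z3 v))" using assms unfolding Y_fibre_def by blast
  then have "surj (\<lambda>v. (w v, z1 v, z2 v, z3 v))" by (rule bij_is_surj)
  then obtain h k l where "(0, 1, 0, 0) = (w h, z1 h, z2 h, z3 h)" "(0, 0, 1, 0) = (w k, z1 k, z2 k, z3 k)"
    "(1, 0, 0, 0) = (w l, z1 l, z2 l, z3 l)"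
    unfolding surj_def by metis
  then show "\<exists>h. w h = 0 \<and> z1 h \<noteq> 0" "\<exists>h. w h = 0 \<and> z2 h \<noteq> 0" "\<exists>h. w h \<noteq> 0"
    by (metis Pair_inject zero_neq_one)+
qed

section \<open>The adapted atlas of Y\<close>

lemma Y_fibred: "fibred_atlas EA YS fst (Yidx M T1 T2) YK"
proof
  show "smooth_atlas EA" by (rule atlas_E)
  show "open YK" by (rule open_YK)
  show "c \<in> EA \<and> openin (mtop EA) W \<and> W \<subseteq> fst c" if "(c, W, G) \<in> Yidx M T1 T2" for c W G
    using that by (auto elim!: YidxE simp: Ysection_def)
  show "bij_betw G {y \<in> YS. fst y = x} YK" if iW: "(c, W, G) \<in> Yidx M T1 T2" "x \<in> W" for c W G x
  proof -
    obtain \<eta>1 \<eta>2 \<psi> where s: "G = Ycoord (Ysec M T1 T2 \<eta>1 \<eta>2 \<psi>)" "Ysection M T1 T2 c W \<eta>1 \<eta>2 \<psi>"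
      using iW(1) by (auto elim!: YidxE)
    show ?thesis unfolding s(1) by (rule Y_fib) (use Ysection_charts[OF s(2)] iW(2) in auto)
  qed
  fix C V G C' V' G' assume i: "(C, V, G) \<in> Yidx M T1 T2" and i': "(C', V', G') \<in> Yidx M T1 T2"
  obtain \<eta>1 \<eta>2 \<psi> where s: "G = Ycoord (Ysec M T1 T2 \<eta>1 \<eta>2 \<psi>)" "Ysection M T1 T2 C V \<eta>1 \<eta>2 \<psi>"
    using i by (auto elim!: YidxE)
  obtain \<zeta>1 \<zeta>2 \<xi> where s': "G' = Ycoord (Ysec M T1 T2 \<zeta>1 \<zeta>2 \<xi>)" "Ysection M T1 T2 C' V' \<zeta>1 \<zeta>2 \<xi>"
    using i' by (auto elim!: YidxE)
  note S1 = Ysection_charts[OF s(2)] and S2 = Ysection_charts[OF s'(2)]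
  let ?S = "snd C ` (V \<inter> V')" and ?q = "Ysec M T1 T2 \<eta>1 \<eta>2 \<psi>" and ?q' = "Ysec M T1 T2 \<zeta>1 \<zeta>2 \<xi>"
  have VV: "fst C \<inter> (V \<inter> V') = V \<inter> V'" using S1 by auto
  have opS: "open ?S" using openin_chart_image[OF atlas_E S1(1) openin_Int[OF S1(2) S2(2)]] by (simp add: VV)
  have opSK: "open (?S \<times> YK)" by (intro open_Times opS open_YK)
  have cov: "smooth_covec (?S \<times> YK) (\<lambda>z. formc EA C \<alpha> (fst z))" if "form_on EA (V \<inter> V') \<alpha>" for \<alpha>
    using smooth_covec_fst[OF form_on_covec[OF atlas_E S1(1) that] _ open_YK] opS by (simp add: VV)
  have covs: "smooth_covec (?S \<times> YK) (\<lambda>z. formc EA C \<alpha> (fst z))"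
    if "\<alpha> \<in> {taut, \<eta>1, \<eta>2, \<psi>, \<zeta>1, \<zeta>2, \<xi>}" for \<alpha>
    using that by (auto intro!: cov intro: form_on_subset[OF S1(4)] form_on_subset[OF S1(5)]
        form_on_subset[OF S1(6)]
        form_on_subset[OF S1(9)] form_on_subset[OF S2(4)] form_on_subset[OF S2(5)] form_on_subset[OF S2(6)])
  \<comment> \<open>The group element \<open>snd z\<close>, applied to the first section at the
    point with coordinates \<open>fst z\<close>, gives one coframe; \<open>?f z\<close> is its group
    coordinate relative to the second section. Its four covectors have coordinate expressions
    \<open>?w\<close>, \<open>?w1\<close>, \<open>?w2\<close>, \<open>?w3\<close>, so
    \<open>smooth_Y_act\<close> applies to \<open>?f\<close>.\<close>
  let ?f = "\<lambda>z. G' (the_inv_into {y \<in> YS. fst y = cinv C (fst z)} G (snd z))"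
  let ?w = "\<lambda>z. formc EA C taut (fst z)"
  let ?w1 = "\<lambda>z h. fst (snd z) * formc EA C \<eta>1 (fst z) h + fst (snd (snd z)) * ?w z h"
  let ?w2 = "\<lambda>z h. (1 / fst (snd z)) * formc EA C \<eta>2 (fst z) h + fst (snd (snd (snd z))) * ?w z h"
  let ?w3 = "\<lambda>z h. 1 * (1 * formc EA C \<psi> (fst z) h + (- 1/2 * fst (snd z) * fst (snd (snd (snd z)))) * formc EA
      C \<eta>1 (fst z) h)
     + 1 * ((1/2 * (1 / fst (snd z)) * fst (snd (snd z))) * formc EA C \<eta>2 (fst z) h + snd (snd (snd (snd z))) *
         ?w z h)"
  have sm: "smooth_covec (?S \<times> YK) ?w1" "smooth_covec (?S \<times> YK) ?w2" "smooth_covec (?S \<times> YK) ?w3"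
    by ((intro smooth_covec_comb covs opSK smooth_intros; force simp: YK_def)+)
  have key: "fst (?f z) \<noteq> 0 \<and> fst z \<in> ?S \<and> cinv C (fst z) \<in> V \<inter> V' \<and>
      Y_act (snd z) (?q (cinv C (fst z))) = Y_act (?f z) (?q' (cinv C (fst z)))" if z: "z \<in> ?S \<times> YK" for z
  proof -
    obtain e where e: "e \<in> V" "e \<in> V'" "fst z = snd C e" and g: "fst (snd z) \<noteq> 0"
      using z by (auto simp only: mem_Times_iff YK_def mem_Collect_eq)
    have ce: "cinv C (fst z) = e" using e cinv_chart[OF atlas_E S1(1), of e] S1(3) by auto
    let ?y = "(e, Y_act (snd z) (?q e))"
    have y: "?y \<in> YS" using Y_act_in_Yf[OF S1(8,7)[OF e(1)] g] S1(8)[OF e(1)] by (simp add: Y_set_def)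
    have inv: "the_inv_into {y \<in> YS. fst y = e} G (snd z) = ?y"
    proof (rule the_inv_into_f_eq)
      show "inj_on G {y \<in> YS. fst y = e}" using Y_fib[of e ?q] S1(8,7)[OF e(1)] s(1) by (simp add: bij_betw_def)
      show "G ?y = snd z" unfolding s(1) by (rule Ycoord_eqI) (use S1(7)[OF e(1)] g in auto)
      show "?y \<in> {y \<in> YS. fst y = e}" using y by simp
    qed
    have "fst (G' ?y) \<noteq> 0" "Y_act (snd z) (?q e) = Y_act (G' ?y) (?q' e)"
      using Ycoord[OF y, of ?q'] S2(7)[OF e(2)] unfolding s'(1) by auto
    then show ?thesis unfolding ce inv using e by auto
  qed
  have "smooth_on (?S \<times> YK) (\<lambda>z. (fst (?f z), fst (snd (?f z)), fst (snd (snd (?f z))), snd (snd (snd (?f z)))))"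
  proof (rule smooth_Y_act[OF opSK, of ?w "\<lambda>z. formc EA C \<zeta>1 (fst z)" "\<lambda>z. formc EA C \<zeta>2 (fst z)" "\<lambda>z. formc EA
      C \<xi> (fst z)"
       ?w1 ?w2 ?w3])
    fix z assume z: "z \<in> ?S \<times> YK"
    note k = key[OF z]
    let ?e = "cinv C (fst z)"
    show "fst (?f z) \<noteq> 0" using k by blast
    have eE: "?e \<in> E" and qe: "?q' ?e \<in> Yf ?e" using k S2(7,8) by auto
    have "Y_act (snd z) (?q ?e) = Y_act (?f z) (?q' ?e)" using k by blast
    note eqs = this[unfolded Ysec_def Y_act_sel prod.inject, THEN conjunct2]
    show "?w1 z h = fst (?f z) * formc EA C \<zeta>1 (fst z) h + fst (snd (?f z)) * ?w z h"
      "?w2 z h = (1 / fst (?f z)) * formc EA C \<zeta>2 (fst z) h + fst (snd (snd (?f z))) * ?w z h"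
      "?w3 z h = formc EA C \<xi> (fst z) h - 1/2 * fst (?f z) * fst (snd (snd (?f z))) * formc EA C \<zeta>1 (fst z) h
         + 1/2 * (1 / fst (?f z)) * fst (snd (?f z)) * formc EA C \<zeta>2 (fst z) h + snd (snd (snd (?f z))) * ?w z
             h" for h
      using fun_cong[OF eqs[THEN conjunct1], of "tvec EA C ?e h"]
        fun_cong[OF eqs[THEN conjunct2, THEN conjunct1], of "tvec EA C ?e h"]
        fun_cong[OF eqs[THEN conjunct2, THEN conjunct2], of "tvec EA C ?e h"]
      unfolding formc_def by (simp_all add: algebra_simps)
    have Ce: "C \<in> EA" "?e \<in> fst C" using S1(1,3) k by auto
    have lift: "\<exists>h. P (tvec EA C ?e h)" if "\<exists>h. P h" for P
      using that tvec_tcoord[OF atlas_E Ce] by metis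
    show "\<exists>h. ?w z h = 0 \<and> formc EA C \<zeta>1 (fst z) h \<noteq> 0" "\<exists>h. ?w z h = 0 \<and> formc EA C \<zeta>2 (fst z) h \<noteq> 0"
      "\<exists>h. ?w z h \<noteq> 0"
      unfolding formc_def using Y_indep[OF eE qe[unfolded Ysec_def]]
      by (intro lift[of "\<lambda>h. _ h = 0 \<and> _ h \<noteq> 0"] lift[of "\<lambda>h. _ h \<noteq> 0"]; simp)+
  qed (use covs sm in auto)
  then show "smooth_on (?S \<times> YK) ?f" by simp
qed

sublocale Y: fibred_atlas EA YS fst "Yidx M T1 T2" YK
  by (rule Y_fibred)

lemma YA_eq: "YA = Y.atl"
proof -
  have "YA = {Y.bchart (c, V, Ycoord (Ysec M T1 T2 \<eta>1 \<eta>2 \<psi>)) | c V \<eta>1 \<eta>2 \<psi>. Ysection M T1 T2 c V \<eta>1 \<eta>2 \<psi>}"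
    unfolding Y_atlas_def Y.bchart_def Ycoord_def[abs_def] Ysection_def Ysec_def by simp
  also have "\<dots> = Y.atl" unfolding Y.atl_def by (blast intro: YidxI elim: YidxE)
  finally show ?thesis .
qed

lemma atlas_Y: "smooth_atlas YA"
  unfolding YA_eq by (rule Y.smooth_atlas_atl)

end

section \<open>The bundle \<open>Y\<^sub>2\<close>\<close>

text \<open>Expand the normal \<open>cross3 y z\<close> in the basis. If the triple product
  vanished, the normal would be orthogonal to itself, hence zero, and \<open>y\<close>,
  \<open>z\<close> would be collinear.\<close>

lemma triple_product_nonzero:
  fixes x y z :: "real^3"
  assumes span: "\<And>v. \<exists>a b c. v = a *\<^sub>R x + b *\<^sub>R y + c *\<^sub>R z"
    and indep: "\<And>a b c. a *\<^sub>R x + b *\<^sub>R y + c *\<^sub>R z = 0 \<Longrightarrow> a = 0 \<and> b = 0 \<and> c = 0"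
  shows "x \<bullet> cross3 y z \<noteq> 0"
proof
  assume 0: "x \<bullet> cross3 y z = 0"
  obtain a b c where "cross3 y z = a *\<^sub>R x + b *\<^sub>R y + c *\<^sub>R z" using span by blast
  then have "cross3 y z \<bullet> cross3 y z = (a *\<^sub>R x + b *\<^sub>R y + c *\<^sub>R z) \<bullet> cross3 y z" by simp
  then have "cross3 y z = 0" using 0 by (simp add: inner_add_left dot_cross_self)
  then have "y = 0 \<or> z = 0 \<or> (\<exists>c. z = c *\<^sub>R y)" by (simp add: cross_eq_0 collinear_lemma)
  moreover have "y \<noteq> 0" "z \<noteq> 0" using indep[of 0 1 0] indep[of 0 0 1] by auto
  moreover have "z \<noteq> c *\<^sub>R y" for c using indep[of 0 c "-1"] by auto
  ultimately show False by blast
qed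

text \<open>A covector killing \<open>y\<close> and \<open>z\<close> is a multiple of the pairing
  with their normal. The formula shows that it depends smoothly on the frame.\<close>

lemma dual_covector_cross:
  fixes x y z :: "real^3"
  assumes span: "\<And>v. \<exists>a b c. v = a *\<^sub>R x + b *\<^sub>R y + c *\<^sub>R z"
    and indep: "\<And>a b c. a *\<^sub>R x + b *\<^sub>R y + c *\<^sub>R z = 0 \<Longrightarrow> a = 0 \<and> b = 0 \<and> c = 0"
    and m: "linear m" "m y = 0" "m z = 0"
  shows "m h = m x * ((h \<bullet> cross3 y z) / (x \<bullet> cross3 y z))"
proof -
  obtain a b c where h: "h = a *\<^sub>R x + b *\<^sub>R y + c *\<^sub>R z" using span by blast
  then have "h \<bullet> cross3 y z = a * (x \<bullet> cross3 y z)" by (simp add: inner_add_left dot_cross_self)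
  moreover have "m h = a * m x" using m h by (simp add: linear_add linear_scale)
  ultimately show ?thesis using triple_product_nonzero[OF span indep] by simp
qed

lemma smooth_on_cross3:
  "open S \<Longrightarrow> smooth_on S f \<Longrightarrow> smooth_on S g \<Longrightarrow> smooth_on S (\<lambda>u. cross3 (f u) (g u))"
  using smooth_on_bilinear bilinear_cross bilinear_conv_bounded_bilinear by blast

definition Y2coord :: "('m \<Rightarrow> real^3) \<Rightarrow> ('m \<Rightarrow> real^3) \<Rightarrow> 'm Y2_point \<Rightarrow> real \<times> real" where
  "Y2coord X1 X2 y = (fst (snd (snd y)) (X1 (fst y)), snd (snd (snd y)) (X2 (fst y)))"

definition Y2idx :: "'m mfd3 \<Rightarrow> 'm dist3 \<Rightarrow> 'm dist3 \<Rightarrow> 'm dist3 \<Rightarrow> 'm Y2_point set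
    \<Rightarrow> (('m, real^3) chart \<times> 'm set \<times> ('m Y2_point \<Rightarrow> real \<times> real)) set" where
  "Y2idx M T1 T2 L Y2 = {(c, W, Y2coord X1 X2) | c W X1 X2 X.
      c \<in> M \<and> W \<subseteq> fst c \<and> Y2_trivialising M T1 T2 L Y2 W X1 X2 X}"

lemma Y2idxI: "c \<in> M \<Longrightarrow> W \<subseteq> fst c \<Longrightarrow> Y2_trivialising M T1 T2 L Y2 W X1 X2 X \<Longrightarrow>
    (c, W, Y2coord X1 X2) \<in> Y2idx M T1 T2 L Y2"
  unfolding Y2idx_def by blast

lemma Y2idxE:
  assumes "i \<in> Y2idx M T1 T2 L Y2"
  obtains c W X1 X2 X where "i = (c, W, Y2coord X1 X2)" "c \<in> M" "W \<subseteq> fst c" "Y2_trivialising M T1 T2 L Y2 W X1 X2 X"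
  using assms unfolding Y2idx_def by blast

definition K2 :: "(real \<times> real) set" where
  "K2 = {0<..} \<times> {0<..}"

lemma open_K2: "open K2"
  unfolding K2_def by (intro open_Times open_greaterThan)

locale enriched_Y2 = enriched M T1 T2 L
  for M :: "'m mfd3" and T1 T2 L :: "'m dist3" +
  fixes Y2 :: "'m Y2_point set"
  assumes Y2b: "Y2_bundle M T1 T2 L Y2"
begin

abbreviation "triv \<equiv> Y2_trivialising M T1 T2 L Y2"
abbreviation "Y2A \<equiv> Y2_atlas M T1 T2 L Y2"

lemma triv_subset:
  assumes t: "triv W X1 X2 X" and V: "openin (mtop M) V" "V \<subseteq> W"
  shows "triv V X1 X2 X"
proof -
  have "snd c ` (fst c \<inter> V) \<subseteq> snd c ` (fst c \<inter> W)" for c :: "('m, real^3) chart" using V by auto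
  then show ?thesis
    using t V unfolding Y2_trivialising_def adapted_frame_def vector_field_on_def
    by (meson smooth_on_subset subsetD)
qed

lemma triv_frame:
  assumes "triv W X1 X2 X" "x \<in> W"
  shows "frame_at x (X1 x) (X2 x) (X x)"
  using assms openin_points unfolding Y2_trivialising_def adapted_frame_def frame_at_def by blast

lemma triv_fibre:
  assumes "triv W X1 X2 X" "fst y \<in> W"
  shows "y \<in> Y2 \<longleftrightarrow> snd y \<in> Y2_fibre M T1 T2 (X1 (fst y)) (X2 (fst y)) (X (fst y)) (fst y)"
  using assms unfolding Y2_trivialising_def by (metis (mono_tags, lifting) mem_Collect_eq prod.collapse)

section \<open>Fibres of Y2 and their coordinates\<close>

text \<open>Any two local contact forms are proportional. Hence the normalisation in
  \<open>Y2_fibre\<close> does not depend on the extension \<open>\<Omega>\<close> and can be tested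
  with any contact form.\<close>

lemma ext_deriv_proportional:
  assumes \<Theta>: "openin (mtop M) U" "form_on M U \<Theta>" "kernel_on U D \<Theta>" "x \<in> U"
    and \<Omega>: "openin (mtop M) V" "form_on M V \<Omega>" "kernel_on V D \<Omega>" "x \<in> V"
    and r: "\<Omega> x = (\<lambda>v. r * \<Theta> x v)" and uv: "\<Theta> x u = 0" "\<Theta> x v = 0"
  shows "ext_deriv M \<Omega> x u v = r * ext_deriv M \<Theta> x u v"
proof (rule ext_deriv_scale[OF atlas_M, of "U \<inter> V"])
  fix q assume q: "q \<in> U \<inter> V"
  have qM: "q \<in> points M" using openin_points \<Theta>(1) q by blast
  note k = form_kernel[OF \<Theta>(2,3), of q] form_kernel[OF \<Omega>(2,3), of q]
  show "\<exists>v. \<Theta> q v \<noteq> 0" using kernel_nonzero[OF qM k(2)] q by blast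
  show "\<exists>r. \<Omega> q = (\<lambda>v. r * \<Theta> q v)" using kernel_ratio[OF qM k] q by blast
qed (use assms form_on_subset[OF \<Theta>(2)] form_on_subset[OF \<Omega>(2)] in auto)

lemma fibre_values:
  assumes y: "(w, w1, w2) \<in> Y2_fibre M T1 T2 X1 X2 X x" and f: "frame_at x X1 X2 X"
  shows "linear w" "linear w1" "linear w2" "w X1 = 0" "w X2 = 0" "w X > 0" "w1 X1 > 0" "w1 X2 = 0" "w1 X = 0"
    "w2 X1 = 0" "w2 X2 > 0" "w2 X = 0" "{v. w v = 0} = D x"
    and fibre_ext_deriv: "\<exists>U \<Omega>. openin (mtop M) U \<and> x \<in> U \<and> form_on M U \<Omega> \<and> kernel_on U D \<Omega> \<and> \<Omega> x = w \<and>
        ext_deriv M \<Omega> x X1 X2 = w1 X1 * w2 X2"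
proof -
  obtain t1 t2 t a1 a2 l where t: "dual_coframe X1 X2 X t1 t2 t" "a1 > 0" "a2 > 0" "l > 0"
        "w = (\<lambda>v. l * t v)" "w1 = (\<lambda>v. a1 * t1 v)" "w2 = (\<lambda>v. a2 * t2 v)"
    using y unfolding Y2_fibre_def by blast
  obtain U \<Omega> where U: "openin (mtop M) U" "x \<in> U" "form_on M U \<Omega>" "kernel_on U D \<Omega>" "\<Omega> x = w"
        "\<forall>u\<in>D x. \<forall>v\<in>D x. ext_deriv M \<Omega> x u v = wedge w1 w2 u v"
    using y unfolding Y2_fibre_def by blast
  show "linear w" "linear w1" "linear w2" using t by (auto simp: dual_coframe_def intro: linear_cmult)
  show v: "w X1 = 0" "w X2 = 0" "w X > 0" "w1 X1 > 0" "w1 X2 = 0" "w1 X = 0"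
    "w2 X1 = 0" "w2 X2 > 0" "w2 X = 0" using t by (auto simp: dual_coframe_def)
  show "{v. w v = 0} = D x" using U(2,4,5) by (auto simp: kernel_on_def)
  have "X1 = 1 *\<^sub>R X1 + 0 *\<^sub>R X2" "X2 = 0 *\<^sub>R X1 + 1 *\<^sub>R X2" by auto
  then have "X1 \<in> D x" "X2 \<in> D x" unfolding frame_D[OF f] by blast+
  then have "ext_deriv M \<Omega> x X1 X2 = w1 X1 * w2 X2" using U(6) v by (simp add: wedge_def)
  then show "\<exists>U \<Omega>. openin (mtop M) U \<and> x \<in> U \<and> form_on M U \<Omega> \<and> kernel_on U D \<Omega> \<and> \<Omega> x = w \<and>
        ext_deriv M \<Omega> x X1 X2 = w1 X1 * w2 X2" using U by blast
qed

lemma form_on_cmult: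
  assumes "form_on M U \<Omega>" "openin (mtop M) U"
  shows "form_on M U (\<lambda>q v. k * \<Omega> q v)"
  unfolding form_on_def
proof (intro conjI ballI allI)
  show "linear (\<lambda>v. k * \<Omega> p v)" if "p \<in> U" for p
    using assms that by (auto simp: form_on_def intro: linear_cmult)
  show "smooth_on (snd c ` (fst c \<inter> U)) (\<lambda>u. k * \<Omega> (cinv c u) (tvec M c (cinv c u) h))" if c: "c \<in> M" for c h
    by (rule smooth_on_linear[OF bounded_linear_mult_right]) (use assms c in \<open>auto simp: form_on_def\<close>)
qed

text \<open>The action of the structure group: on \<open>D\<close> the exterior derivative of
  \<open>a b \<Omega>\<close> is \<open>a b\<close> times that of \<open>\<Omega>\<close>, matching
  the scaling of \<open>w1\<close> and \<open>w2\<close>.\<close>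

lemma fibre_scale:
  assumes y: "(w, w1, w2) \<in> Y2_fibre M T1 T2 X1 X2 X x" and f: "frame_at x X1 X2 X" and ab: "a > 0" "b > 0"
  shows "(\<lambda>v. (a * b) * w v, \<lambda>v. a * w1 v, \<lambda>v. b * w2 v) \<in> Y2_fibre M T1 T2 X1 X2 X x"
proof -
  obtain t1 t2 t a1 a2 l where t: "dual_coframe X1 X2 X t1 t2 t" "a1 > 0" "a2 > 0" "l > 0"
        "w = (\<lambda>v. l * t v)" "w1 = (\<lambda>v. a1 * t1 v)" "w2 = (\<lambda>v. a2 * t2 v)"
    using y unfolding Y2_fibre_def by blast
  obtain U \<Omega> where U: "openin (mtop M) U" "x \<in> U" "form_on M U \<Omega>" "kernel_on U D \<Omega>" "\<Omega> x = w"
        "\<forall>u\<in>D x. \<forall>v\<in>D x. ext_deriv M \<Omega> x u v = wedge w1 w2 u v"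
    using y unfolding Y2_fibre_def by blast
  let ?\<Omega> = "\<lambda>q v. (a * b) * \<Omega> q v"
  have k: "kernel_on U D ?\<Omega>" using U(4) ab by (auto simp: kernel_on_def)
  have fo: "form_on M U ?\<Omega>" by (rule form_on_cmult[OF U(3,1)])
  have e: "\<forall>u\<in>D x. \<forall>v\<in>D x. ext_deriv M ?\<Omega> x u v = wedge (\<lambda>v. a * w1 v) (\<lambda>v. b * w2 v) u v"
  proof (intro ballI)
    fix u v assume uv: "u \<in> D x" "v \<in> D x"
    have z: "\<Omega> x u = 0" "\<Omega> x v = 0" using uv U(2,4) by (auto simp: kernel_on_def)
    have "ext_deriv M ?\<Omega> x u v = (a * b) * ext_deriv M \<Omega> x u v"
      by (rule ext_deriv_proportional[OF U(1,3,4,2) U(1) fo k U(2) refl z])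
    then show "ext_deriv M ?\<Omega> x u v = wedge (\<lambda>v. a * w1 v) (\<lambda>v. b * w2 v) u v"
      using U(6) uv by (simp add: wedge_def algebra_simps)
  qed
  show ?thesis
    unfolding Y2_fibre_def mem_Collect_eq case_prod_conv
  proof (intro conjI)
    show "\<exists>t1 t2 t a1 a2 l. dual_coframe X1 X2 X t1 t2 t \<and> a1 > 0 \<and> a2 > 0 \<and> l > 0 \<and>
        (\<lambda>v. (a * b) * w v) = (\<lambda>v. l * t v) \<and> (\<lambda>v. a * w1 v) = (\<lambda>v. a1 * t1 v) \<and> (\<lambda>v. b * w2 v) = (\<lambda>v. a2 * t2 v)"
      by (rule exI[of _ t1], rule exI[of _ t2], rule exI[of _ t], rule exI[of _ "a * a1"], rule exI[of _ "b * a2"],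
          rule exI[of _ "(a * b) * l"]) (use t ab in \<open>auto simp: mult.assoc\<close>)
    show "\<exists>U \<Omega>'. openin (mtop M) U \<and> x \<in> U \<and> form_on M U \<Omega>' \<and> kernel_on U D \<Omega>' \<and> \<Omega>' x = (\<lambda>v. (a * b) * w v) \<and>
        (\<forall>u\<in>D x. \<forall>v\<in>D x. ext_deriv M \<Omega>' x u v = wedge (\<lambda>v. a * w1 v) (\<lambda>v. b * w2 v) u v)"
      using U(1,2,5) fo k e by (intro exI[of _ U] exI[of _ ?\<Omega>]) simp
  qed
qed

lemma frame_linear_eq:
  assumes f: "frame_at x X1 X2 X" and m: "linear m" "linear m'" "m X1 = m' X1" "m X2 = m' X2" "m X = m' X"
  shows "m = m'"
proof
  fix v
  obtain a b c where "v = a *\<^sub>R X1 + b *\<^sub>R X2 + c *\<^sub>R X" using frame_span[OF f] by blast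
  then show "m v = m' v" using m by (simp add: linear_add linear_scale)
qed

text \<open>Writing \<open>w = r \<Theta>\<close>, the normalisation becomes
  \<open>r d\<Theta>(X1, X2) = w1(X1) w2(X2)\<close>, and the right-hand side is positive. So
  \<open>w\<close> is determined by \<open>w1\<close> and \<open>w2\<close>.\<close>

lemma fibre_omega:
  assumes y: "(w, w1, w2) \<in> Y2_fibre M T1 T2 X1 X2 X x" and f: "frame_at x X1 X2 X"
    and \<Theta>: "openin (mtop M) U" "form_on M U \<Theta>" "kernel_on U D \<Theta>" "x \<in> U"
  shows "ext_deriv M \<Theta> x X1 X2 \<noteq> 0" "w = (\<lambda>v. (w1 X1 * w2 X2 / ext_deriv M \<Theta> x X1 X2) * \<Theta> x v)"
proof -
  note v = fibre_values[OF y f] and k = form_kernel[OF \<Theta>(2,3,4)]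
  have xM: "x \<in> points M" using f by (simp add: frame_at_def)
  obtain V \<Omega> where \<Omega>: "openin (mtop M) V" "x \<in> V" "form_on M V \<Omega>" "kernel_on V D \<Omega>" "\<Omega> x = w"
    "ext_deriv M \<Omega> x X1 X2 = w1 X1 * w2 X2" using fibre_ext_deriv[OF y f] by blast
  obtain r where r: "r \<noteq> 0" "w = (\<lambda>v. r * \<Theta> x v)" using kernel_ratio[OF xM k v(1,13)] .
  have "w1 X1 * w2 X2 = r * ext_deriv M \<Theta> x X1 X2"
    using ext_deriv_proportional[OF \<Theta> \<Omega>(1,3,4,2), of r X1 X2] \<Omega>(5,6) r frame_kernel[OF f k(2)] by simp
  moreover have "w1 X1 * w2 X2 \<noteq> 0" using v by simp
  ultimately show "ext_deriv M \<Theta> x X1 X2 \<noteq> 0" "w = (\<lambda>v. (w1 X1 * w2 X2 / ext_deriv M \<Theta> x X1 X2) * \<Theta> x v)"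
    using r(2) by auto
qed

text \<open>Two numbers suffice as fibre coordinate because the third scale is fixed by
  \<open>fibre_omega\<close>; all positive pairs occur by \<open>fibre_scale\<close>.\<close>

lemma Y2_fib:
  assumes t: "triv W X1 X2 X" and x: "x \<in> W"
  shows "bij_betw (Y2coord X1 X2) {y \<in> Y2. fst y = x} K2"
proof -
  note f = triv_frame[OF t x]
  have xM: "x \<in> points M" using f by (simp add: frame_at_def)
  have mem: "y \<in> Y2 \<longleftrightarrow> snd y \<in> Y2_fibre M T1 T2 (X1 x) (X2 x) (X x) x" if "fst y = x" for y
    using triv_fibre[OF t, of y] that x by simp
  show ?thesis
    unfolding bij_betw_def
  proof (intro conjI inj_onI set_eqI iffI)
    fix y y' assume y: "y \<in> {y \<in> Y2. fst y = x}" and y': "y' \<in> {y \<in> Y2. fst y = x}"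
      and eq: "Y2coord X1 X2 y = Y2coord X1 X2 y'"
    obtain w w1 w2 where yy: "y = (x, w, w1, w2)" using y by (cases y) auto
    obtain w' w1' w2' where yy': "y' = (x, w', w1', w2')" using y' by (cases y') auto
    have fy: "(w, w1, w2) \<in> Y2_fibre M T1 T2 (X1 x) (X2 x) (X x) x"
      "(w', w1', w2') \<in> Y2_fibre M T1 T2 (X1 x) (X2 x) (X x) x"
      using mem[of y] mem[of y'] y y' yy yy' by auto
    have e: "w1 (X1 x) = w1' (X1 x)" "w2 (X2 x) = w2' (X2 x)" using eq by (auto simp: yy yy' Y2coord_def)
    note v = fibre_values[OF fy(1) f] and v' = fibre_values[OF fy(2) f]
    have "w1 = w1'" by (rule frame_linear_eq[OF f]) (use v v' e in auto)
    moreover have "w2 = w2'" by (rule frame_linear_eq[OF f]) (use v v' e in auto)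
    moreover obtain U \<Theta> where "openin (mtop M) U" "x \<in> U" "form_on M U \<Theta>" "kernel_on U D \<Theta>"
      using contact_form[OF xM] .
    then have "w = w'" using fibre_omega(2)[OF fy(1) f, of U \<Theta>] fibre_omega(2)[OF fy(2) f, of U \<Theta>] e by simp
    ultimately show "y = y'" by (simp add: yy yy')
  next
    fix z assume "z \<in> Y2coord X1 X2 ` {y \<in> Y2. fst y = x}"
    then obtain y where y: "y \<in> Y2" "fst y = x" "z = Y2coord X1 X2 y" by blast
    obtain w w1 w2 where yy: "y = (x, w, w1, w2)" using y by (cases y) auto
    show "z \<in> K2" using fibre_values[OF _ f, of w w1 w2] mem[of y] y by (simp add: yy Y2coord_def K2_def)
  next
    fix z assume z: "z \<in> K2"
    obtain a b where ab: "z = (a, b)" "a > 0" "b > 0" using z by (cases z) (auto simp: K2_def)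
    \<comment> \<open>\<open>Y2_bundle\<close> guarantees a point in the fibre; rescaling it by the
      structure group reaches the prescribed coordinates.\<close>
    have "x \<in> fst ` Y2" using Y2b xM by (simp add: Y2_bundle_def)
    then obtain w w1 w2 where y0: "(x, w, w1, w2) \<in> Y2" by force
    then have y0f: "(w, w1, w2) \<in> Y2_fibre M T1 T2 (X1 x) (X2 x) (X x) x" using mem[of "(x, w, w1, w2)"] by simp
    note v = fibre_values[OF y0f f]
    let ?a = "a / w1 (X1 x)" and ?b = "b / w2 (X2 x)"
    let ?y = "(x, \<lambda>v. (?a * ?b) * w v, \<lambda>v. ?a * w1 v, \<lambda>v. ?b * w2 v)"
    have "?y \<in> Y2" using fibre_scale[OF y0f f, of ?a ?b] ab v mem[of ?y] by simp
    moreover have "Y2coord X1 X2 ?y = z" using v ab by (simp add: Y2coord_def)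
    ultimately show "z \<in> Y2coord X1 X2 ` {y \<in> Y2. fst y = x}" by (intro image_eqI[of _ _ ?y]) auto
  qed
qed

lemma triv_smooth:
  assumes t: "triv W X1 X2 X" and c: "c \<in> M" "W \<subseteq> fst c"
  shows "openin (mtop M) W" "open (snd c ` W)"
    "smooth_on (snd c ` W) (\<lambda>u. tcoord M c (cinv c u) (X1 (cinv c u)))"
    "smooth_on (snd c ` W) (\<lambda>u. tcoord M c (cinv c u) (X2 (cinv c u)))"
    "smooth_on (snd c ` W) (\<lambda>u. tcoord M c (cinv c u) (X (cinv c u)))"
proof -
  have W: "fst c \<inter> W = W" using c by auto
  show op: "openin (mtop M) W" using t by (simp add: Y2_trivialising_def)
  show "open (snd c ` W)" using openin_chart_image[OF atlas_M c(1) op] by (simp add: W)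
  have vf: "smooth_on (snd c ` W) (\<lambda>u. tcoord M c (cinv c u) (Z (cinv c u)))" if "vector_field_on M W Z" for Z
    using that c(1) W unfolding vector_field_on_def by fastforce
  have "vector_field_on M W X1 \<and> vector_field_on M W X2 \<and> vector_field_on M W X"
    using t unfolding Y2_trivialising_def adapted_frame_def by blast
  then show "smooth_on (snd c ` W) (\<lambda>u. tcoord M c (cinv c u) (X1 (cinv c u)))"
    "smooth_on (snd c ` W) (\<lambda>u. tcoord M c (cinv c u) (X2 (cinv c u)))"
    "smooth_on (snd c ` W) (\<lambda>u. tcoord M c (cinv c u) (X (cinv c u)))"
    using vf[of X1] vf[of X2] vf[of X] by blast+
qed

section \<open>The adapted atlas of Y2\<close>

lemma frame_change_smooth:
  assumes c: "c \<in> M" and W: "openin (mtop M) W" "W \<subseteq> fst c"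
    and Z: "smooth_on (snd c ` W) (\<lambda>u. tcoord M c (cinv c u) (Z (cinv c u)))"
      "smooth_on (snd c ` W) (\<lambda>u. tcoord M c (cinv c u) (Z' (cinv c u)))"
    and r: "\<And>x. x \<in> W \<Longrightarrow> Z' x = r x *\<^sub>R Z x" "\<And>x. x \<in> W \<Longrightarrow> Z x \<noteq> 0"
  shows "smooth_on (snd c ` W) (\<lambda>u. r (cinv c u))"
proof (rule smooth_on_coeff1[OF _ Z(2,1)])
  have "fst c \<inter> W = W" using W by auto
  then show "open (snd c ` W)" using openin_chart_image[OF atlas_M c W(1)] by simp
  fix u assume "u \<in> snd c ` W"
  then have x: "cinv c u \<in> W" "cinv c u \<in> fst c" using cinv_chart[OF atlas_M c] W by auto
  note tc = linear_tcoord[OF atlas_M c x(2)] tvec_tcoord[OF atlas_M c x(2)] linear_tvec[OF atlas_M c x(2)]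
  show "tcoord M c (cinv c u) (Z (cinv c u)) \<noteq> 0" using tc(2)[of "Z (cinv c u)"] linear_0[OF tc(3)] r(2)[OF
      x(1)] by metis
  show "tcoord M c (cinv c u) (Z' (cinv c u)) = r (cinv c u) *\<^sub>R tcoord M c (cinv c u) (Z (cinv c u))"
    using r(1)[OF x(1)] linear_scale[OF tc(1)] by simp
qed

lemma Y2_fibred: "fibred_atlas M Y2 fst (Y2idx M T1 T2 L Y2) K2"
proof
  show "smooth_atlas M" by (rule atlas_M)
  show "open K2" by (rule open_K2)
  show "c \<in> M \<and> openin (mtop M) W \<and> W \<subseteq> fst c" if "(c, W, G) \<in> Y2idx M T1 T2 L Y2" for c W G
    using that by (auto elim!: Y2idxE simp: Y2_trivialising_def)
  show "bij_betw G {y \<in> Y2. fst y = x} K2" if "(c, W, G) \<in> Y2idx M T1 T2 L Y2" "x \<in> W" for c W G x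
    using that Y2_fib by (auto elim!: Y2idxE)
  fix c W G c' W' G' assume i: "(c, W, G) \<in> Y2idx M T1 T2 L Y2" and i': "(c', W', G') \<in> Y2idx M T1 T2 L Y2"
  obtain X1 X2 X where t: "G = Y2coord X1 X2" "c \<in> M" "W \<subseteq> fst c" "triv W X1 X2 X"
    using i by (auto elim!: Y2idxE)
  obtain Z1 Z2 Z where t': "G' = Y2coord Z1 Z2" "c' \<in> M" "W' \<subseteq> fst c'" "triv W' Z1 Z2 Z"
    using i' by (auto elim!: Y2idxE)
  let ?W = "W \<inter> W'"
  have opW: "openin (mtop M) ?W" using triv_smooth(1) t t' by blast
  have tW: "triv ?W X1 X2 X" "triv ?W Z1 Z2 Z" "?W \<subseteq> fst c"
    using triv_subset[OF t(4) opW] triv_subset[OF t'(4) opW] t(3) by auto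
  note s = triv_smooth[OF tW(1) t(2) tW(3)] and s' = triv_smooth[OF tW(2) t(2) tW(3)]
  \<comment> \<open>The two frames span the same lines, so the change of fibre coordinate multiplies
    each entry by a function on the base.\<close>
  have "\<exists>r1 r2. Z1 x = r1 *\<^sub>R X1 x \<and> Z2 x = r2 *\<^sub>R X2 x" if "x \<in> ?W" for x
    using frame_lines(1,2)[OF triv_frame[OF tW(1) that]] triv_frame[OF tW(2) that] unfolding frame_at_def by blast
  then obtain r1 r2 where r: "\<And>x. x \<in> ?W \<Longrightarrow> Z1 x = r1 x *\<^sub>R X1 x" "\<And>x. x \<in> ?W \<Longrightarrow> Z2 x = r2 x *\<^sub>R X2 x"
    by metis
  have nz: "X1 x \<noteq> 0" "X2 x \<noteq> 0" if "x \<in> ?W" for x using triv_frame[OF tW(1) that] by (auto simp: frame_at_def)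
  have r1: "smooth_on (snd c ` ?W) (\<lambda>u. r1 (cinv c u))" "smooth_on (snd c ` ?W) (\<lambda>u. r2 (cinv c u))"
    by (rule frame_change_smooth[OF t(2) opW tW(3) s(3) s'(3) r(1) nz(1)]
        frame_change_smooth[OF t(2) opW tW(3) s(4) s'(4) r(2) nz(2)]; assumption)+
  let ?S = "snd c ` ?W \<times> K2"
  have opS: "open ?S" by (intro open_Times s(2) open_K2)
  have "smooth_on ?S (\<lambda>z. r1 (cinv c (fst z)))" "smooth_on ?S (\<lambda>z. r2 (cinv c (fst z)))"
    by (rule smooth_on_compose[OF r1(1) smooth_on_fst[OF smooth_on_id] opS s(2)]
        smooth_on_compose[OF r1(2) smooth_on_fst[OF smooth_on_id] opS s(2)]; force)+
  then have "smooth_on ?S (\<lambda>z. (r1 (cinv c (fst z)) * fst (snd z), r2 (cinv c (fst z)) * snd (snd z)))"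
    by (intro smooth_intros opS)
  then show "smooth_on ?S (\<lambda>z. G' (the_inv_into {y \<in> Y2. fst y = cinv c (fst z)} G (snd z)))"
  proof (rule smooth_on_cong[OF _ opS])
    fix z assume "z \<in> ?S"
    then obtain x where x: "x \<in> ?W" "fst z = snd c x" and K: "snd z \<in> K2" by (auto simp only: mem_Times_iff)
    have cx: "cinv c (fst z) = x" using x cinv_chart[OF atlas_M t(2), of x] t(3) by auto
    note b = Y2_fib[OF t(4), of x, folded t(1), unfolded bij_betw_def]
    let ?y = "the_inv_into {y \<in> Y2. fst y = x} G (snd z)"
    have y: "?y \<in> {y \<in> Y2. fst y = x}" by (rule the_inv_into_into) (use b x K in auto)
    have Gy: "G ?y = snd z" by (rule f_the_inv_into_f) (use b x K in auto)
    obtain w w1 w2 where yy: "?y = (x, w, w1, w2)" using y by (cases ?y) auto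
    have sz: "snd z = (w1 (X1 x), w2 (X2 x))" using Gy[unfolded yy] by (simp add: t(1) Y2coord_def)
    have "(w, w1, w2) \<in> Y2_fibre M T1 T2 (X1 x) (X2 x) (X x) x"
      using triv_fibre[OF t(4), of ?y] y yy x by simp
    note v = fibre_values[OF this triv_frame[OF tW(1) x(1)]]
    show "(r1 (cinv c (fst z)) * fst (snd z), r2 (cinv c (fst z)) * snd (snd z)) =
        G' (the_inv_into {y \<in> Y2. fst y = cinv c (fst z)} G (snd z))"
      unfolding cx yy t'(1) Y2coord_def
      using r(1)[OF x(1)] r(2)[OF x(1)] v sz by (simp add: linear_scale)
  qed
qed

sublocale Y2F: fibred_atlas M Y2 fst "Y2idx M T1 T2 L Y2" K2
  by (rule Y2_fibred)

lemma Y2A_eq: "Y2A = Y2F.atl"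
proof -
  have "(\<lambda>(x, w, w1, w2). (snd c x, w1 (X1 x), w2 (X2 x))) = (\<lambda>y. (snd c (fst y), Y2coord X1 X2 y))"
    for c :: "('m, real^3) chart" and X1 X2 by (auto simp: Y2coord_def)
  then have "Y2A = {Y2F.bchart (c, W, Y2coord X1 X2) | c W X1 X2 X. c \<in> M \<and> W \<subseteq> fst c \<and> triv W X1 X2 X}"
    unfolding Y2_atlas_def Y2F.bchart_def by simp
  also have "\<dots> = Y2F.atl" unfolding Y2F.atl_def by (blast intro: Y2idxI elim: Y2idxE)
  finally show ?thesis .
qed

lemma atlas_Y2: "smooth_atlas Y2A"
  unfolding Y2A_eq by (rule Y2F.smooth_atlas_atl)

text \<open>One open set carrying a chart, an adapted frame and a contact form, so that charts of E
  and of \<open>Y2\<close> are available over the same base.\<close>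

definition local_data :: "('m, real^3) chart \<Rightarrow> 'm set \<Rightarrow> ('m \<Rightarrow> real^3) \<Rightarrow> ('m \<Rightarrow> real^3) \<Rightarrow> ('m \<Rightarrow> real^3)
    \<Rightarrow> ('m \<Rightarrow> covector) \<Rightarrow> bool" where
  "local_data c W X1 X2 X \<Theta> \<longleftrightarrow> c \<in> M \<and> openin (mtop M) W \<and> W \<subseteq> fst c \<and> triv W X1 X2 X \<and>
     form_on M W \<Theta> \<and> kernel_on W D \<Theta>"

lemma local_data_exists:
  assumes "x \<in> points M" "c \<in> M" "x \<in> fst c" "triv W' X1 X2 X" "x \<in> W'"
  obtains W \<Theta> where "x \<in> W" "W \<subseteq> W'" "local_data c W X1 X2 X \<Theta>"
proof -
  obtain W \<Theta> where W: "x \<in> W" "W \<subseteq> fst c" "openin (mtop M) W" "form_on M W \<Theta>" "kernel_on W D \<Theta>"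
    using E_chart_exists[OF assms(1-3)] .
  have op: "openin (mtop M) (W \<inter> W')" using W(3) assms(4) by (auto simp: Y2_trivialising_def)
  have "kernel_on (W \<inter> W') D \<Theta>" using W(5) by (auto simp: kernel_on_def)
  then have "local_data c (W \<inter> W') X1 X2 X \<Theta>"
    unfolding local_data_def using op W assms triv_subset[OF assms(4) op] form_on_subset[OF W(4)] by auto
  then show ?thesis using that[of "W \<inter> W'" \<Theta>] W assms by auto
qed

lemma local_data_at:
  assumes "x \<in> points M"
  obtains c W X1 X2 X \<Theta> where "x \<in> W" "local_data c W X1 X2 X \<Theta>"
proof -
  obtain W X1 X2 X where W: "x \<in> W" "triv W X1 X2 X" using Y2b assms unfolding Y2_bundle_def by blast
  show ?thesis using local_data_exists[OF assms chart_at_in[OF assms] W(2,1)] that by metis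
qed

end

context enriched_Y2
begin

section \<open>The projection from Y2 to E in coordinates\<close>

definition pr_E :: "'m Y2_point \<Rightarrow> 'm contact_covector" where
  "pr_E y = (fst y, fst (snd y))"

lemma fst_pr_E [simp]: "fst (pr_E y) = fst y" and snd_pr_E [simp]: "snd (pr_E y) = fst (snd y)"
  by (simp_all add: pr_E_def)

lemma fst_Y2: "y \<in> Y2 \<Longrightarrow> fst y \<in> points M"
  using Y2b by (auto simp: Y2_bundle_def)

lemma Y2_values:
  assumes y: "y \<in> Y2" and t: "triv W X1 X2 X" "fst y \<in> W"
  defines "w \<equiv> fst (snd y)" and "w1 \<equiv> fst (snd (snd y))" and "w2 \<equiv> snd (snd (snd y))" and "x \<equiv> fst y"
  shows "linear w" "linear w1" "linear w2" "w (X1 x) = 0" "w (X2 x) = 0" "w (X x) > 0" "w1 (X1 x) > 0" "w1 (X2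
      x) = 0" "w1 (X x) = 0"
    "w2 (X1 x) = 0" "w2 (X2 x) > 0" "w2 (X x) = 0" "{v. w v = 0} = D x"
    and "(w, w1, w2) \<in> Y2_fibre M T1 T2 (X1 x) (X2 x) (X x) x"
proof -
  show *: "(w, w1, w2) \<in> Y2_fibre M T1 T2 (X1 x) (X2 x) (X x) x"
    using triv_fibre[OF t] y by (simp add: w_def w1_def w2_def x_def)
  show "linear w" "linear w1" "linear w2" "w (X1 x) = 0" "w (X2 x) = 0" "w (X x) > 0" "w1 (X1 x) > 0" "w1 (X2
      x) = 0" "w1 (X x) = 0"
    "w2 (X1 x) = 0" "w2 (X2 x) > 0" "w2 (X x) = 0" "{v. w v = 0} = D x"
    using fibre_values[OF * triv_frame[OF t(1)]] t(2) by (auto simp: x_def)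
qed

lemma pr_E_in:
  assumes y: "y \<in> Y2"
  shows "pr_E y \<in> E"
proof -
  obtain W X1 X2 X where W: "fst y \<in> W" "triv W X1 X2 X" using Y2b fst_Y2[OF y] unfolding Y2_bundle_def by blast
  show ?thesis using Y2_values[OF y W(2,1)] fst_Y2[OF y] by (simp add: pr_E_def E_set_def)
qed

text \<open>The factor \<open>\<kappa>\<close> in the coordinate expression
  \<open>a b / \<kappa>\<close> of the projection to E.\<close>

definition kap :: "('m \<Rightarrow> covector) \<Rightarrow> ('m \<Rightarrow> real^3) \<Rightarrow> ('m \<Rightarrow> real^3) \<Rightarrow> 'm \<Rightarrow> real" where
  "kap \<Theta> X1 X2 x = ext_deriv M \<Theta> x (X1 x) (X2 x)"

lemma
  assumes l: "local_data c W X1 X2 X \<Theta>"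
  shows ldE: "(c, W, Ecoord \<Theta>) \<in> Eidx M T1 T2"
    and ldY2: "(c, W, Y2coord X1 X2) \<in> Y2idx M T1 T2 L Y2"
    and ld: "c \<in> M" "openin (mtop M) W" "W \<subseteq> fst c" "triv W X1 X2 X" "form_on M W \<Theta>" "kernel_on W D \<Theta>"
    and ld_cinv: "u \<in> snd c ` W \<Longrightarrow> cinv c u \<in> W" "u \<in> snd c ` W \<Longrightarrow> snd c (cinv c u) = u"
    and kap_smooth: "smooth_on (snd c ` W) (\<lambda>u. kap \<Theta> X1 X2 (cinv c u))"
proof -
  show *: "c \<in> M" "openin (mtop M) W" "W \<subseteq> fst c" "triv W X1 X2 X" "form_on M W \<Theta>" "kernel_on W D \<Theta>"
    using l by (auto simp: local_data_def)
  show "(c, W, Ecoord \<Theta>) \<in> Eidx M T1 T2" by (rule EidxI[OF *(1-3,5,6)])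
  show "(c, W, Y2coord X1 X2) \<in> Y2idx M T1 T2 L Y2" by (rule Y2idxI[OF *(1,3,4)])
  show cc: "u \<in> snd c ` W \<Longrightarrow> cinv c u \<in> W" "u \<in> snd c ` W \<Longrightarrow> snd c (cinv c u) = u" for u
    using cinv_chart[OF atlas_M *(1)] *(3) by auto
  note s = triv_smooth[OF *(4,1,3)]
  have W: "fst c \<inter> W = W" using *(3) by auto
  have cov: "smooth_covec (snd c ` W) (formc M c \<Theta>)" using form_on_covec[OF atlas_M *(1,5)] by (simp add: W)
  have "smooth_on (snd c ` W) (\<lambda>u. dcov (formc M c \<Theta>) u (tcoord M c (cinv c u) (X1 (cinv c u)))
      (tcoord M c (cinv c u) (X2 (cinv c u))))"
    by (rule dcov_smooth[OF cov s(2-4)])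
  then show "smooth_on (snd c ` W) (\<lambda>u. kap \<Theta> X1 X2 (cinv c u))"
  proof (rule smooth_on_cong[OF _ s(2)])
    fix u assume u: "u \<in> snd c ` W"
    note x = cc[OF u]
    have xc: "cinv c u \<in> fst c" using x *(3) by auto
    show "dcov (formc M c \<Theta>) u (tcoord M c (cinv c u) (X1 (cinv c u))) (tcoord M c (cinv c u) (X2 (cinv c u)))
        = kap \<Theta> X1 X2 (cinv c u)"
      using ext_deriv_chart[OF atlas_M *(1) xc *(2) x(1) *(5)] x(2) tvec_tcoord[OF atlas_M *(1) xc]
      unfolding kap_def by metis
  qed
qed

lemma Y2_over_exists:
  assumes "x \<in> points M" obtains y where "y \<in> Y2" "fst y = x"
  using assms Y2b unfolding Y2_bundle_def by (metis imageE)

lemma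
  assumes l: "local_data c W X1 X2 X \<Theta>" and y: "y \<in> Y2" "fst y \<in> W"
  shows Y2_omega_eq: "fst (snd y) = (\<lambda>v. (fst (Y2coord X1 X2 y) * snd (Y2coord X1 X2 y) / kap \<Theta> X1 X2 (fst y))
      * \<Theta> (fst y) v)"
    and Y2coord_pos: "fst (Y2coord X1 X2 y) > 0" "snd (Y2coord X1 X2 y) > 0"
    and Ecoord_pr_E: "Ecoord \<Theta> (pr_E y) = fst (Y2coord X1 X2 y) * snd (Y2coord X1 X2 y) / kap \<Theta> X1 X2 (fst y)"
proof -
  note d = ld[OF l] and v = Y2_values[OF y(1) ld(4)[OF l] y(2)]
  show *: "fst (snd y) = (\<lambda>v. (fst (Y2coord X1 X2 y) * snd (Y2coord X1 X2 y) / kap \<Theta> X1 X2 (fst y)) * \<Theta> (fst y) v)"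
    using fibre_omega(2)[OF v(14) triv_frame[OF d(4) y(2)] d(2,5,6) y(2)] by (simp add: Y2coord_def kap_def)
  show "fst (Y2coord X1 X2 y) > 0" "snd (Y2coord X1 X2 y) > 0" using v by (auto simp: Y2coord_def)
  obtain z where z: "\<Theta> (fst y) z \<noteq> 0" using kernel_nonzero[OF fst_Y2[OF y(1)] form_kernel(2)[OF d(5,6) y(2)]] .
  show "Ecoord \<Theta> (pr_E y) = fst (Y2coord X1 X2 y) * snd (Y2coord X1 X2 y) / kap \<Theta> X1 X2 (fst y)"
    unfolding pr_E_def * by (rule Ecoord_eq[of \<Theta> "fst y" z, OF z])
qed

text \<open>A point of \<open>Y2\<close> over \<open>x\<close> exists, and its positive product
  \<open>\<omega>1(X1) \<omega>2(X2)\<close> is a multiple of \<open>\<kappa>\<close>.\<close>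

lemma kap_nonzero:
  assumes l: "local_data c W X1 X2 X \<Theta>" and x: "x \<in> W"
  shows "kap \<Theta> X1 X2 x \<noteq> 0"
proof -
  note d = ld[OF l]
  obtain y where y: "y \<in> Y2" "fst y = x" using Y2_over_exists openin_points[OF d(2) x] by blast
  note v = Y2_values[OF y(1) d(4)]
  show ?thesis using fibre_omega(1)[OF v(14) triv_frame[OF d(4)] d(2,5,6)] x y(2) by (simp add: kap_def)
qed

lemma points_Y2A: "points Y2A = Y2"
proof
  show "points Y2A \<subseteq> Y2" unfolding Y2A_eq points_def Y2F.atl_def by (auto simp: Y2F.bchart_def)
  show "Y2 \<subseteq> points Y2A"
  proof
    fix y assume y: "y \<in> Y2"
    obtain c W X1 X2 X \<Theta> where l: "fst y \<in> W" "local_data c W X1 X2 X \<Theta>" using local_data_at[OF fst_Y2[OF y]] .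
    have "y \<in> fst (Y2F.bchart (c, W, Y2coord X1 X2))" using y l by (simp add: Y2F.fst_bchart)
    then show "y \<in> points Y2A" unfolding Y2A_eq using pointsI[OF Y2F.bchart_in[OF ldY2[OF l(2)]]] by blast
  qed
qed

lemma openin_Y2: "openin (mtop Y2A) Y2"
  using openin_topspace[of "mtop Y2A"] by (simp add: points_Y2A)

lemma
  assumes l: "local_data c W X1 X2 X \<Theta>" and z: "z \<in> snd c ` W \<times> K2"
  defines "y \<equiv> cinv (Y2F.bchart (c, W, Y2coord X1 X2)) z"
  shows cinv_Y2: "y \<in> Y2" "fst y = cinv c (fst z)" "fst y \<in> W" "Y2coord X1 X2 y = snd z" "snd c (fst y) = fst z"
proof -
  have z': "fst z \<in> snd c ` W" "snd z \<in> K2" using z by auto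
  note C = Y2F.pr_cinv_bchart[OF ldY2[OF l] z']
  show "y \<in> Y2" "fst y = cinv c (fst z)" "Y2coord X1 X2 y = snd z" using C by (simp_all add: y_def)
  then show "fst y \<in> W" "snd c (fst y) = fst z" using ld_cinv[OF l z'(1)] by simp_all
qed

text \<open>In the charts given by local data the map is
  \<open>(x, a, b) \<mapsto> (x, a b / \<kappa>(x))\<close>.\<close>

lemma pr_E_smooth: "smooth_map Y2 Y2A EA pr_E"
  unfolding smooth_map_iff[of Y2]
proof
  fix y assume y: "y \<in> Y2"
  obtain c W X1 X2 X \<Theta> where l: "fst y \<in> W" "local_data c W X1 X2 X \<Theta>" using local_data_at[OF fst_Y2[OF y]] .
  note d = ld[OF l(2)]
  let ?C = "Y2F.bchart (c, W, Y2coord X1 X2)" let ?S = "snd c ` W \<times> K2"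
  note op = Y2F.open_bchart_range[OF ldY2[OF l(2)]] and rg = Y2F.bchart_range[OF ldY2[OF l(2)]]
  have C: "?C \<in> Y2A" "y \<in> fst ?C" unfolding Y2A_eq using Y2F.bchart_in[OF ldY2[OF l(2)]] y l(1) by (auto simp:
      Y2F.fst_bchart)
  show "smooth_map {y} Y2A EA pr_E"
    unfolding EA_eq
  proof (rule E.smooth_map_into[OF ldE[OF l(2)] C op(1)])
    show "snd ?C y \<in> ?S" using rg C(2) by blast
    show "?S \<subseteq> snd ?C ` fst ?C" using rg by simp
    show "smooth_atlas Y2A" by (rule atlas_Y2)
    show "pr_E (cinv ?C u) \<in> E \<and> fst (pr_E (cinv ?C u)) \<in> W" if "u \<in> ?S" for u
      using cinv_Y2[OF l(2) that] pr_E_in by simp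
    show "smooth_on ?S (\<lambda>u. snd c (fst (pr_E (cinv ?C u))))"
      by (rule smooth_on_cong[OF smooth_on_fst[OF smooth_on_id] op(1)]) (use cinv_Y2[OF l(2)] in simp)
    have "smooth_on ?S (\<lambda>z. kap \<Theta> X1 X2 (cinv c (fst z)))"
      by (rule smooth_on_compose[OF kap_smooth[OF l(2)] smooth_on_fst[OF smooth_on_id] op]) force
    moreover have "kap \<Theta> X1 X2 (cinv c (fst z)) \<noteq> 0" if "z \<in> ?S" for z
      using kap_nonzero[OF l(2)] ld_cinv(1)[OF l(2)] that by (auto simp only: mem_Times_iff)
    ultimately have "smooth_on ?S (\<lambda>z. fst (snd z) * snd (snd z) / kap \<Theta> X1 X2 (cinv c (fst z)))"
      by (intro smooth_intros op) auto
    then show "smooth_on ?S (\<lambda>u. Ecoord \<Theta> (pr_E (cinv ?C u)))"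
      by (rule smooth_on_cong[OF _ op(1)]) (use cinv_Y2[OF l(2)] Ecoord_pr_E[OF l(2)] in simp)
  qed
qed

text \<open>A section of \<open>Y\<^sub>2 \<rightarrow> E\<close> over the image of \<open>Y\<^sub>2\<close>, normalised by \<open>\<omega>\<^sup>2(X\<^sub>2) = b\<close>.\<close>

definition sec :: "('m, real^3) chart \<Rightarrow> 'm set \<Rightarrow> ('m \<Rightarrow> real^3) \<Rightarrow> ('m \<Rightarrow> real^3) \<Rightarrow> ('m \<Rightarrow> covector) \<Rightarrow> real
    \<Rightarrow> 'm contact_covector \<Rightarrow> 'm Y2_point" where
  "sec c W X1 X2 \<Theta> b e = cinv (Y2F.bchart (c, W, Y2coord X1 X2))
     (snd c (fst e), (Ecoord \<Theta> e * kap \<Theta> X1 X2 (fst e) / b, b))"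

text \<open>The image of \<open>Y2\<close> over \<open>W\<close>. E contains both signs of the
  contact covector, while \<open>r \<kappa> = a b\<close> must be positive.\<close>

definition sec_dom :: "'m set \<Rightarrow> ('m \<Rightarrow> real^3) \<Rightarrow> ('m \<Rightarrow> real^3) \<Rightarrow> ('m \<Rightarrow> covector) \<Rightarrow> 'm contact_covector set" where
  "sec_dom W X1 X2 \<Theta> = {e \<in> E. fst e \<in> W \<and> Ecoord \<Theta> e * kap \<Theta> X1 X2 (fst e) > 0}"

lemma
  assumes l: "local_data c W X1 X2 X \<Theta>" and b: "b > 0" and e: "e \<in> sec_dom W X1 X2 \<Theta>"
  shows sec_in: "sec c W X1 X2 \<Theta> b e \<in> Y2" "fst (sec c W X1 X2 \<Theta> b e) = fst e"
      "Y2coord X1 X2 (sec c W X1 X2 \<Theta> b e) = (Ecoord \<Theta> e * kap \<Theta> X1 X2 (fst e) / b, b)"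
    and pr_E_sec: "pr_E (sec c W X1 X2 \<Theta> b e) = e"
proof -
  note d = ld[OF l]
  let ?z = "(snd c (fst e), (Ecoord \<Theta> e * kap \<Theta> X1 X2 (fst e) / b, b))"
  have e': "e \<in> E" "fst e \<in> W" using e by (auto simp: sec_dom_def)
  have z: "?z \<in> snd c ` W \<times> K2" using e b by (simp add: sec_dom_def K2_def)
  have cx: "cinv c (snd c (fst e)) = fst e" using cinv_chart[OF atlas_M d(1)] d(3) e' by auto
  note s = cinv_Y2[OF l z, folded sec_def]
  show a: "sec c W X1 X2 \<Theta> b e \<in> Y2" "fst (sec c W X1 X2 \<Theta> b e) = fst e"
      "Y2coord X1 X2 (sec c W X1 X2 \<Theta> b e) = (Ecoord \<Theta> e * kap \<Theta> X1 X2 (fst e) / b, b)"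
    using s cx by simp_all
  have "fst (snd (sec c W X1 X2 \<Theta> b e)) = snd e"
    using Y2_omega_eq[OF l s(1,3)] E_snd[OF d(1-3,5,6) e'] kap_nonzero[OF l e'(2)] b unfolding a by simp
  then show "pr_E (sec c W X1 X2 \<Theta> b e) = e" using a(2) by (simp add: prod_eq_iff)
qed

text \<open>Every point of \<open>Y2\<close> over \<open>W\<close> lies on the section normalised by
  its own value of \<open>\<omega>2(X2)\<close>.\<close>

lemma sec_pr_E:
  assumes l: "local_data c W X1 X2 X \<Theta>" and y: "y \<in> Y2" "fst y \<in> W"
  shows "pr_E y \<in> sec_dom W X1 X2 \<Theta>" "sec c W X1 X2 \<Theta> (snd (Y2coord X1 X2 y)) (pr_E y) = y"
proof -
  note p = Y2coord_pos[OF l y] and k = kap_nonzero[OF l y(2)] and r = Ecoord_pr_E[OF l y]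
  show e: "pr_E y \<in> sec_dom W X1 X2 \<Theta>" using p k r pr_E_in[OF y(1)] y by (simp add: sec_dom_def)
  let ?s = "sec c W X1 X2 \<Theta> (snd (Y2coord X1 X2 y)) (pr_E y)"
  note s = sec_in[OF l p(2) e]
  have "Y2coord X1 X2 ?s = Y2coord X1 X2 y" using s(3) p r k by (simp add: prod_eq_iff)
  then show "?s = y"
    using Y2_fib[OF ld(4)[OF l] y(2)] s(1,2) y by (auto simp: bij_betw_def dest: inj_onD)
qed

lemma sec_smooth:
  assumes l: "local_data c W X1 X2 X \<Theta>" and b: "b > 0"
  shows "openin (mtop EA) (sec_dom W X1 X2 \<Theta>)" "smooth_map (sec_dom W X1 X2 \<Theta>) EA Y2A (sec c W X1 X2 \<Theta> b)"
    "sec_dom W X1 X2 \<Theta> \<subseteq> fst (E.bchart (c, W, Ecoord \<Theta>))"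
proof -
  note d = ld[OF l]
  let ?C = "E.bchart (c, W, Ecoord \<Theta>)" and ?V = "sec_dom W X1 X2 \<Theta>" let ?S = "snd c ` W \<times> - {0 :: real}"
  note op = E.open_bchart_range[OF ldE[OF l]] and rg = E.bchart_range[OF ldE[OF l]]
  have CE: "?C \<in> EA" unfolding EA_eq by (rule E.bchart_in[OF ldE[OF l]])
  show VC: "?V \<subseteq> fst ?C" by (auto simp: sec_dom_def E.fst_bchart)
  have ks: "smooth_on ?S (\<lambda>z. kap \<Theta> X1 X2 (cinv c (fst z)))"
    by (rule smooth_on_compose[OF kap_smooth[OF l] smooth_on_fst[OF smooth_on_id] op]) force
  have sm: "smooth_on ?S (\<lambda>z. snd z * kap \<Theta> X1 X2 (cinv c (fst z)))" by (intro smooth_intros op ks)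
  \<comment> \<open>The coordinate description of the domain: the inequality
    \<open>r \<kappa> > 0\<close> is an open condition since \<open>\<kappa>\<close> is
    continuous.\<close>
  let ?Q = "?S \<inter> (\<lambda>z. snd z * kap \<Theta> X1 X2 (cinv c (fst z))) -` {0<..}"
  have Q: "open ?Q" by (rule continuous_open_preimage[OF smooth_on_continuous[OF sm] op(1)]) simp
  have V: "e \<in> ?V \<longleftrightarrow> e \<in> fst ?C \<and> snd ?C e \<in> ?Q" for e
  proof (cases "e \<in> fst ?C")
    case True
    then have "snd ?C e \<in> ?S" "fst e \<in> W" "e \<in> E" using rg by (blast, auto simp: E.fst_bchart)
    moreover have "cinv c (snd c (fst e)) = fst e" using cinv_chart[OF atlas_M d(1)] d(3) \<open>fst e \<in> W\<close> by auto
    ultimately show ?thesis using True by (simp add: sec_dom_def E.snd_bchart)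
  next
    case False then show ?thesis using VC by auto
  qed
  show "openin (mtop EA) ?V"
    using openin_chart_preimage[OF CE Q] V by (metis (no_types, lifting) Collect_cong Collect_mem_eq)
  show "smooth_map ?V EA Y2A (sec c W X1 X2 \<Theta> b)"
    unfolding smooth_map_iff[of ?V] Y2A_eq
  proof
    fix e assume e: "e \<in> ?V"
    have QC: "cinv ?C z \<in> ?V \<and> snd c (fst (cinv ?C z)) = fst z \<and> Ecoord \<Theta> (cinv ?C z) = snd z \<and> fst (cinv ?C z)
        = cinv c (fst z)"
      if z: "z \<in> ?Q" for z
    proof -
      have z': "fst z \<in> snd c ` W" "snd z \<in> - {0}" using z by auto
      note p = E.pr_cinv_bchart[OF ldE[OF l] z']
      show ?thesis using p z ld_cinv[OF l z'(1)] by (simp add: sec_dom_def)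
    qed
    show "smooth_map {e} EA Y2F.atl (sec c W X1 X2 \<Theta> b)"
    proof (rule Y2F.smooth_map_into[OF ldY2[OF l] CE _ Q])
      show "e \<in> fst ?C" "snd ?C e \<in> ?Q" using V e by auto
      show "?Q \<subseteq> snd ?C ` fst ?C" using rg by auto
      show "smooth_atlas EA" by (rule atlas_E)
      show "sec c W X1 X2 \<Theta> b (cinv ?C u) \<in> Y2 \<and> fst (sec c W X1 X2 \<Theta> b (cinv ?C u)) \<in> W" if "u \<in> ?Q" for u
        using sec_in(1,2)[OF l b conjunct1[OF QC[OF that]]] QC[OF that] by (auto simp: sec_dom_def)
      show "smooth_on ?Q (\<lambda>u. snd c (fst (sec c W X1 X2 \<Theta> b (cinv ?C u))))"
      proof (rule smooth_on_cong[OF smooth_on_fst[OF smooth_on_id] Q])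
        fix z assume z: "z \<in> ?Q"
        note q = QC[OF z]
        show "fst z = snd c (fst (sec c W X1 X2 \<Theta> b (cinv ?C z)))"
          unfolding sec_in(2)[OF l b conjunct1[OF q]] using q by (elim conjE) (rule sym)
      qed
      have "smooth_on ?Q (\<lambda>z. (snd z * kap \<Theta> X1 X2 (cinv c (fst z)) / b, b))"
        by (intro smooth_intros Q smooth_on_subset[OF ks]) (use b in auto)
      then show "smooth_on ?Q (\<lambda>u. Y2coord X1 X2 (sec c W X1 X2 \<Theta> b (cinv ?C u)))"
        by (rule smooth_on_cong[OF _ Q]) (use QC sec_in(3)[OF l b] in simp)
    qed
  qed
qed

section \<open>The differential of the projection and the forms on Y2\<close>

abbreviation "dpr \<equiv> tangent_map Y2A EA pr_E"

lemma pr_E_smooth_at: "y \<in> Y2 \<Longrightarrow> smooth_map {y} Y2A EA pr_E"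
  by (rule smooth_map_singleton[OF pr_E_smooth])

lemma dpr_sec:
  assumes l: "local_data c W X1 X2 X \<Theta>" and b: "b > 0" and e: "e \<in> sec_dom W X1 X2 \<Theta>"
  shows "dpr (sec c W X1 X2 \<Theta> b e) (tangent_map EA Y2A (sec c W X1 X2 \<Theta> b) e v) = v"
proof -
  let ?s = "sec c W X1 X2 \<Theta> b"
  note s = sec_smooth[OF l b]
  have sm: "smooth_map {e} EA Y2A ?s" by (rule smooth_map_singleton[OF s(2) e])
  have e': "e \<in> points EA" using e by (simp add: points_EA sec_dom_def)
  have "tangent_map EA EA (pr_E \<circ> ?s) e = tangent_map EA EA id e"
    by (rule smooth_map_cong(3)[OF atlas_E atlas_E smooth_map_comp(1)[OF atlas_E atlas_Y2 atlas_E sm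
        pr_E_smooth_at] s(1) e])
      (use sec_in(1)[OF l b e] pr_E_sec[OF l b] in auto)
  then have "tangent_map EA EA (pr_E \<circ> ?s) e v = v" using tangent_map_id[OF atlas_E e'] by simp
  then show ?thesis
    using tangent_map_comp[OF atlas_E atlas_Y2 atlas_E sm pr_E_smooth_at[OF sec_in(1)[OF l b e]]] by simp
qed

text \<open>Through each point passes a local section of the projection, whose differential is a
  right inverse of \<open>dpr\<close>.\<close>

lemma dpr_surj:
  assumes y: "y \<in> Y2"
  shows "\<exists>u. dpr y u = v"
proof -
  obtain c W X1 X2 X \<Theta> where l: "fst y \<in> W" "local_data c W X1 X2 X \<Theta>" using local_data_at[OF fst_Y2[OF y]] .
  show ?thesis
    using dpr_sec[OF l(2) Y2coord_pos(2)[OF l(2) y l(1)] sec_pr_E(1)[OF l(2) y l(1)]] sec_pr_E(2)[OF l(2) y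
        l(1)] by metis
qed

lemma linear_dpr: "y \<in> Y2 \<Longrightarrow> linear (dpr y)"
  by (rule linear_tangent_map[OF atlas_Y2 atlas_E pr_E_smooth_at])

lemma Y2_proj_dpr:
  assumes "y \<in> Y2"
  shows "Y2_proj M T1 T2 L Y2 y v = E_proj M T1 T2 (pr_E y) (dpr y v)"
proof -
  have "tangent_map Y2A M (fst \<circ> pr_E) y v = tangent_map EA M fst (pr_E y) (dpr y v)"
    by (rule tangent_map_comp[OF atlas_Y2 atlas_E atlas_M pr_E_smooth_at[OF assms] fst_smooth_E[OF pr_E_in[OF
        assms]]])
  moreover have "fst \<circ> pr_E = fst" by (auto simp: fun_eq_iff)
  ultimately show ?thesis unfolding Y2_proj_def E_proj_def by simp
qed

abbreviation "om \<equiv> Y2_omega M T1 T2 L Y2"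
abbreviation "om1 \<equiv> Y2_omega1 M T1 T2 L Y2"
abbreviation "om2 \<equiv> Y2_omega2 M T1 T2 L Y2"
abbreviation "Eproj \<equiv> E_proj M T1 T2"

lemma
  assumes "y \<in> Y2"
  shows om_eq: "om y v = taut (pr_E y) (dpr y v)"
    and om1_eq: "om1 y v = fst (snd (snd y)) (Eproj (pr_E y) (dpr y v))"
    and om2_eq: "om2 y v = snd (snd (snd y)) (Eproj (pr_E y) (dpr y v))"
  using Y2_proj_dpr[OF assms]
  by (simp_all add: Y2_omega_def Y2_omega1_def Y2_omega2_def E_taut_def split: prod.split)

text \<open>\<open>om\<close> is the pull-back of the tautological form, and d is natural.\<close>

lemma ext_deriv_om:
  assumes "y \<in> Y2"
  shows "ext_deriv Y2A om y u v = ext_deriv EA taut (pr_E y) (dpr y u) (dpr y v)"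
proof -
  have "ext_deriv Y2A om y = ext_deriv Y2A (pull Y2A EA pr_E taut) y"
    by (rule ext_deriv_cong[OF atlas_Y2 openin_Y2 assms]) (auto simp: om_eq pull_def fun_eq_iff)
  then show ?thesis
    using ext_deriv_pull[OF atlas_Y2 atlas_E pr_E_smooth_at[OF assms] openin_E pr_E_in[OF assms] E_taut_form]
        by simp
qed

text \<open>Unlike \<open>om\<close>, these two forms are not pulled back from E, since they involve
  a and b separately. Their smoothness has to be read off in the coordinates
  \<open>(x, a, b)\<close>.\<close>

lemma om12_form: "form_on Y2A Y2 om1" "form_on Y2A Y2 om2"
proof -
  \<comment> \<open>A form horizontal over M is smooth as soon as its covector on M has coefficients
    that are smooth functions of \<open>(x, a, b)\<close>.\<close>
  have *: "form_on Y2A Y2 om'"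
    if val: "\<And>y v. y \<in> Y2 \<Longrightarrow> om' y v = \<alpha> y (Eproj (pr_E y) (dpr y v))"
      and lin: "\<And>y. y \<in> Y2 \<Longrightarrow> linear (\<alpha> y)"
      and co: "\<And>c W X1 X2 X. triv W X1 X2 X \<Longrightarrow> c \<in> M \<Longrightarrow> W \<subseteq> fst c \<Longrightarrow>
        \<exists>f. (\<forall>h. smooth_on (snd c ` W \<times> K2) (\<lambda>z. f z h)) \<and>
          (\<forall>y\<in>Y2. \<forall>h. fst y \<in> W \<longrightarrow> \<alpha> y (tvec M c (fst y) h) = f (snd c (fst y), Y2coord X1 X2 y) h)"
    for om' and \<alpha> :: "'m Y2_point \<Rightarrow> covector"
  proof (rule form_on_localI[OF atlas_Y2])
    fix y assume y: "y \<in> Y2"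
    have "om' y = \<alpha> y \<circ> (Eproj (pr_E y) \<circ> dpr y)" using val[OF y] by (auto simp: fun_eq_iff)
    moreover have "linear (\<alpha> y \<circ> (Eproj (pr_E y) \<circ> dpr y))"
      by (intro linear_compose lin y linear_dpr linear_E_proj pr_E_in)
    ultimately show "linear (om' y)" by metis
  next
    fix y C h assume y: "y \<in> Y2" "C \<in> Y2A" "y \<in> fst C"
    obtain c W X1 X2 X where C: "C = Y2F.bchart (c, W, Y2coord X1 X2)" "c \<in> M" "W \<subseteq> fst c" "triv W X1 X2 X"
      using y(2) unfolding Y2A_eq Y2F.atl_def by (blast elim: Y2idxE)
    note ix = Y2idxI[OF C(2-4)]
    obtain f where f: "\<And>h. smooth_on (snd c ` W \<times> K2) (\<lambda>z. f z h)"
      "\<And>y h. y \<in> Y2 \<Longrightarrow> fst y \<in> W \<Longrightarrow> \<alpha> y (tvec M c (fst y) h) = f (snd c (fst y), Y2coord X1 X2 y) h"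
      using co[OF C(4,2,3)] by blast
    have "f z (fst h) = formc Y2A C om' z h" if z: "z \<in> snd c ` W \<times> K2" for z
    proof -
      have z': "fst z \<in> snd c ` W" "snd z \<in> K2" using z by auto
      note p = Y2F.pr_cinv_bchart[OF ix z']
      let ?y = "cinv C z"
      have x: "fst ?y \<in> W" "snd c (fst ?y) = fst z" "?y \<in> Y2" "Y2coord X1 X2 ?y = snd z"
        using p z' cinv_chart[OF atlas_M C(2)] C(1,3) by auto
      have "formc Y2A C om' z h = \<alpha> ?y (Y2_proj M T1 T2 L Y2 ?y (tvec Y2A C ?y h))"
        unfolding formc_def using val[OF x(3)] Y2_proj_dpr[OF x(3)] by simp
      also have "Y2_proj M T1 T2 L Y2 ?y (tvec Y2A C ?y h) = tvec M c (fst ?y) (fst h)"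
        unfolding Y2_proj_def C(1) Y2A_eq by (rule Y2F.pr_smooth_bchart(3)[OF ix]) (use x C(1) in auto)
      also have "\<alpha> ?y (tvec M c (fst ?y) (fst h)) = f z (fst h)"
        using f(2)[OF x(3,1)] x by simp
      finally show ?thesis by simp
    qed
    then have "smooth_on (snd c ` W \<times> K2) (\<lambda>z. formc Y2A C om' z h)"
      by (rule smooth_on_cong[OF f(1) Y2F.open_bchart_range(1)[OF ix]])
    moreover have "snd C y \<in> snd c ` W \<times> K2" using Y2F.bchart_range[OF ix] y(3) C(1) by blast
    ultimately show "\<exists>N. open N \<and> snd C y \<in> N \<and> smooth_on N (\<lambda>u. formc Y2A C om' u h)"
      using Y2F.open_bchart_range(1)[OF ix] by metis
  qed
  \<comment> \<open>Each covector kills two frame vectors and takes a coordinate of the fibre,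
    selected by \<open>pf\<close>, on the third. Cyclic order of the frame lets one cross product
    formula cover both forms.\<close>
  have co: "\<exists>f. (\<forall>h. smooth_on (snd c ` W \<times> K2) (\<lambda>z. f z h)) \<and>
          (\<forall>y\<in>Y2. \<forall>h. fst y \<in> W \<longrightarrow> \<alpha> y (tvec M c (fst y) h) = f (snd c (fst y), Y2coord X1 X2 y) h)"
    if t: "triv W X1 X2 X" and c: "c \<in> M" "W \<subseteq> fst c"
      and xyz: "(Z1, Z2, Z3) \<in> {(X1, X2, X), (X2, X, X1)}"
      and pf: "bounded_linear pf"
      and \<alpha>: "\<And>y. y \<in> Y2 \<Longrightarrow> fst y \<in> W \<Longrightarrow> linear (\<alpha> y) \<and> \<alpha> y (Z1 (fst y)) = pf (Y2coord X1 X2 y) \<and>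
        \<alpha> y (Z2 (fst y)) = 0 \<and> \<alpha> y (Z3 (fst y)) = 0"
    for c W X1 X2 X Z1 Z2 Z3 and pf :: "real \<times> real \<Rightarrow> real" and \<alpha> :: "'m Y2_point \<Rightarrow> covector"
  proof -
    let ?t = "\<lambda>Z u. tcoord M c (cinv c u) (Z (cinv c u))"
    let ?N = "\<lambda>u. cross3 (?t Z2 u) (?t Z3 u)"
    let ?f = "\<lambda>z h. pf (snd z) * ((h \<bullet> ?N (fst z)) / (?t Z1 (fst z) \<bullet> ?N (fst z)))"
    let ?S = "snd c ` W \<times> K2"
    note ts = triv_smooth[OF t c]
    have sm: "smooth_on (snd c ` W) (?t Z1)" "smooth_on (snd c ` W) (?t Z2)" "smooth_on (snd c ` W) (?t Z3)"
      using xyz ts by auto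
    have basis: "(\<exists>r1 r2 r3. v = r1 *\<^sub>R ?t Z1 u + r2 *\<^sub>R ?t Z2 u + r3 *\<^sub>R ?t Z3 u) \<and>
       (r1 *\<^sub>R ?t Z1 u + r2 *\<^sub>R ?t Z2 u + r3 *\<^sub>R ?t Z3 u = 0 \<longrightarrow> r1 = 0 \<and> r2 = 0 \<and> r3 = 0)"
      if u: "u \<in> snd c ` W" for u v r1 r2 r3
    proof -
      let ?x = "cinv c u"
      have x: "?x \<in> W" "?x \<in> fst c" using u cinv_chart[OF atlas_M c(1)] c(2) by auto
      note f = triv_frame[OF t x(1)] and tl = linear_tcoord[OF atlas_M c(1) x(2)]
      have "\<exists>r1 r2 r3. tvec M c ?x v = r1 *\<^sub>R Z1 ?x + r2 *\<^sub>R Z2 ?x + r3 *\<^sub>R Z3 ?x"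
      proof -
        obtain r1 r2 r3 where eq: "tvec M c ?x v = r1 *\<^sub>R X1 ?x + r2 *\<^sub>R X2 ?x + r3 *\<^sub>R X ?x"
          using frame_span[OF f] by blast
        consider "Z1 = X1" "Z2 = X2" "Z3 = X" | "Z1 = X2" "Z2 = X" "Z3 = X1" using xyz by auto
        then show ?thesis
        proof cases
          case 1 then show ?thesis using eq by blast
        next
          case 2
          then have "tvec M c ?x v = r2 *\<^sub>R Z1 ?x + r3 *\<^sub>R Z2 ?x + r1 *\<^sub>R Z3 ?x"
            using eq by (simp add: add.commute add.left_commute)
          then show ?thesis by blast
        qed
      qed
      then obtain s1 s2 s3 where "tvec M c ?x v = s1 *\<^sub>R Z1 ?x + s2 *\<^sub>R Z2 ?x + s3 *\<^sub>R Z3 ?x" by blast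
      then have "v = tcoord M c ?x (s1 *\<^sub>R Z1 ?x + s2 *\<^sub>R Z2 ?x + s3 *\<^sub>R Z3 ?x)"
        using tcoord_tvec[OF atlas_M c(1) x(2), of v] by simp
      then have 1: "v = s1 *\<^sub>R ?t Z1 u + s2 *\<^sub>R ?t Z2 u + s3 *\<^sub>R ?t Z3 u"
        using tl by (simp add: linear_add linear_scale)
      have "r1 = 0 \<and> r2 = 0 \<and> r3 = 0" if "r1 *\<^sub>R ?t Z1 u + r2 *\<^sub>R ?t Z2 u + r3 *\<^sub>R ?t Z3 u = 0"
      proof -
        have "tcoord M c ?x (r1 *\<^sub>R Z1 ?x + r2 *\<^sub>R Z2 ?x + r3 *\<^sub>R Z3 ?x) = 0"
          using that tl by (simp add: linear_add linear_scale)
        then have "r1 *\<^sub>R Z1 ?x + r2 *\<^sub>R Z2 ?x + r3 *\<^sub>R Z3 ?x = 0"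
          using tvec_tcoord[OF atlas_M c(1) x(2)] linear_0[OF linear_tvec[OF atlas_M c(1) x(2)]] by metis
        then show ?thesis
          using frame_indep[OF f, of r1 r2 r3] frame_indep[OF f, of r3 r1 r2] xyz by (auto simp: ac_simps)
      qed
      with 1 show ?thesis by blast
    qed
    have nz: "?t Z1 u \<bullet> ?N u \<noteq> 0" if "u \<in> snd c ` W" for u
      by (rule triple_product_nonzero) (use basis[OF that] in blast)+
    have opS: "open ?S" by (intro open_Times ts(2) open_K2)
    have cf: "smooth_on ?S (\<lambda>z. g (fst z))" if "smooth_on (snd c ` W) g" for g :: "real^3 \<Rightarrow> real^3"
      by (rule smooth_on_compose[OF that smooth_on_fst[OF smooth_on_id] opS ts(2)]) auto
    have nz': "?t Z1 (fst z) \<bullet> ?N (fst z) \<noteq> 0" if "z \<in> ?S" for z using nz that by (auto simp only: mem_Times_iff)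
    have "smooth_on ?S (\<lambda>z. ?f z h)" for h
      by (intro smooth_on_mult smooth_on_divide smooth_on_inner smooth_on_cross3 smooth_on_const opS cf sm nz'
          smooth_on_linear[OF pf] smooth_on_snd smooth_on_id)
    moreover have "\<alpha> y (tvec M c (fst y) h) = ?f (snd c (fst y), Y2coord X1 X2 y) h" if y: "y \<in> Y2" "fst y \<in> W"
        for y h
    proof -
      let ?u = "snd c (fst y)"
      have yc: "fst y \<in> fst c" using y c by auto
      have u: "?u \<in> snd c ` W" "cinv c ?u = fst y" using y yc cinv_chart[OF atlas_M c(1)] by auto
      note a = \<alpha>[OF y] and tt = tvec_tcoord[OF atlas_M c(1) yc]
      have "linear (\<lambda>h. \<alpha> y (tvec M c (fst y) h))"
        using linear_compose[OF linear_tvec[OF atlas_M c(1) yc], of "\<alpha> y"] a by (simp add: o_def)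
      from dual_covector_cross[OF _ _ this, of "?t Z1 ?u" "?t Z2 ?u" "?t Z3 ?u" h] basis[OF u(1)]
      show ?thesis using a tt by (simp add: u(2))
    qed
    ultimately show ?thesis by (intro exI[of _ ?f]) blast
  qed
  show "form_on Y2A Y2 om1"
  proof (rule *[of om1 "\<lambda>y. fst (snd (snd y))"])
    show "linear (fst (snd (snd y)))" if "y \<in> Y2" for y
      using Y2b fst_Y2[OF that] Y2_values(2)[OF that] unfolding Y2_bundle_def by blast
    show "\<exists>f. (\<forall>h. smooth_on (snd c ` W \<times> K2) (\<lambda>z. f z h)) \<and>
          (\<forall>y\<in>Y2. \<forall>h. fst y \<in> W \<longrightarrow> fst (snd (snd y)) (tvec M c (fst y) h) = f (snd c (fst y), Y2coord X1 X2 y) h)"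
      if "triv W X1 X2 X" "c \<in> M" "W \<subseteq> fst c" for c W X1 X2 X
      by (rule co[OF that, of X1 X2 X fst])
        (use Y2_values[OF _ that(1)] in \<open>auto simp: Y2coord_def bounded_linear_fst\<close>)
  qed (rule om1_eq)
  show "form_on Y2A Y2 om2"
  proof (rule *[of om2 "\<lambda>y. snd (snd (snd y))"])
    show "linear (snd (snd (snd y)))" if "y \<in> Y2" for y
      using Y2b fst_Y2[OF that] Y2_values(3)[OF that] unfolding Y2_bundle_def by blast
    show "\<exists>f. (\<forall>h. smooth_on (snd c ` W \<times> K2) (\<lambda>z. f z h)) \<and>
          (\<forall>y\<in>Y2. \<forall>h. fst y \<in> W \<longrightarrow> snd (snd (snd y)) (tvec M c (fst y) h) = f (snd c (fst y), Y2coord X1 X2 y) h)"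
      if "triv W X1 X2 X" "c \<in> M" "W \<subseteq> fst c" for c W X1 X2 X
      by (rule co[OF that, of X2 X X1 snd])
        (use Y2_values[OF _ that(1)] in \<open>auto simp: Y2coord_def bounded_linear_snd\<close>)
  qed (rule om2_eq)
qed

lemma om_form: "form_on Y2A Y2 om"
proof -
  have p: "form_on Y2A Y2 (pull Y2A EA pr_E taut)"
    by (rule form_on_pull[OF atlas_Y2 atlas_E pr_E_smooth openin_E _ E_taut_form]) (use pr_E_in in auto)
  have eq: "om y = pull Y2A EA pr_E taut y" if "y \<in> Y2" for y using om_eq[OF that] by (auto simp: pull_def)
  show ?thesis by (rule form_on_cong[OF atlas_Y2 openin_Y2 p]) (simp add: eq)
qed

end

section \<open>The embedding\<close>

locale enriched_phi = enriched_Y2 M T1 T2 L Y2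
  for M :: "'m mfd3" and T1 T2 L :: "'m dist3" and Y2 :: "'m Y2_point set" +
  fixes \<phi> :: "'m Y2_point \<Rightarrow> Y2_model \<Rightarrow> real"
  assumes phi_form: "form_on (Y2_atlas M T1 T2 L Y2) Y2 \<phi>"
    and d_om: "y \<in> Y2 \<Longrightarrow> ext_deriv (Y2_atlas M T1 T2 L Y2) (Y2_omega M T1 T2 L Y2) y u v
      = 2 * wedge (\<phi> y) (Y2_omega M T1 T2 L Y2 y) u v + wedge (Y2_omega1 M T1 T2 L Y2 y) (Y2_omega2 M T1 T2 L
          Y2 y) u v"
begin

section \<open>The coframe on E defined by a point of Y2\<close>

lemma linear_phi: "y \<in> Y2 \<Longrightarrow> linear (\<phi> y)"
  using phi_form by (auto simp: form_on_def)

lemma Y2_triv: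
  assumes "y \<in> Y2" obtains W X1 X2 X where "fst y \<in> W" "triv W X1 X2 X"
  using Y2b fst_Y2[OF assms] unfolding Y2_bundle_def by blast

lemma linear_Y2:
  assumes "y \<in> Y2"
  shows "linear (fst (snd y))" "linear (fst (snd (snd y)))" "linear (snd (snd (snd y)))"
proof -
  obtain W X1 X2 X where "fst y \<in> W" "triv W X1 X2 X" using Y2_triv[OF assms] .
  then show "linear (fst (snd y))" "linear (fst (snd (snd y)))" "linear (snd (snd (snd y)))"
    using Y2_values(1-3)[OF assms] by blast+
qed

lemma phi_vertical:
  assumes y: "y \<in> Y2" and v: "dpr y v = 0"
  shows "\<phi> y v = 0"
proof -
  have P0: "Eproj (pr_E y) 0 = 0" using linear_0[OF linear_E_proj[OF pr_E_in[OF y]]] .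
  have t0: "taut (pr_E y) 0 = 0" using P0 linear_0[OF linear_Y2(1)[OF y]] by (simp add: E_taut_def)
  \<comment> \<open>With a vector on which the tautological form is nonzero, the equation for the
    exterior derivative reduces to the single term containing \<open>\<phi> y v\<close>.\<close>
  obtain X1 X2 X h1 h2 h3 where h3: "taut (pr_E y) h3 \<noteq> 0" using E_frame_lifts[OF pr_E_in[OF y]] by metis
  obtain u where u: "dpr y u = h3" using dpr_surj[OF y] by blast
  have "ext_deriv Y2A om y v u = 0"
    unfolding ext_deriv_om[OF y] v by (rule ext_deriv_zero[OF atlas_E openin_E pr_E_in[OF y] E_taut_form])
  then have "2 * (\<phi> y v * taut (pr_E y) h3) = 0"
    unfolding d_om[OF y] wedge_def om_eq[OF y] om1_eq[OF y] om2_eq[OF y] v u t0 P0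
    using linear_0[OF linear_Y2(2)[OF y]] linear_0[OF linear_Y2(3)[OF y]] by simp
  then show ?thesis using h3 by simp
qed

text \<open>The covector at \<open>pr_E y\<close> that \<open>\<phi> y\<close> induces. It is
  indexed by points of \<open>Y2\<close> because it can vary along the fibres of the projection; the
  choice is unique since \<open>dpr y\<close> is onto.\<close>

definition phi_E :: "'m Y2_point \<Rightarrow> E_covector" where
  "phi_E y = (SOME f. linear f \<and> (\<forall>v. f (dpr y v) = \<phi> y v))"

lemma
  assumes y: "y \<in> Y2"
  shows linear_phi_E: "linear (phi_E y)" and phi_E: "phi_E y (dpr y v) = \<phi> y v"
proof -
  have "surj (dpr y)" using dpr_surj[OF y] by (metis surjI)
  \<comment> \<open>A linear right inverse of \<open>dpr y\<close>. Lifts of one vector differ by a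
    vertical vector, on which \<open>\<phi> y\<close> vanishes, so \<open>\<phi> y \<circ> g\<close>
    is the required covector.\<close>
  then obtain g where g: "linear g" "dpr y \<circ> g = id"
    using linear_surjective_right_inverse[OF linear_dpr[OF y]] by blast
  have "\<phi> y (g (dpr y v)) = \<phi> y v" for v
  proof -
    have "dpr y (g (dpr y v) - v) = 0"
      using fun_cong[OF g(2), of "dpr y v"] by (simp add: linear_diff[OF linear_dpr[OF y]])
    from phi_vertical[OF y this] show ?thesis by (simp add: linear_diff[OF linear_phi[OF y]])
  qed
  then have "\<exists>f. linear f \<and> (\<forall>v. f (dpr y v) = \<phi> y v)"
    using linear_compose[OF g(1) linear_phi[OF y]] by (intro exI[of _ "\<phi> y \<circ> g"]) simp
  from someI_ex[OF this, folded phi_E_def] show "linear (phi_E y)" "phi_E y (dpr y v) = \<phi> y v" by blast+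
qed

definition cof :: "'m Y2_point \<Rightarrow> E_coframe" where
  "cof y = (taut (pr_E y), fst (snd (snd y)) \<circ> Eproj (pr_E y), snd (snd (snd y)) \<circ> Eproj (pr_E y), phi_E y)"

text \<open>The equation \<open>d_om\<close> on \<open>Y2\<close> transports to E because every
  tangent vector of E lifts along \<open>dpr y\<close>.\<close>

lemma d_taut:
  assumes y: "y \<in> Y2"
  shows "ext_deriv EA taut (pr_E y) u v = 2 * wedge (phi_E y) (taut (pr_E y)) u v
    + wedge (fst (snd (snd y)) \<circ> Eproj (pr_E y)) (snd (snd (snd y)) \<circ> Eproj (pr_E y)) u v"
proof -
  obtain u' v' where uv: "u = dpr y u'" "v = dpr y v'" using dpr_surj[OF y] by metis
  have "ext_deriv EA taut (pr_E y) u v = ext_deriv Y2A om y u' v'" unfolding uv ext_deriv_om[OF y] ..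
  then show ?thesis
    unfolding d_om[OF y] wedge_def om_eq[OF y] om1_eq[OF y] om2_eq[OF y] uv phi_E[OF y] o_apply .
qed

text \<open>Everything but bijectivity is inherited. The first three covectors vanish together
  exactly on the fibre direction of E, so the point is that \<open>phi_E y\<close> is nonzero
  there.\<close>

lemma cof_in:
  assumes y: "y \<in> Y2"
  shows "cof y \<in> Yf (pr_E y)"
proof -
  let ?e = "pr_E y" and ?w = "fst (snd y)" and ?w1 = "fst (snd (snd y))" and ?w2 = "snd (snd (snd y))"
  obtain c W X1 X2 X \<Theta> where l: "fst y \<in> W" "local_data c W X1 X2 X \<Theta>" using local_data_at[OF fst_Y2[OF y]] .
  note d = ld[OF l(2)] and e = pr_E_in[OF y]
  note v = Y2_values[OF y d(4) l(1)] and f = triv_frame[OF d(4) l(1)]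
  let ?X1 = "X1 (fst y)" and ?X2 = "X2 (fst y)" and ?X = "X (fst y)"
  let ?C = "E.bchart (c, W, Ecoord \<Theta>)"
  have CE: "?C \<in> EA" "?e \<in> fst ?C" unfolding EA_eq using E.bchart_in[OF ldE[OF l(2)]] e l(1) by (auto simp:
      E.fst_bchart)
  have eW: "fst ?e \<in> W" using l(1) by simp
  have cx: "fst y \<in> fst c" using l(1) d(3) by auto
  have lin: "linear (taut ?e)" "linear (?w1 \<circ> Eproj ?e)" "linear (?w2 \<circ> Eproj ?e)"
    using linear_compose[OF linear_E_proj[OF e]] linear_Y2[OF y] by (auto simp: E_taut_def)
  note proj = E_proj_tvec[OF d(1-3,5,6) e eW, unfolded fst_pr_E]
  \<comment> \<open>The fibre direction of E, the derivative with respect to the fibre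
    coordinate.\<close>
  define h0 where "h0 = tvec EA ?C ?e (0, 1)"
  have P0: "Eproj ?e h0 = 0" unfolding h0_def proj using linear_0[OF linear_tvec[OF atlas_M d(1) cx]] by simp
  have z0: "taut ?e h0 = 0" "?w1 (Eproj ?e h0) = 0" "?w2 (Eproj ?e h0) = 0"
    unfolding P0 E_taut_def o_apply using linear_0 linear_Y2[OF y] by auto
  \<comment> \<open>Otherwise \<open>d_taut\<close> would make the derivative of the tautological
    form vanish whenever \<open>h0\<close> is inserted, against
    \<open>ext_deriv_E_taut_vertical\<close>.\<close>
  have f0: "phi_E y h0 \<noteq> 0"
  proof
    assume 0: "phi_E y h0 = 0"
    obtain z where z: "\<Theta> (fst y) z \<noteq> 0" using kernel_nonzero[OF fst_Y2[OF y] form_kernel(2)[OF d(5,6) l(1)]] .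
    have "\<Theta> (fst y) z = ext_deriv EA taut ?e h0 (tvec EA ?C ?e (tcoord M c (fst y) z, 0))"
      unfolding h0_def using ext_deriv_E_taut_vertical[OF d(1-3,5,6) e eW] tvec_tcoord[OF atlas_M d(1) cx] by simp
    also have "\<dots> = 0" unfolding d_taut[OF y] wedge_def o_apply 0 z0 by simp
    finally show False using z by simp
  qed
  obtain h1 h2 h3 where h: "Eproj ?e h1 = ?X1" "Eproj ?e h2 = ?X2" "Eproj ?e h3 = ?X"
    using E_proj_surj[OF e] by metis
  have "bij (\<lambda>v. (taut ?e v, (?w1 \<circ> Eproj ?e) v, (?w2 \<circ> Eproj ?e) v, phi_E y v))" (is "bij ?q")
  proof (rule bijI)
    have linq: "linear ?q"
      by (rule linearI) (simp_all add: linear_add linear_scale linear_add[OF lin(1)] linear_scale[OF lin(1)]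
          linear_add[OF linear_phi_E[OF y]] linear_scale[OF linear_phi_E[OF y]]
          linear_add[OF lin(2), unfolded o_apply] linear_scale[OF lin(2), unfolded o_apply]
          linear_add[OF lin(3), unfolded o_apply] linear_scale[OF lin(3), unfolded o_apply])
    show "inj ?q"
      unfolding linear_injective_0[OF linq]
    proof (intro allI impI)
      fix u assume u: "?q u = 0"
      then have u': "?w (Eproj ?e u) = 0" "?w1 (Eproj ?e u) = 0" "?w2 (Eproj ?e u) = 0" "phi_E y u = 0"
        by (auto simp: zero_prod_def E_taut_def)
      obtain r1 r2 r3 where r: "Eproj ?e u = r1 *\<^sub>R ?X1 + r2 *\<^sub>R ?X2 + r3 *\<^sub>R ?X" using frame_span[OF f] by blast
      have "r1 = 0" "r2 = 0" "r3 = 0"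
        using u' v unfolding r by (auto simp: linear_add linear_scale)
      then have Pu: "Eproj ?e u = 0" using r by simp
      \<comment> \<open>In the chart a vector projecting to zero on M has only a fibre component,
        hence is a multiple of \<open>h0\<close>.\<close>
      obtain k \<rho> where k: "tcoord EA ?C ?e u = (k, \<rho>)" by (cases "tcoord EA ?C ?e u")
      then have uk: "u = tvec EA ?C ?e (k, \<rho>)" using tvec_tcoord[OF atlas_E CE, of u] by simp
      then have "tvec M c (fst y) k = 0" using Pu proj[of "(k, \<rho>)"] by simp
      then have "k = 0"
        using tcoord_tvec[OF atlas_M d(1) cx, of k] linear_0[OF linear_tcoord[OF atlas_M d(1) cx]] by simp
      then have "u = \<rho> *\<^sub>R h0"
        unfolding uk h0_def using linear_scale[OF linear_tvec[OF atlas_E CE], of \<rho> "(0, 1)"] by simp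
      then show "u = 0" using u'(4) f0 by (simp add: linear_scale[OF linear_phi_E[OF y]])
    qed
    show "surj ?q"
      unfolding surj_def
    proof
      fix p :: "real \<times> real \<times> real \<times> real"
      obtain p0 p1 p2 p3 where p: "p = (p0, p1, p2, p3)" by (cases p)
      \<comment> \<open>Lifts of the frame realise the three horizontal values; adding a multiple of
        \<open>h0\<close> then corrects the fourth without changing them.\<close>
      define k where "k = (p1 / ?w1 ?X1) *\<^sub>R h1 + (p2 / ?w2 ?X2) *\<^sub>R h2 + (p0 / ?w ?X) *\<^sub>R h3"
      have Pk: "Eproj ?e k = (p1 / ?w1 ?X1) *\<^sub>R ?X1 + (p2 / ?w2 ?X2) *\<^sub>R ?X2 + (p0 / ?w ?X) *\<^sub>R ?X"
        unfolding k_def using linear_E_proj[OF e] h by (simp add: linear_add linear_scale)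
      let ?k = "k + ((p3 - phi_E y k) / phi_E y h0) *\<^sub>R h0"
      have "Eproj ?e ?k = Eproj ?e k" using linear_E_proj[OF e] P0 by (simp add: linear_add linear_scale)
      then have "?w (Eproj ?e ?k) = p0" "?w1 (Eproj ?e ?k) = p1" "?w2 (Eproj ?e ?k) = p2"
        using Pk v by (auto simp: linear_add linear_scale)
      moreover have "phi_E y ?k = p3" using f0 linear_phi_E[OF y] by (simp add: linear_add linear_scale)
      ultimately show "\<exists>x. p = ?q x" unfolding p by (intro exI[of _ ?k]) (simp add: E_taut_def)
    qed
  qed
  moreover have "\<exists>t1. linear t1 \<and> (\<forall>v\<in>T2 (fst ?e). t1 v = 0) \<and> (\<exists>v\<in>T1 (fst ?e). t1 v \<noteq> 0) \<and> ?w1 \<circ> Eproj ?e = t1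
      \<circ> Eproj ?e"
    using linear_Y2(2)[OF y] f v frame_lines(2)[OF f]
    by (intro exI[of _ ?w1]) (auto simp: linear_scale frame_at_def intro: bexI[of _ ?X1])
  moreover have "\<exists>t2. linear t2 \<and> (\<forall>v\<in>T1 (fst ?e). t2 v = 0) \<and> (\<exists>v\<in>T2 (fst ?e). t2 v \<noteq> 0) \<and> ?w2 \<circ> Eproj ?e = t2
      \<circ> Eproj ?e"
    using linear_Y2(3)[OF y] f v frame_lines(1)[OF f]
    by (intro exI[of _ ?w2]) (auto simp: linear_scale frame_at_def intro: bexI[of _ ?X2])
  ultimately show ?thesis
    unfolding cof_def Y_fibre_def using lin linear_phi_E[OF y] d_taut[OF y] by simp
qed

section \<open>The embedding and its smoothness\<close>

text \<open>Restriction fixes the values outside \<open>Y2\<close>, as uniqueness among extensional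
  functions demands.\<close>

definition iota :: "'m Y2_point \<Rightarrow> 'm Y_point" where
  "iota = restrict (\<lambda>y. (pr_E y, cof y)) Y2"

lemma iota: "y \<in> Y2 \<Longrightarrow> iota y = (pr_E y, cof y)" and iota_in: "y \<in> Y2 \<Longrightarrow> iota y \<in> YS"
  using cof_in pr_E_in by (auto simp: iota_def Y_set_def)

text \<open>The point of E records \<open>\<omega>\<close>, and the coframe records
  \<open>\<omega>1\<close> and \<open>\<omega>2\<close> because the projection to M is onto on
  tangent vectors.\<close>

lemma iota_inj: "inj_on iota Y2"
proof (rule inj_onI)
  fix y y' assume y: "y \<in> Y2" "y' \<in> Y2" "iota y = iota y'"
  then have e: "pr_E y = pr_E y'" and c: "cof y = cof y'" by (auto simp: iota)
  have "fst (snd (snd y)) v = fst (snd (snd y')) v \<and> snd (snd (snd y)) v = snd (snd (snd y')) v" for v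
  proof -
    obtain h where "Eproj (pr_E y) h = v" using E_proj_surj[OF pr_E_in[OF y(1)]] by blast
    then show ?thesis using c e unfolding cof_def by (metis Pair_inject o_apply)
  qed
  then show "y = y'" using e by (simp add: pr_E_def prod_eq_iff fun_eq_iff)
qed

abbreviation "qsec s \<equiv> Ysec M T1 T2 (pull EA Y2A s om1) (pull EA Y2A s om2) (pull EA Y2A s \<phi>)"

text \<open>Pulling the forms back by a section \<open>s\<close> of \<open>pr_E\<close> gives a
  smooth coframe field on E. It equals \<open>cof \<circ> s\<close>, as \<open>dpr\<close> composed
  with the differential of \<open>s\<close> is the identity, so it is an admissible section of
  Y.\<close>

lemma
  assumes l: "local_data c W X1 X2 X \<Theta>" and b: "b > 0"
  defines "s \<equiv> sec c W X1 X2 \<Theta> b"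
  shows qsec_cof: "e \<in> sec_dom W X1 X2 \<Theta> \<Longrightarrow> qsec s e = cof (s e)"
    and qsec_section: "Ysection M T1 T2 (E.bchart (c, W, Ecoord \<Theta>)) (sec_dom W X1 X2 \<Theta>)
      (pull EA Y2A s om1) (pull EA Y2A s om2) (pull EA Y2A s \<phi>)"
proof -
  let ?V = "sec_dom W X1 X2 \<Theta>"
  show q: "qsec s e = cof (s e)" if e: "e \<in> ?V" for e
  proof -
    have y: "s e \<in> Y2" "pr_E (s e) = e" unfolding s_def using sec_in(1)[OF l b e] pr_E_sec[OF l b e] by auto
    have ds: "dpr (s e) (tangent_map EA Y2A s e v) = v" for v unfolding s_def by (rule dpr_sec[OF l b e])
    show ?thesis
      unfolding Ysec_def cof_def y(2) pull_def
      using om1_eq[OF y(1)] om2_eq[OF y(1)] phi_E[OF y(1), of "tangent_map EA Y2A s e _"] ds y(2)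
      by (auto simp: fun_eq_iff)
  qed
  note sm = sec_smooth[OF l b, folded s_def]
  have sV: "s ` ?V \<subseteq> Y2" using sec_in(1)[OF l b] by (auto simp: s_def)
  note p = form_on_pull[OF atlas_E atlas_Y2 sm(2) openin_Y2 sV]
  have "E.bchart (c, W, Ecoord \<Theta>) \<in> EA" unfolding EA_eq by (rule E.bchart_in[OF ldE[OF l]])
  moreover have "qsec s e \<in> Yf e" if e: "e \<in> ?V" for e
    unfolding q[OF e] using cof_in[of "s e"] sV e pr_E_sec[OF l b e] by (auto simp: s_def)
  ultimately show "Ysection M T1 T2 (E.bchart (c, W, Ecoord \<Theta>)) (sec_dom W X1 X2 \<Theta>)
      (pull EA Y2A s om1) (pull EA Y2A s om2) (pull EA Y2A s \<phi>)"
    unfolding Ysection_def using sm p[OF om12_form(1)] p[OF om12_form(2)] p[OF phi_form] by blast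
qed

text \<open>The group coordinate of \<open>iota y\<close> compares \<open>cof y\<close> with the
  smooth section at \<open>pr_E y\<close>. Pulled back to \<open>Y2\<close>, one coframe becomes
  \<open>om\<close>, \<open>om1\<close>, \<open>om2\<close>, \<open>\<phi>\<close> and the other the
  pull-back of a smooth coframe field; both are smooth forms, so \<open>smooth_Y_act\<close>
  applies.\<close>

lemma iota_smooth_at:
  assumes y: "y0 \<in> Y2"
  shows "smooth_map {y0} Y2A YA iota"
proof -
  obtain c W X1 X2 X \<Theta> where l: "fst y0 \<in> W" "local_data c W X1 X2 X \<Theta>" using local_data_at[OF fst_Y2[OF y]] .
  define b where "b = snd (Y2coord X1 X2 y0)"
  have b: "b > 0" unfolding b_def by (rule Y2coord_pos(2)[OF l(2) y l(1)])
  define s where "s = sec c W X1 X2 \<Theta> b"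
  let ?V = "sec_dom W X1 X2 \<Theta>" and ?C = "E.bchart (c, W, Ecoord \<Theta>)" and ?C2 = "Y2F.bchart (c, W, Y2coord X1 X2)"
  note sec = qsec_section[OF l(2) b, folded s_def]
  note S = Ysection_charts[OF sec]
  have C2: "?C2 \<in> Y2A" "y0 \<in> fst ?C2" unfolding Y2A_eq using Y2F.bchart_in[OF ldY2[OF l(2)]] y l(1) by (auto
      simp: Y2F.fst_bchart)
  define U where "U = {y \<in> Y2. pr_E y \<in> ?V}"
  have opU: "openin (mtop Y2A) U"
    unfolding U_def by (rule openin_smooth_preimage[OF atlas_Y2 atlas_E openin_Y2 pr_E_smooth S(2)])
  have y0U: "y0 \<in> U" unfolding U_def using y sec_pr_E(1)[OF l(2) y l(1)] by simp
  let ?W0 = "snd ?C2 ` (fst ?C2 \<inter> U)"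
  have op: "open ?W0" by (rule openin_chart_image[OF atlas_Y2 C2(1) opU])
  have cv: "cinv ?C2 u \<in> fst ?C2" "cinv ?C2 u \<in> U" if "u \<in> ?W0" for u
    using that cinv_chart[OF atlas_Y2 C2(1)] by auto
  let ?g = "\<lambda>u. Ycoord (qsec s) (iota (cinv ?C2 u))"
  have act: "fst (?g u) \<noteq> 0 \<and> cof (cinv ?C2 u) = Y_act (?g u) (qsec s (pr_E (cinv ?C2 u)))" if u: "u \<in> ?W0" for u
  proof -
    have yy: "cinv ?C2 u \<in> Y2" "pr_E (cinv ?C2 u) \<in> ?V" using cv(2)[OF u] by (auto simp: U_def)
    show ?thesis using Ycoord[OF iota_in[OF yy(1)], of "qsec s"] S(7)[OF yy(2)] by (simp add: iota[OF yy(1)])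
  qed
  have UV: "pr_E ` U \<subseteq> ?V" "U \<subseteq> Y2" by (auto simp: U_def)
  have cov: "smooth_covec ?W0 (formc Y2A ?C2 \<alpha>)" if "form_on Y2A U \<alpha>" for \<alpha>
    by (rule form_on_covec[OF atlas_Y2 C2(1) that])
  note pl = form_on_pull[OF atlas_Y2 atlas_E smooth_map_subset[OF pr_E_smooth UV(2)] S(2) UV(1)]
  note fs = cov[OF form_on_subset[OF om_form UV(2)]] cov[OF pl[OF S(4)]] cov[OF pl[OF S(5)]] cov[OF pl[OF S(6)]]
     cov[OF form_on_subset[OF om12_form(1) UV(2)]] cov[OF form_on_subset[OF om12_form(2) UV(2)]]
     cov[OF form_on_subset[OF phi_form UV(2)]]
  have "smooth_on ?W0 (\<lambda>u. (fst (?g u), fst (snd (?g u)), fst (snd (snd (?g u))), snd (snd (snd (?g u)))))"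
  proof (rule smooth_Y_act[OF op fs])
    fix u assume u: "u \<in> ?W0"
    let ?y = "cinv ?C2 u"
    have yy: "?y \<in> Y2" "pr_E ?y \<in> ?V" using cv(2)[OF u] by (auto simp: U_def)
    show "fst (?g u) \<noteq> 0" using act[OF u] by blast
    note eqs = conjunct2[OF act[OF u], unfolded cof_def Ysec_def[of _ _ _ _ _ _ "pr_E (cinv ?C2 u)"] Y_act_sel
        prod.inject, THEN conjunct2]
    \<comment> \<open>Relations between covectors on E become relations between forms on
      \<open>Y2\<close> by evaluation on \<open>dpr\<close>; nothing is lost because
      \<open>dpr\<close> is onto.\<close>
    let ?T = "\<lambda>h. dpr ?y (tvec Y2A ?C2 ?y h)"
    show "formc Y2A ?C2 om1 u h = fst (?g u) * formc Y2A ?C2 (pull Y2A EA pr_E (pull EA Y2A s om1)) u h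
        + fst (snd (?g u)) * formc Y2A ?C2 om u h"
      "formc Y2A ?C2 om2 u h = (1 / fst (?g u)) * formc Y2A ?C2 (pull Y2A EA pr_E (pull EA Y2A s om2)) u h
        + fst (snd (snd (?g u))) * formc Y2A ?C2 om u h"
      "formc Y2A ?C2 \<phi> u h = formc Y2A ?C2 (pull Y2A EA pr_E (pull EA Y2A s \<phi>)) u h
        - 1/2 * fst (?g u) * fst (snd (snd (?g u))) * formc Y2A ?C2 (pull Y2A EA pr_E (pull EA Y2A s om1)) u h
        + 1/2 * (1 / fst (?g u)) * fst (snd (?g u)) * formc Y2A ?C2 (pull Y2A EA pr_E (pull EA Y2A s om2)) u h
        + snd (snd (snd (?g u))) * formc Y2A ?C2 om u h" for h
      using fun_cong[OF eqs[THEN conjunct1], of "?T h"] fun_cong[OF eqs[THEN conjunct2, THEN conjunct1], of "?T h"]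
        fun_cong[OF eqs[THEN conjunct2, THEN conjunct2], of "?T h"]
      unfolding formc_def pull_def[of Y2A EA pr_E] om_eq[OF yy(1)] om1_eq[OF yy(1)] om2_eq[OF yy(1)]
        phi_E[OF yy(1), symmetric] by simp_all
    note ind = Y_indep[OF S(8,7)[OF yy(2), unfolded Ysec_def]]
    have lift: "\<exists>h. P (?T h)" if "\<exists>h. P h" for P
      using that dpr_surj[OF yy(1)] tvec_tcoord[OF atlas_Y2 C2(1) cv(1)[OF u]] by metis
    show "\<exists>h. formc Y2A ?C2 om u h = 0 \<and> formc Y2A ?C2 (pull Y2A EA pr_E (pull EA Y2A s om1)) u h \<noteq> 0"
      "\<exists>h. formc Y2A ?C2 om u h = 0 \<and> formc Y2A ?C2 (pull Y2A EA pr_E (pull EA Y2A s om2)) u h \<noteq> 0"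
      "\<exists>h. formc Y2A ?C2 om u h \<noteq> 0"
      unfolding formc_def pull_def[of Y2A EA pr_E] om_eq[OF yy(1)]
      by (rule lift[OF ind(1)] lift[OF ind(2)] lift[OF ind(3)])+
  qed
  then have sg: "smooth_on ?W0 ?g" by simp
  show ?thesis
    unfolding YA_eq
  proof (rule Y.smooth_map_into[OF YidxI[OF sec] C2 op])
    show "snd ?C2 y0 \<in> ?W0" using C2(2) y0U by blast
    show "?W0 \<subseteq> snd ?C2 ` fst ?C2" by blast
    show "smooth_atlas Y2A" by (rule atlas_Y2)
    show "iota (cinv ?C2 u) \<in> YS \<and> fst (iota (cinv ?C2 u)) \<in> ?V" if "u \<in> ?W0" for u
      using cv(2)[OF that] iota_in by (auto simp: U_def iota)
    have "smooth_on ?W0 (snd ?C \<circ> pr_E \<circ> cinv ?C2)"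
      by (rule smooth_on_charts[OF atlas_Y2 atlas_E pr_E_smooth C2(1) S(1)])
        (use UV cv(2) S(3) in blast)+
    then show "smooth_on ?W0 (\<lambda>u. snd ?C (fst (iota (cinv ?C2 u))))"
    proof (rule smooth_on_cong[OF _ op])
      fix u assume "u \<in> ?W0"
      then have "cinv ?C2 u \<in> Y2" using cv(2) UV(2) by blast
      then show "(snd ?C \<circ> pr_E \<circ> cinv ?C2) u = snd ?C (fst (iota (cinv ?C2 u)))" by (simp add: iota)
    qed
    show "smooth_on ?W0 ?g" by (rule sg)
  qed
qed

lemma iota_smooth: "smooth_map Y2 Y2A YA iota"
  unfolding smooth_map_iff[of Y2] using iota_smooth_at by blast

text \<open>A smooth local left inverse of \<open>\<iota>\<^sub>2\<close> in charts: \<open>\<omega>\<^sup>1(X\<^sub>1)\<close> and \<open>\<omega>\<^sup>2(X\<^sub>2)\<close> can be read off the coframe.\<close>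

lemma iota_left_inverse:
  assumes y0: "y0 \<in> Y2" and C2: "C2 \<in> Y2A" "y0 \<in> fst C2"
  obtains \<rho> D where "D \<in> YA" "iota y0 \<in> fst D" "smooth_on (snd D ` fst D) \<rho>"
    "\<And>y. y \<in> Y2 \<Longrightarrow> iota y \<in> fst D \<Longrightarrow> y \<in> fst C2 \<and> \<rho> (snd D (iota y)) = snd C2 y"
proof -
  obtain c W' X1 X2 X where C: "C2 = Y2F.bchart (c, W', Y2coord X1 X2)" "c \<in> M" "W' \<subseteq> fst c" "triv W' X1 X2 X"
    using C2(1) unfolding Y2A_eq Y2F.atl_def by (blast elim: Y2idxE)
  have x0: "fst y0 \<in> W'" using C2(2) C(1) by (simp add: Y2F.fst_bchart)
  then have "fst y0 \<in> fst c" using C(3) by auto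
  then obtain W \<Theta> where l: "fst y0 \<in> W" "W \<subseteq> W'" "local_data c W X1 X2 X \<Theta>"
    using local_data_exists[OF fst_Y2[OF y0] C(2) _ C(4) x0] by metis
  define b where "b = snd (Y2coord X1 X2 y0)"
  have b: "b > 0" unfolding b_def by (rule Y2coord_pos(2)[OF l(3) y0 l(1)])
  define s where "s = sec c W X1 X2 \<Theta> b"
  let ?V = "sec_dom W X1 X2 \<Theta>" and ?C = "E.bchart (c, W, Ecoord \<Theta>)"
  note sec = qsec_section[OF l(3) b, folded s_def] and qc = qsec_cof[OF l(3) b, folded s_def]
  note S = Ysection_charts[OF sec] and ix = YidxI[OF sec] and d = ld[OF l(3)]
  let ?D = "Y.bchart (?C, ?V, Ycoord (qsec s))"
  \<comment> \<open>Here \<open>z = ((x, r), (g, v1, v2, s))\<close>. The section has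
    \<open>\<omega>1(X1) = r \<kappa> / b\<close> and \<open>\<omega>2(X2) = b\<close>; the group
    element multiplies these by \<open>g\<close> and \<open>1 / g\<close>.\<close>
  let ?\<rho> = "\<lambda>z. (fst (fst z), (fst (snd z) * (snd (fst z) * kap \<Theta> X1 X2 (cinv c (fst (fst z))) / b), (1 / fst
      (snd z)) * b))"
  let ?S = "snd ?C ` ?V \<times> YK"
  have rg: "snd ?D ` fst ?D = ?S" by (rule Y.bchart_range[OF ix])
  note op = Y.open_bchart_range[OF ix]
  show thesis
  proof (rule that[of ?D ?\<rho>])
    show "?D \<in> YA" unfolding YA_eq by (rule Y.bchart_in[OF ix])
    show "iota y0 \<in> fst ?D" using iota_in[OF y0] iota[OF y0] sec_pr_E(1)[OF l(3) y0 l(1)] by (simp add: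
        Y.fst_bchart)
    have zW: "fst (fst z) \<in> snd c ` W" "fst (snd z) \<noteq> 0" if "z \<in> ?S" for z
      using that by (auto simp: sec_dom_def E.snd_bchart YK_def)
    have "smooth_on ?S (\<lambda>z. kap \<Theta> X1 X2 (cinv c (fst (fst z))))"
      by (rule smooth_on_compose[OF kap_smooth[OF l(3)] smooth_on_fst[OF smooth_on_fst[OF smooth_on_id]] op(1)])
        (rule triv_smooth(2)[OF d(4,1,3)], use zW(1) in blast)
    then show "smooth_on (snd ?D ` fst ?D) ?\<rho>"
      unfolding rg by (intro smooth_intros op) (use b zW in auto)
    fix y assume y: "y \<in> Y2" "iota y \<in> fst ?D"
    let ?e = "pr_E y" and ?g = "Ycoord (qsec s) (iota y)"
    have e: "?e \<in> ?V" using y by (simp add: Y.fst_bchart iota)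
    then have yW: "fst y \<in> W" by (simp add: sec_dom_def)
    have cx: "cinv c (snd c (fst y)) = fst y" using cinv_chart[OF atlas_M d(1)] d(3) yW by auto
    have "cof y = Y_act ?g (cof (s ?e))"
      using Ycoord(1)[OF iota_in[OF y(1)], of "qsec s"] S(7)[OF e] qc[OF e] by (simp add: iota[OF y(1)])
    note eqs = this[unfolded cof_def Y_act_sel prod.inject, THEN conjunct2]
    have se: "s ?e \<in> Y2" "fst (s ?e) = fst y" "Y2coord X1 X2 (s ?e) = (Ecoord \<Theta> ?e * kap \<Theta> X1 X2 (fst y) / b,
        b)" "pr_E (s ?e) = ?e"
      unfolding s_def using sec_in[OF l(3) b e] pr_E_sec[OF l(3) b e] by simp_all
    obtain h1 h2 where h: "Eproj ?e h1 = X1 (fst y)" "Eproj ?e h2 = X2 (fst y)" using E_proj_surj[OF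
        pr_E_in[OF y(1)]] by metis
    note v = Y2_values[OF y(1) d(4) yW]
    \<comment> \<open>On lifts of \<open>X1\<close> and \<open>X2\<close> the translations by
      multiples of \<open>\<omega>\<close> vanish, leaving only the scaling by the group
      element.\<close>
    have "taut ?e h1 = 0" "taut ?e h2 = 0" using h v by (simp_all add: E_taut_def)
    then have "fst (Y2coord X1 X2 y) = fst ?g * fst (Y2coord X1 X2 (s ?e))"
      "snd (Y2coord X1 X2 y) = (1 / fst ?g) * snd (Y2coord X1 X2 (s ?e))"
      using fun_cong[OF eqs[THEN conjunct1], of h1] fun_cong[OF eqs[THEN conjunct2, THEN conjunct1], of h2] h
          se(2,4)
      by (simp_all add: Y2coord_def)
    then show "y \<in> fst C2 \<and> ?\<rho> (snd ?D (iota y)) = snd C2 y"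
      using yW l(2) y(1) cx unfolding C(1) Y2F.snd_bchart Y.snd_bchart Y2F.fst_bchart iota[OF y(1)] fst_conv
          E.snd_bchart snd_conv
      by (auto simp: se(3) prod_eq_iff iota[OF y(1)])
  qed
qed

section \<open>Immersion and homeomorphism onto the image\<close>

text \<open>The left inverse composed with the coordinate expression of \<open>iota\<close> is the
  identity near the point, so the differential of \<open>iota\<close> has a left inverse
  too.\<close>

lemma iota_immersion:
  assumes y: "y \<in> Y2"
  shows "inj (tangent_map Y2A YA iota y)"
proof -
  have yp: "y \<in> points Y2A" using y by (simp add: points_Y2A)
  note c2 = chart_at_in[OF yp]
  let ?C2 = "chart_at Y2A y"
  obtain D \<rho> where D: "D \<in> YA" "iota y \<in> fst D" "smooth_on (snd D ` fst D) \<rho>"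
    "\<And>y. y \<in> Y2 \<Longrightarrow> iota y \<in> fst D \<Longrightarrow> y \<in> fst ?C2 \<and> \<rho> (snd D (iota y)) = snd ?C2 y"
    using iota_left_inverse[OF y c2] by metis
  note sm = iota_smooth_at[OF y]
  obtain W where W: "open W" "snd ?C2 y \<in> W" "W \<subseteq> snd ?C2 ` fst ?C2" "iota ` cinv ?C2 ` W \<subseteq> fst D"
    "smooth_on W (snd D \<circ> iota \<circ> cinv ?C2)"
    by (rule smooth_on_chart_map[OF sm atlas_Y2 atlas_Y c2 D(1,2)])
  have dm: "(snd D \<circ> iota \<circ> cinv ?C2 has_derivative dmap ?C2 D iota y) (at (snd ?C2 y))"
    by (rule dmap_has_derivative[OF atlas_Y2 c2 atlas_Y D(1,2) sm])
  have cy: "cinv ?C2 (snd ?C2 y) = y" by (rule cinv_chart[OF atlas_Y2 c2])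
  have "(\<rho> has_derivative FD \<rho> (snd D (iota y))) (at (snd D (iota y)))"
    by (rule smooth_on_has_derivative[OF D(3) chart_open[OF atlas_Y D(1)]]) (use D(2) in blast)
  then have "((\<lambda>u. \<rho> ((snd D \<circ> iota \<circ> cinv ?C2) u)) has_derivative
      (\<lambda>v. FD \<rho> (snd D (iota y)) (dmap ?C2 D iota y v))) (at (snd ?C2 y))"
    by (intro has_derivative_compose[OF dm]) (simp add: cy)
  then have "((\<lambda>u. u) has_derivative (\<lambda>v. FD \<rho> (snd D (iota y)) (dmap ?C2 D iota y v))) (at (snd ?C2 y))"
  proof (rule has_derivative_transform_open[OF _ W(1,2)])
    fix u assume u: "u \<in> W"
    then have uc: "u \<in> snd ?C2 ` fst ?C2" using W(3) by auto
    have "cinv ?C2 u \<in> Y2" using cinv_in[OF atlas_Y2 c2(1) uc] pointsI[OF c2(1)] points_Y2A by blast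
    moreover have "iota (cinv ?C2 u) \<in> fst D" using W(4) u by blast
    ultimately show "\<rho> ((snd D \<circ> iota \<circ> cinv ?C2) u) = u" using D(4) chart_cinv[OF atlas_Y2 c2(1) uc] by simp
  qed
  then have id: "FD \<rho> (snd D (iota y)) (dmap ?C2 D iota y v) = v" for v
    using fun_cong[OF has_derivative_unique[OF _ has_derivative_ident], of _ _ v] by blast
  have tm: "dmap ?C2 D iota y v = tcoord YA D (iota y) (tangent_map Y2A YA iota y v)" for v
  proof -
    have "tangent_map Y2A YA iota y (tvec Y2A ?C2 y v) = tvec YA D (iota y) (dmap ?C2 D iota y v)"
      by (rule tangent_map_tvec[OF atlas_Y2 atlas_Y sm c2 D(1,2)])
    moreover have "tvec Y2A ?C2 y v = v" unfolding tvec_dmap by (rule dmap_id[OF atlas_Y2 c2])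
    ultimately show ?thesis using tcoord_tvec[OF atlas_Y D(1,2)] by simp
  qed
  show ?thesis by (rule injI) (metis id tm)
qed

lemma iota_embedding: "embedding_map (mtop Y2A) (mtop YA) iota"
  unfolding embedding_map_def topspace_mtop points_Y2A
proof (rule bijective_open_imp_homeomorphic_map)
  have iY: "iota y \<in> points YA" if "y \<in> Y2" for y using smooth_map_points(2)[OF iota_smooth_at[OF that]] .
  have cont: "continuous_map (mtop Y2A) (mtop YA) iota"
    unfolding continuous_map_def topspace_mtop points_Y2A
    using iY openin_smooth_preimage[OF atlas_Y2 atlas_Y openin_Y2 iota_smooth] by auto
  then show "continuous_map (mtop Y2A) (subtopology (mtop YA) (iota ` Y2)) iota"
    by (simp add: continuous_map_in_subtopology points_Y2A)
  show "iota ` topspace (mtop Y2A) = topspace (subtopology (mtop YA) (iota ` Y2))"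
    using iY by (auto simp: points_Y2A)
  show "inj_on iota (topspace (mtop Y2A))" using iota_inj by (simp add: points_Y2A)
  show "open_map (mtop Y2A) (subtopology (mtop YA) (iota ` Y2)) iota"
    unfolding open_map_def
  proof (intro allI impI)
    fix U assume U: "openin (mtop Y2A) U"
    then have UY: "U \<subseteq> Y2" using openin_subset points_Y2A by (metis topspace_mtop)
    show "openin (subtopology (mtop YA) (iota ` Y2)) (iota ` U)"
    proof (subst openin_subopen, intro ballI)
      fix z assume "z \<in> iota ` U"
      then obtain y0 where y0: "y0 \<in> U" "z = iota y0" by blast
      have y0Y: "y0 \<in> Y2" using y0 UY by blast
      then have yp: "y0 \<in> points Y2A" by (simp add: points_Y2A)
      note c2 = chart_at_in[OF yp]
      let ?C2 = "chart_at Y2A y0"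
      obtain D \<rho> where D: "D \<in> YA" "iota y0 \<in> fst D" "smooth_on (snd D ` fst D) \<rho>"
        "\<And>y. y \<in> Y2 \<Longrightarrow> iota y \<in> fst D \<Longrightarrow> y \<in> fst ?C2 \<and> \<rho> (snd D (iota y)) = snd ?C2 y"
        using iota_left_inverse[OF y0Y c2] by metis
      let ?Q = "snd ?C2 ` (fst ?C2 \<inter> U)"
      let ?P = "snd D ` fst D \<inter> \<rho> -` ?Q"
      have "open ?P"
        by (rule continuous_open_preimage[OF smooth_on_continuous[OF D(3)] chart_open[OF atlas_Y D(1)]
              openin_chart_image[OF atlas_Y2 c2(1) U]])
      from openin_chart_preimage[OF D(1) this]
      have N: "openin (mtop YA) {z \<in> fst D. snd D z \<in> ?P}" .
      \<comment> \<open>It matters that the left inverse works for every \<open>y\<close> with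
        \<open>iota y\<close> in the chart domain, and not merely for \<open>y\<close> close to
        \<open>y0\<close>.\<close>
      have "y \<in> U" if "y \<in> Y2" "iota y \<in> fst D" "snd D (iota y) \<in> ?P" for y
      proof -
        have "y \<in> fst ?C2" "snd ?C2 y \<in> ?Q" using D(4)[OF that(1,2)] that(3) by auto
        then show ?thesis using chart_inj[OF atlas_Y2 c2(1)] by (auto dest: inj_onD)
      qed
      then have "iota ` Y2 \<inter> {z \<in> fst D. snd D z \<in> ?P} \<subseteq> iota ` U" by blast
      moreover have "z \<in> iota ` Y2 \<inter> {z \<in> fst D. snd D z \<in> ?P}"
        using y0 UY D(2) D(4)[of y0] c2(2) by auto
      moreover have "openin (subtopology (mtop YA) (iota ` Y2)) (iota ` Y2 \<inter> {z \<in> fst D. snd D z \<in> ?P})"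
        using N by (auto simp: openin_subtopology)
      ultimately show "\<exists>T. openin (subtopology (mtop YA) (iota ` Y2)) T \<and> z \<in> T \<and> T \<subseteq> iota ` U" by blast
    qed
  qed
qed

section \<open>Pull-backs and uniqueness\<close>

lemma fst_smooth_Y:
  assumes "z \<in> points YA" shows "smooth_map {z} YA EA fst"
proof -
  obtain D where "D \<in> YA" "z \<in> fst D" using assms by (auto simp: points_def)
  then obtain C V \<eta>1 \<eta>2 \<psi> where "D = Y.bchart (C, V, Ycoord (Ysec M T1 T2 \<eta>1 \<eta>2 \<psi>))" "Ysection M T1 T2 C V \<eta>1 \<eta>2 \<psi>"
    unfolding YA_eq Y.atl_def by (blast elim: YidxE)
  then show ?thesis
    unfolding YA_eq using Y.pr_smooth_bchart(1)[OF YidxI] \<open>z \<in> fst D\<close> by (auto simp: Y.fst_bchart)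
qed

lemma Y_proj_comp:
  assumes y: "y \<in> Y2" and F: "smooth_map {y} Y2A YA F"
  shows "Y_proj M T1 T2 (F y) (tangent_map Y2A YA F y v) = tangent_map Y2A EA (fst \<circ> F) y v"
    "smooth_map {y} Y2A EA (fst \<circ> F)"
proof -
  note f = fst_smooth_Y[OF smooth_map_points(2)[OF F]]
  show "Y_proj M T1 T2 (F y) (tangent_map Y2A YA F y v) = tangent_map Y2A EA (fst \<circ> F) y v"
    unfolding Y_proj_def by (rule tangent_map_comp[OF atlas_Y2 atlas_Y atlas_E F f, symmetric])
  show "smooth_map {y} Y2A EA (fst \<circ> F)" by (rule smooth_map_comp(1)[OF atlas_Y2 atlas_Y atlas_E F f])
qed

lemma Y_forms:
  "Y_omega M T1 T2 z v = fst (snd z) (Y_proj M T1 T2 z v)"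
  "Y_omega1 M T1 T2 z v = fst (snd (snd z)) (Y_proj M T1 T2 z v)"
  "Y_omega2 M T1 T2 z v = fst (snd (snd (snd z))) (Y_proj M T1 T2 z v)"
  "Y_phi M T1 T2 z v = snd (snd (snd (snd z))) (Y_proj M T1 T2 z v)"
  by (simp_all add: Y_omega_def Y_omega1_def Y_omega2_def Y_phi_def split: prod.split)

text \<open>Stated for any smooth lift of \<open>pr_E\<close>, so that it serves both
  \<open>iota\<close> and a competing map.\<close>

lemma tangent_lift_pr_E:
  assumes y: "y \<in> Y2" and F: "smooth_map {y} Y2A YA F" "\<And>y. y \<in> Y2 \<Longrightarrow> fst (F y) = pr_E y"
  shows "Y_proj M T1 T2 (F y) (tangent_map Y2A YA F y v) = dpr y v"
proof -
  have "tangent_map Y2A EA (fst \<circ> F) y = dpr y"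
    by (rule smooth_map_cong(3)[OF atlas_Y2 atlas_E Y_proj_comp(2)[OF y F(1)] openin_Y2 y]) (use F(2) in auto)
  then show ?thesis using Y_proj_comp(1)[OF y F(1)] by simp
qed

lemma iota_pulls_back:
  "pulls_back Y2 Y2A YA iota (Y_omega M T1 T2) om" "pulls_back Y2 Y2A YA iota (Y_omega1 M T1 T2) om1"
  "pulls_back Y2 Y2A YA iota (Y_omega2 M T1 T2) om2" "pulls_back Y2 Y2A YA iota (Y_phi M T1 T2) \<phi>"
proof -
  have t: "Y_proj M T1 T2 (iota y) (tangent_map Y2A YA iota y v) = dpr y v" if "y \<in> Y2" for y v
    by (rule tangent_lift_pr_E[OF that iota_smooth_at[OF that]]) (simp add: iota)
  show "pulls_back Y2 Y2A YA iota (Y_omega M T1 T2) om" "pulls_back Y2 Y2A YA iota (Y_omega1 M T1 T2) om1"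
    "pulls_back Y2 Y2A YA iota (Y_omega2 M T1 T2) om2" "pulls_back Y2 Y2A YA iota (Y_phi M T1 T2) \<phi>"
    unfolding pulls_back_def Y_forms
    using t by (auto simp: iota cof_def om_eq om1_eq om2_eq phi_E)
qed

lemma iota_unique:
  assumes F: "smooth_map Y2 Y2A YA F" "F ` Y2 \<subseteq> YS" "\<And>y. y \<in> Y2 \<Longrightarrow> fst (fst (F y)) = fst y"
    and p: "pulls_back Y2 Y2A YA F (Y_omega M T1 T2) om" "pulls_back Y2 Y2A YA F (Y_omega1 M T1 T2) om1"
      "pulls_back Y2 Y2A YA F (Y_omega2 M T1 T2) om2" "pulls_back Y2 Y2A YA F (Y_phi M T1 T2) \<phi>"
    and y: "y \<in> Y2"
  shows "F y = iota y"
proof -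
  have pr: "fst (F y) = pr_E y" if y: "y \<in> Y2" for y
  proof -
    have sm: "smooth_map {y} Y2A YA F" by (rule smooth_map_singleton[OF F(1) y])
    have Fe: "fst (F y) \<in> E" "snd (F y) \<in> Yf (fst (F y))" using F(2) y by (auto simp: Y_set_def)
    have taut: "fst (snd (F y)) = taut (fst (F y))" using Fe(2) by (auto simp: Y_fibre_def)
    note c = Y_proj_comp[OF y sm]
    have "tangent_map Y2A M (fst \<circ> (fst \<circ> F)) y v = Eproj (fst (F y)) (tangent_map Y2A EA (fst \<circ> F) y v)" for v
      unfolding E_proj_def
      using tangent_map_comp[OF atlas_Y2 atlas_E atlas_M c(2), of fst] fst_smooth_E[OF Fe(1)] by simp
    \<comment> \<open>Covering the identity of M enters here: both maps to M coincide, hence so do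
      their differentials.\<close>
    moreover have "tangent_map Y2A M (fst \<circ> (fst \<circ> F)) y = Y2_proj M T1 T2 L Y2 y"
      unfolding Y2_proj_def
      by (rule smooth_map_cong(3)[OF atlas_Y2 atlas_M smooth_map_comp(1)[OF atlas_Y2 atlas_E atlas_M c(2)]
          openin_Y2 y])
        (use fst_smooth_E[OF Fe(1)] F(3) in auto)
    ultimately have proj: "Eproj (fst (F y)) (tangent_map Y2A EA (fst \<circ> F) y v) = Y2_proj M T1 T2 L Y2 y v" for
        v by simp
    have "snd (fst (F y)) (Y2_proj M T1 T2 L Y2 y v) = om y v" for v
    proof -
      have "Y_omega M T1 T2 (F y) (tangent_map Y2A YA F y v) = om y v" using p(1) y unfolding pulls_back_def by
          blast
      then show ?thesis unfolding Y_forms taut c(1) E_taut_def o_apply proj .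
    qed
    then have "snd (fst (F y)) (Y2_proj M T1 T2 L Y2 y v) = fst (snd y) (Y2_proj M T1 T2 L Y2 y v)" for v
      by (simp add: Y2_omega_def split: prod.split)
    \<comment> \<open>Since the projection to M is onto on tangent vectors, agreement after
      projection is agreement of the covectors on M.\<close>
    moreover have "\<exists>v. Y2_proj M T1 T2 L Y2 y v = h" for h
      using Y2_proj_dpr[OF y] dpr_surj[OF y] E_proj_surj[OF pr_E_in[OF y]] by metis
    ultimately have "snd (fst (F y)) = fst (snd y)" by (metis ext)
    then show ?thesis using F(3)[OF y] by (simp add: prod_eq_iff)
  qed
  have t: "Y_proj M T1 T2 (F y) (tangent_map Y2A YA F y v) = dpr y v" for v
    by (rule tangent_lift_pr_E[OF y smooth_map_singleton[OF F(1) y] pr])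
  have pb: "fst (snd (F y)) (dpr y v) = om y v" "fst (snd (snd (F y))) (dpr y v) = om1 y v"
    "fst (snd (snd (snd (F y)))) (dpr y v) = om2 y v" "snd (snd (snd (snd (F y)))) (dpr y v) = \<phi> y v" for v
    unfolding t[symmetric] Y_forms[symmetric] using p y unfolding pulls_back_def by blast+
  have "fst (snd (F y)) h = taut (pr_E y) h \<and> fst (snd (snd (F y))) h = fst (snd (snd y)) (Eproj (pr_E y) h) \<and>
    fst (snd (snd (snd (F y)))) h = snd (snd (snd y)) (Eproj (pr_E y) h) \<and> snd (snd (snd (snd (F y)))) h =
        phi_E y h" for h
  proof -
    obtain v where v: "h = dpr y v" using dpr_surj[OF y] by metis
    show ?thesis unfolding v pb om_eq[OF y] om1_eq[OF y] om2_eq[OF y] phi_E[OF y] by simp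
  qed
  then have "snd (F y) = cof y" unfolding cof_def by (simp add: prod_eq_iff fun_eq_iff)
  then show ?thesis using pr[OF y] by (simp add: iota[OF y] prod_eq_iff)
qed

lemma iota_smooth_embedding: "smooth_embedding Y2 Y2A YS YA iota"
  unfolding smooth_embedding_def using iota_in iota_smooth iota_immersion iota_embedding by blast

end

theorem proposition3p4:
  fixes M :: "('m, real^3) atlas"
    and T1 T2 L :: "'m \<Rightarrow> (real^3) set"
    and Y2 :: "'m Y2_point set"
    and \<phi> w :: "'m Y2_point \<Rightarrow> Y2_model \<Rightarrow> real"
    and \<tau>12 \<tau>21 :: "'m Y2_point \<Rightarrow> real"
  assumes "smooth_manifold M"
    and "enriched_path_structure M T1 T2 L"
    and "Y2_bundle M T1 T2 L Y2"
    and "form_on (Y2_atlas M T1 T2 L Y2) Y2 \<phi>"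
    and "form_on (Y2_atlas M T1 T2 L Y2) Y2 w"
    and "Y2_structure_equations M T1 T2 L Y2 \<phi> w \<tau>12 \<tau>21"
  shows "\<exists>!\<iota>. \<iota> \<in> extensional Y2 \<and>
    smooth_embedding Y2 (Y2_atlas M T1 T2 L Y2) (Y_set M T1 T2) (Y_atlas M T1 T2) \<iota> \<and>
    (\<forall>y\<in>Y2. fst (fst (\<iota> y)) = fst y) \<and>
    pulls_back Y2 (Y2_atlas M T1 T2 L Y2) (Y_atlas M T1 T2) \<iota>
      (Y_omega M T1 T2) (Y2_omega M T1 T2 L Y2) \<and>
    pulls_back Y2 (Y2_atlas M T1 T2 L Y2) (Y_atlas M T1 T2) \<iota>
      (Y_omega1 M T1 T2) (Y2_omega1 M T1 T2 L Y2) \<and>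
    pulls_back Y2 (Y2_atlas M T1 T2 L Y2) (Y_atlas M T1 T2) \<iota>
      (Y_omega2 M T1 T2) (Y2_omega2 M T1 T2 L Y2) \<and>
    pulls_back Y2 (Y2_atlas M T1 T2 L Y2) (Y_atlas M T1 T2) \<iota>
      (Y_phi M T1 T2) \<phi>"
proof -
  interpret enriched_phi M T1 T2 L Y2 \<phi>
    by unfold_locales (use assms in \<open>auto simp: Y2_structure_equations_def Let_def\<close>)
  show ?thesis
  proof (rule ex1I[of _ iota], intro conjI)
    show "iota \<in> extensional Y2" by (simp add: iota_def)
    show "\<forall>y\<in>Y2. fst (fst (iota y)) = fst y" by (simp add: iota)
  next
    fix F assume F: "F \<in> extensional Y2 \<and> smooth_embedding Y2 Y2A YS YA F \<and> (\<forall>y\<in>Y2. fst (fst (F y)) = fst y) \<and>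
      pulls_back Y2 Y2A YA F (Y_omega M T1 T2) om \<and> pulls_back Y2 Y2A YA F (Y_omega1 M T1 T2) om1 \<and>
      pulls_back Y2 Y2A YA F (Y_omega2 M T1 T2) om2 \<and> pulls_back Y2 Y2A YA F (Y_phi M T1 T2) \<phi>"
    have "F y = iota y" if "y \<in> Y2" for y
      by (rule iota_unique) (use F that in \<open>auto simp: smooth_embedding_def\<close>)
    \<comment> \<open>Agreement on \<open>Y2\<close> becomes equality of functions because both take
      the default value elsewhere.\<close>
    moreover have "F \<in> extensional Y2" "iota \<in> extensional Y2" using F by (auto simp: iota_def)
    ultimately show "F = iota" by (rule extensionalityI[rotated 2])
  qed (rule iota_smooth_embedding iota_pulls_back)+
qed

end
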